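(* Consider the $(n+1)$-point bandit game with tree-compatible losses described in the context, with $n\in\{1,\dots,L\}$ and scales $\sigma_1\ge\dots\ge\sigma_L>0$. Let $\mathcal D$ be a probability distribution over the subsets of $\{1,\dots,L\}$ of cardinality $n$, and let $\xi_j=\Pr_{S\sim\mathcal D}(j\in S)$, assumed positive for all $j$. Let $c\ge2$ and $$\psi_t(x)=\frac{4\sqrt c}{\sqrt{c-1}}\sum_{j=1}^L\frac{\sigma_j}{\sqrt{\xi_j}}\max\Big\{\sqrt t,\sqrt{c(c-1)/\xi_j}\Big\}\sum_{v\in V_j}\big(x[v]-\sqrt{x[v]}\big),\qquad x\in\mathbb R_+^K.$$ Then the $(n+1)$-point FTRL algorithm described in the context, with these regularizers and $b_j=\sigma_j$ for all $j$, satisfies for every $T\ge1$ $$\mathrm{Reg}^{(n+1)}_T\le6c\sum_{j=1}^L\frac{\sigma_j}{\xi_j}\sqrt{|V_j|}+\frac{16\sqrt c}{\sqrt{c-1}}\sum_{j=1}^L\frac{\sigma_j}{\sqrt{\xi_j}}\sqrt{|V_j|T}.$$ Further, if there exists $\Delta\in\mathbb R_+^K$ with $|\{a\in\mathcal A:\Delta(a)=0\}|\le1$ such that $\mathrm{Reg}^{(n+1)}_T\ge\mathbb E\sum_{t=1}^T\frac1{n+1}\sum_{i=1}^{n+1}\Delta(A_{t,i})$ holds for any algorithm, then the same algorithm also satisfies $$\mathrm{Reg}^{(n+1)}_T\le12c\sum_{j=1}^L\frac{\sigma_j}{\xi_j}\sqrt{|V_j|}+\frac{64c}{c-1}\Big(\sum_{j=1}^L\frac{\sigma_j}{\sqrt{\xi_j}}\sqrt{\Gamma(j,\Delta)}\Big)^2\ln(eT),$$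 where $\Gamma(j,\Delta)=\sum_{v\in V_j:\ \min_{a\succeq v}\Delta(a)\ne0}\frac1{\min_{a\succeq v}\Delta(a)}$ and $a\succeq v$ ranges over leaves $a\in\mathcal A$ descending from $v$.
   Context: Tree. $\mathcal A$ is a finite set of $K$ actions, the leaf set of a rooted tree of depth $L\ge1$ all of whose leaves are at depth $L$. $V_j$ is the set of nodes at depth $j$ ($V_0$ contains only the root, $V_L=\mathcal A$). $v\preceq w$ (or $w\succeq v$) means $v$ is an ancestor of $w$; every node is its own ancestor. $\mathrm{anc}_j(w)$ is the ancestor of $w$ at depth $j$; $a\sim_jb$ iff $\mathrm{anc}_j(a)=\mathrm{anc}_j(b)$. $\Delta_K$ is the simplex of probability vectors indexed by $\mathcal A$; for $x\in\mathbb R^K$, $x[v]=\sum_{a\in\mathcal A:\,v\preceq a}x(a)$. $s(a,b)=1+\max\{j\in\{0,\dots,L\}:a\sim_jb\}$. Game. At each round $t$ the environment secretly draws $y_t:\mathcal A\to\mathbb R$ with $|y_t(a)-y_t(b)|\le\sigma_{s(a,b)}$ for all $a,b\in\mathcal A$ ($\sigma_{L+1}=0$). The learner plays $n+1$ actions $A_{t,1},\dots,A_{t,n+1}$ (repetitions allowed), observes all $y_t(A_{t,i})$, and incurs their average. $y_t$ may depend on everything up to round $t-1$, but is independent of the learner's actions (and internal randomization) at round $t$ or later, conditionally on the events up to the end of round $t-1$. Losses are integrable so that expectations are defined. $\mathrm{Reg}^{(n+1)}_T=\mathbb E\big[\sum_{t=1}^T\frac1{n+1}\sum_{i=1}^{n+1}y_t(A_{t,i})\big]-\min_{a\in\mathcal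 A}\mathbb E\big[\sum_{t=1}^Ty_t(a)\big]$. $(n+1)$-point FTRL algorithm (inputs: regularizers $\psi_t$, constants $b_j$, distribution $\mathcal D$). $p_1=\arg\min_{p\in\Delta_K}\psi_1(p)$. At each round $t\ge1$: sample $A_{t,1}\sim p_t$ and, independently, $M_t\sim\mathcal D$. For each $j\in M_t$ with $j+1\notin M_t$, set $B_{t,j}=A_{t,1}$. Then, going through the $n$ elements $j\in M_t$ in a fixed order, with counter $i=2,\dots,n+1$: sample $A_{t,i}$ from $p_t$ conditioned on $A_{t,i}\sim_{j-1}A_{t,1}$ and set $B_{t,j-1}=A_{t,i}$. For all $a\in\mathcal A$ set $z_t(a)=\sum_{j\in M_t}\mathbf 1\{a\sim_jA_{t,1}\}\frac{y_t(B_{t,j})-y_t(B_{t,j-1})+b_j}{\xi_j\,p_t[\mathrm{anc}_j(A_{t,1})]}$. Finally $p_{t+1}=\arg\min_{p\in\Delta_K}\langle\sum_{s\le t}z_s,p\rangle+\psi_{t+1}(p)$. *)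

theory Defs
  imports "HOL-Probability.Probability"
begin

text \<open>
  A finite rooted tree is given by its nodes, its root and the parent map. The value of the
  parent map at the root is irrelevant.
\<close>

record 'v rtree =
  nodes :: "'v set"
  root :: 'v
  parent :: "'v \<Rightarrow> 'v"

definition rooted_tree :: "'v rtree \<Rightarrow> bool" where
  "rooted_tree G \<longleftrightarrow> finite (nodes G) \<and> root G \<in> nodes G \<and>
     (\<forall>v \<in> nodes G - {root G}. parent G v \<in> nodes G) \<and>
     (\<forall>v \<in> nodes G. \<exists>k. (parent G ^^ k) v = root G)"

definition depth :: "'v rtree \<Rightarrow> 'v \<Rightarrow> nat" where
  "depth G v = (LEAST k. (parent G ^^ k) v = root G)"

definition leaves :: "'v rtree \<Rightarrow> 'v set" where
  "leaves G = {v \<in> nodes G. \<forall>w \<in> nodes G - {root G}. parent G w \<noteq> v}"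

definition level :: "'v rtree \<Rightarrow> nat \<Rightarrow> 'v set" where
  "level G j = {v \<in> nodes G. depth G v = j}"

definition is_anc :: "'v rtree \<Rightarrow> 'v \<Rightarrow> 'v \<Rightarrow> bool" where
  "is_anc G v w \<longleftrightarrow> (\<exists>k \<le> depth G w. (parent G ^^ k) w = v)"

definition anc :: "'v rtree \<Rightarrow> nat \<Rightarrow> 'v \<Rightarrow> 'v" where
  "anc G j w = (parent G ^^ (depth G w - j)) w"

definition leaves_below :: "'v rtree \<Rightarrow> 'v \<Rightarrow> 'v set" where
  "leaves_below G v = {a \<in> leaves G. is_anc G v a}"

definition mass :: "'v rtree \<Rightarrow> ('v \<Rightarrow> real) \<Rightarrow> 'v \<Rightarrow> real" where
  "mass G x v = (\<Sum>a \<in> leaves_below G v. x a)"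

definition sep :: "'v rtree \<Rightarrow> nat \<Rightarrow> 'v \<Rightarrow> 'v \<Rightarrow> nat" where
  "sep G L a b = 1 + Max {j \<in> {0..L}. anc G j a = anc G j b}"

text \<open>Vectors indexed by the leaves are functions; elements of the simplex vanish off the leaves.\<close>

definition prob_simplex :: "'v rtree \<Rightarrow> ('v \<Rightarrow> real) set" where
  "prob_simplex G =
     {p. (\<forall>a \<in> leaves G. 0 \<le> p a) \<and> (\<forall>a. a \<notin> leaves G \<longrightarrow> p a = 0) \<and> (\<Sum>a \<in> leaves G. p a) = 1}"

text \<open>
  Throughout, the time index \<open>t = 0, 1, \<dots>\<close> stands for round \<open>t + 1\<close>.

  A move of the learner is a pair of a finite set of naturals, the learner's recorded internal
  randomization in that round (the set \<open>M\<close> in the algorithm below; a countable space, so it can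
  encode any discrete randomization), and the actions with indices \<open>1, \<dots>, n + 1\<close>.

  The environment draws in every round a signal from an arbitrary measurable space, and the signal
  determines the loss vector \<open>loss N e\<close>; so the environment may keep private information from one
  round to the next. The signal of a round is drawn from a kernel that sees everything that
  happened in the previous rounds: signals, actions and internal randomization.
\<close>

type_synonym 'v move = "nat set \<times> (nat \<Rightarrow> 'v)"

record ('e, 'v) environment =
  signals :: "'e measure"
  loss :: "'e \<Rightarrow> 'v \<Rightarrow> real"
  draw :: "nat \<Rightarrow> (nat \<Rightarrow> 'e \<times> 'v move) \<Rightarrow> 'e measure"

definition moves :: "'v rtree \<Rightarrow> nat \<Rightarrow> 'v move set" where
  "moves G n = {S. finite S} \<times> ({1..n+1} \<rightarrow>\<^sub>E leaves G)"

definition round_space :: "'v rtree \<Rightarrow> nat \<Rightarrow> ('e, 'v) environment \<Rightarrow> ('e \<times> 'v move) measure" where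
  "round_space G n N = signals N \<Otimes>\<^sub>M count_space (moves G n)"

definition hist_space ::
    "'v rtree \<Rightarrow> nat \<Rightarrow> ('e, 'v) environment \<Rightarrow> nat \<Rightarrow> (nat \<Rightarrow> 'e \<times> 'v move) measure" where
  "hist_space G n N t = PiM {0..<t} (\<lambda>_. round_space G n N)"

definition tree_environment ::
    "'v rtree \<Rightarrow> nat \<Rightarrow> (nat \<Rightarrow> real) \<Rightarrow> nat \<Rightarrow> ('e, 'v) environment \<Rightarrow> bool" where
  "tree_environment G L \<sigma> n N \<longleftrightarrow>
     (\<forall>a \<in> leaves G. (\<lambda>e. loss N e a) \<in> borel_measurable (signals N)) \<and>
     (\<forall>e \<in> space (signals N). \<forall>a \<in> leaves G. \<forall>b \<in> leaves G.
        \<bar>loss N e a - loss N e b\<bar> \<le> \<sigma> (sep G L a b)) \<and>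
     (\<forall>t. draw N t \<in> hist_space G n N t \<rightarrow>\<^sub>M prob_algebra (signals N))"

text \<open>
  What the learner remembers: own moves (including internal randomization) and the losses of the
  played actions; the loss vector is masked by 0 at all other actions. A learner maps
  the view of the past to the law of its next move.
\<close>

type_synonym 'v view = "nat \<Rightarrow> ('v \<Rightarrow> real) \<times> 'v move"
type_synonym 'v learner = "nat \<Rightarrow> 'v view \<Rightarrow> 'v move pmf"

definition view_space :: "'v rtree \<Rightarrow> nat \<Rightarrow> nat \<Rightarrow> 'v view measure" where
  "view_space G n t = PiM {0..<t} (\<lambda>_. PiM (leaves G) (\<lambda>_. borel) \<Otimes>\<^sub>M count_space (moves G n))"

definition observe ::
    "'v rtree \<Rightarrow> nat \<Rightarrow> ('e, 'v) environment \<Rightarrow> nat \<Rightarrow> (nat \<Rightarrow> 'e \<times> 'v move) \<Rightarrow> 'v view" where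
  "observe G n N t h = (\<lambda>s \<in> {0..<t}. case h s of (e, M, A) \<Rightarrow>
     ((\<lambda>a \<in> leaves G. if a \<in> A ` {1..n+1} then loss N e a else 0), (M, A)))"

definition is_learner :: "'v rtree \<Rightarrow> nat \<Rightarrow> 'v learner \<Rightarrow> bool" where
  "is_learner G n \<pi> \<longleftrightarrow> (\<forall>t.
     (\<forall>h \<in> space (view_space G n t). set_pmf (\<pi> t h) \<subseteq> moves G n) \<and>
     (\<forall>m \<in> moves G n. (\<lambda>h. pmf (\<pi> t h) m) \<in> borel_measurable (view_space G n t)))"

text \<open>
  Given the past, signal and move of a round are drawn independently, hence the product measure.
  \<open>game_law\<close> is the law of the first \<open>T\<close> rounds, composed from these kernels.
\<close>

definition round_law ::
    "'v rtree \<Rightarrow> nat \<Rightarrow> ('e, 'v) environment \<Rightarrow> 'v learner \<Rightarrow>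
     nat \<Rightarrow> (nat \<Rightarrow> 'e \<times> 'v move) \<Rightarrow> ('e \<times> 'v move) measure" where
  "round_law G n N \<pi> t h =
     draw N t h \<Otimes>\<^sub>M restrict_space (measure_pmf (\<pi> t (observe G n N t h))) (moves G n)"

definition game_law ::
    "'v rtree \<Rightarrow> nat \<Rightarrow> ('e, 'v) environment \<Rightarrow> 'v learner \<Rightarrow>
     nat \<Rightarrow> (nat \<Rightarrow> 'e \<times> 'v move) measure" where
  "game_law G n N \<pi> T =
     Ionescu_Tulcea.C (round_law G n N \<pi>) (\<lambda>_. round_space G n N) 0 T (\<lambda>_. undefined)"

definition env_loss ::
    "('e, 'v) environment \<Rightarrow> (nat \<Rightarrow> 'e \<times> 'v move) \<Rightarrow> nat \<Rightarrow> 'v \<Rightarrow> real" where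
  "env_loss N h t = loss N (fst (h t))"

definition action :: "(nat \<Rightarrow> 'e \<times> 'v move) \<Rightarrow> nat \<Rightarrow> nat \<Rightarrow> 'v" where
  "action h t = snd (snd (h t))"

definition integrable_losses ::
    "'v rtree \<Rightarrow> nat \<Rightarrow> ('e, 'v) environment \<Rightarrow> 'v learner \<Rightarrow> nat \<Rightarrow> bool" where
  "integrable_losses G n N \<pi> T \<longleftrightarrow>
     (\<forall>t < T. \<forall>a \<in> leaves G. integrable (game_law G n N \<pi> T) (\<lambda>h. env_loss N h t a))"

definition regret ::
    "'v rtree \<Rightarrow> nat \<Rightarrow> ('e, 'v) environment \<Rightarrow> 'v learner \<Rightarrow> nat \<Rightarrow> real" where
  "regret G n N \<pi> T =
     (\<integral>h. (\<Sum>t<T. 1 / real (n+1) * (\<Sum>i=1..n+1. env_loss N h t (action h t i))) \<partial>game_law G n N \<pi> T)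
     - Min ((\<lambda>a. \<integral>h. (\<Sum>t<T. env_loss N h t a) \<partial>game_law G n N \<pi> T) ` leaves G)"

definition expected_gap ::
    "'v rtree \<Rightarrow> nat \<Rightarrow> ('e, 'v) environment \<Rightarrow> 'v learner \<Rightarrow> nat \<Rightarrow> ('v \<Rightarrow> real) \<Rightarrow> real" where
  "expected_gap G n N \<pi> T \<Delta> =
     (\<integral>h. (\<Sum>t<T. 1 / real (n+1) * (\<Sum>i=1..n+1. \<Delta> (action h t i))) \<partial>game_law G n N \<pi> T)"

definition incl_prob :: "nat set pmf \<Rightarrow> nat \<Rightarrow> real" where
  "incl_prob D j = measure_pmf.prob D {S. j \<in> S}"

text \<open>
  The fixed order in which the elements of a set \<open>M\<close> are processed is a bijection
  \<open>ord M\<close> from the counter values \<open>{2..n+1}\<close> to \<open>M\<close>. The point \<open>B\<^sub>k\<close> is the action sampled when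
  \<open>k + 1\<close> is processed if \<open>k + 1 \<in> M\<close>, and \<open>A\<^sub>1\<close> otherwise.
\<close>

definition order_on_subsets :: "nat \<Rightarrow> nat \<Rightarrow> (nat set \<Rightarrow> nat \<Rightarrow> nat) \<Rightarrow> bool" where
  "order_on_subsets L n ord \<longleftrightarrow>
     (\<forall>S. S \<subseteq> {1..L} \<and> card S = n \<longrightarrow> bij_betw (ord S) {2..n+1} S)"

definition sample_point ::
    "nat \<Rightarrow> (nat set \<Rightarrow> nat \<Rightarrow> nat) \<Rightarrow> 'v move \<Rightarrow> nat \<Rightarrow> 'v" where
  "sample_point n ord m k = (case m of (M, A) \<Rightarrow>
     if k + 1 \<in> M then A (inv_into {2..n+1} (ord M) (k + 1)) else A 1)"

definition ftrl_round ::
    "'v rtree \<Rightarrow> nat \<Rightarrow> nat set pmf \<Rightarrow> (nat set \<Rightarrow> nat \<Rightarrow> nat) \<Rightarrow> ('v \<Rightarrow> real) \<Rightarrow> 'v move pmf" where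
  "ftrl_round G n D ord p = do {
     A1 \<leftarrow> embed_pmf p;
     M \<leftarrow> D;
     A \<leftarrow> Pi_pmf {2..n+1} undefined
            (\<lambda>i. cond_pmf (embed_pmf p)
                   {a \<in> leaves G. anc G (ord M i - 1) a = anc G (ord M i - 1) A1});
     return_pmf (M, A(1 := A1))
   }"

definition loss_estimate ::
    "'v rtree \<Rightarrow> nat \<Rightarrow> nat set pmf \<Rightarrow> (nat set \<Rightarrow> nat \<Rightarrow> nat) \<Rightarrow> (nat \<Rightarrow> real) \<Rightarrow>
     ('v \<Rightarrow> real) \<Rightarrow> ('v \<Rightarrow> real) \<Rightarrow> 'v move \<Rightarrow> 'v \<Rightarrow> real" where
  "loss_estimate G n D ord b p y m a = (case m of (M, A) \<Rightarrow>
     (\<Sum>j\<in>M. (if anc G j a = anc G j (A 1) then 1 else 0) *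
        ((y (sample_point n ord m j) - y (sample_point n ord m (j - 1)) + b j) /
         (incl_prob D j * mass G p (anc G j (A 1))))))"

definition ftrl_dist ::
    "'v rtree \<Rightarrow> (nat \<Rightarrow> ('v \<Rightarrow> real) \<Rightarrow> real) \<Rightarrow> nat \<Rightarrow> ('v \<Rightarrow> real) \<Rightarrow> ('v \<Rightarrow> real)" where
  "ftrl_dist G \<psi> r Z = arg_min_on (\<lambda>p. (\<Sum>a \<in> leaves G. Z a * p a) + \<psi> r p) (prob_simplex G)"

text \<open>
  \<open>cum_estimate \<dots> v t\<close> is the sum of the loss estimates of the rounds \<open>1, \<dots>, t\<close>, and the
  regularizer used in round \<open>t + 1\<close> is \<open>\<psi> (t + 1)\<close>. Every sample point has been played, so only
  unmasked losses enter.
\<close>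

primrec cum_estimate ::
    "'v rtree \<Rightarrow> nat \<Rightarrow> (nat \<Rightarrow> ('v \<Rightarrow> real) \<Rightarrow> real) \<Rightarrow> (nat \<Rightarrow> real) \<Rightarrow> nat set pmf \<Rightarrow>
     (nat set \<Rightarrow> nat \<Rightarrow> nat) \<Rightarrow> 'v view \<Rightarrow> nat \<Rightarrow> 'v \<Rightarrow> real" where
  "cum_estimate G n \<psi> b D ord v 0 = (\<lambda>_. 0)"
| "cum_estimate G n \<psi> b D ord v (Suc t) =
     (let Z = cum_estimate G n \<psi> b D ord v t in
      (\<lambda>a. Z a + loss_estimate G n D ord b (ftrl_dist G \<psi> (t + 1) Z) (fst (v t)) (snd (v t)) a))"

definition ftrl ::
    "'v rtree \<Rightarrow> nat \<Rightarrow> (nat \<Rightarrow> ('v \<Rightarrow> real) \<Rightarrow> real) \<Rightarrow> (nat \<Rightarrow> real) \<Rightarrow> nat set pmf \<Rightarrow>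
     (nat set \<Rightarrow> nat \<Rightarrow> nat) \<Rightarrow> 'v learner" where
  "ftrl G n \<psi> b D ord t v =
     ftrl_round G n D ord (ftrl_dist G \<psi> (t + 1) (cum_estimate G n \<psi> b D ord v t))"

definition regularizer ::
    "'v rtree \<Rightarrow> nat \<Rightarrow> (nat \<Rightarrow> real) \<Rightarrow> nat set pmf \<Rightarrow> real \<Rightarrow> nat \<Rightarrow> ('v \<Rightarrow> real) \<Rightarrow> real" where
  "regularizer G L \<sigma> D c t x =
     4 * sqrt c / sqrt (c - 1) *
     (\<Sum>j=1..L. \<sigma> j / sqrt (incl_prob D j) *
        max (sqrt (real t)) (sqrt (c * (c - 1) / incl_prob D j)) *
        (\<Sum>v \<in> level G j. mass G x v - sqrt (mass G x v)))"

definition gap_complexity :: "'v rtree \<Rightarrow> nat \<Rightarrow> ('v \<Rightarrow> real) \<Rightarrow> real" where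
  "gap_complexity G j \<Delta> =
     (\<Sum>v \<in> {v \<in> level G j. Min (\<Delta> ` leaves_below G v) \<noteq> 0}. 1 / Min (\<Delta> ` leaves_below G v))"

end

theory Submission
  imports Defs
begin

text \<open>
  The estimate \<open>z\<^sub>t(a)\<close> has conditional mean \<open>y\<^sub>t(a) - \<langle>p\<^sub>t, y\<^sub>t\<rangle> + \<Sum>\<^sub>j \<sigma>\<^sub>j\<close>, and every action played
  in round \<open>t\<close> has law \<open>p\<^sub>t\<close>, so the regret against \<open>a\<close> is the expectation of
  \<open>\<Sum>\<^sub>t \<langle>p\<^sub>t, z\<^sub>t\<rangle> - z\<^sub>t(a)\<close>, which the FTRL analysis bounds pathwise. The regularizer is a sum over the
  levels, hence so are the stability terms. Shifting \<open>z\<close> on level \<open>j\<close> by the constant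
  \<open>p\<^sub>t[v] z\<^sub>t\<^sub>,\<^sub>j(v)\<close>, where \<open>v\<close> is the node of depth \<open>j\<close> above \<open>A\<^sub>t\<^sub>,\<^sub>1\<close>, makes the expected stability of a level
  at most a multiple of \<open>\<Sum>\<^sub>v \<surd>p\<^sub>t[v] (1 - p\<^sub>t[v])\<close>; the maximum in the regularizer keeps the shifted
  losses, which can be negative, large enough for the stability bound to hold. The penalty of a
  level is a multiple of
  \<open>\<Sum>\<^sub>v (\<surd>p\<^sub>t[v] - p\<^sub>t[v])\<close>. Cauchy-Schwarz gives the first bound. Both sums are also
  dominated by the sum of \<open>\<surd>p\<^sub>t[v]\<close> over the nodes with a positive gap, and a self-bounding argument
  gives the second bound.
\<close>

section \<open>Trees with all leaves at the same depth\<close>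

text \<open>The Bregman divergence of \<open>- sqrt\<close> is a multiple of a perfect square in
  \<open>sqrt q - sqrt P\<close>, so the stability of a node is the maximum of a quadratic in one
  variable, without second derivatives at intermediate points. This needs positive masses, which the
  infinite slope of the square root at 0 provides. The parameter \<open>c\<close> fixes how much
  curvature survives: shifted losses are at least \<open>- 2 * \<sigma> j / \<xi> j\<close>, a
  weight of at least \<open>4 * c * \<sigma> j / \<xi> j\<close> makes this at least
  \<open>- w j / (2 * c)\<close>, and a fraction (c - 1) / c of the curvature remains. Prefactor and
  threshold of the regularizer multiply to exactly that weight. The probabilistic obstacle is that
  only differences of losses are bounded and no lower bound on the sampled masses is established.
  All fluctuations are therefore collected in one variable, \<open>slack\<close>, and integrability
  comes from its conditional absolute mean. Conditioning is on the past and the current signal, so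
  that only the learner's randomness is averaged. As the plays come from a choice operator, their
  measurability needs an argument of its own.\<close>

lemma depth_child:
  assumes "rooted_tree G" "w \<in> nodes G" "w \<noteq> root G"
  shows "depth G w = Suc (depth G (parent G w))"
proof -
  obtain m where m: "(parent G ^^ m) w = root G"
    using assms unfolding rooted_tree_def by blast
  show ?thesis unfolding depth_def
  proof (subst Least_Suc[of "\<lambda>k. (parent G ^^ k) w = root G", OF m])
    show "\<not> (parent G ^^ 0) w = root G" using assms by simp
  qed (simp_all add: funpow_swap1)
qed

lemma depth_funpow_parent:
  assumes "rooted_tree G" "v \<in> nodes G" "k \<le> depth G v"
  shows "(parent G ^^ k) v \<in> nodes G \<and> depth G ((parent G ^^ k) v) = depth G v - k"
  using assms(3)
proof (induction k)
  case 0
  then show ?case using assms by simp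
next
  case (Suc k)
  let ?w = "(parent G ^^ k) v"
  have w: "?w \<in> nodes G" "depth G ?w = depth G v - k" using Suc by auto
  have nr: "?w \<noteq> root G"
  proof
    assume "?w = root G"
    then have "depth G v \<le> k" unfolding depth_def by (rule Least_le)
    then show False using Suc.prems by simp
  qed
  then have in_nodes: "parent G ?w \<in> nodes G" using assms(1) w(1) unfolding rooted_tree_def by auto
  have "depth G ?w = Suc (depth G (parent G ?w))"
    using depth_child[OF assms(1) w(1) nr] .
  then show ?case using w in_nodes Suc.prems by simp
qed

text \<open>A descendant of \<open>v\<close> of maximal depth is a leaf, because a child of it would
  be a deeper descendant.\<close>

lemma leaves_below_nonempty:
  assumes G: "rooted_tree G" and v: "v \<in> nodes G"
  shows "leaves_below G v \<noteq> {}"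
proof -
  let ?S = "{w \<in> nodes G. is_anc G v w}"
  have "finite ?S" "v \<in> ?S" using G v unfolding rooted_tree_def is_anc_def by auto
  then have "Max (depth G ` ?S) \<in> depth G ` ?S" by (intro Max_in) auto
  then obtain w where w: "w \<in> ?S" and "depth G w = Max (depth G ` ?S)" by auto
  then have mx: "depth G u \<le> depth G w" if "u \<in> ?S" for u
    using that \<open>finite ?S\<close> by simp
  have "w \<in> leaves G"
    unfolding leaves_def
  proof (intro CollectI conjI ballI notI)
    show "w \<in> nodes G" using w by simp
    fix u assume u: "u \<in> nodes G - {root G}" "parent G u = w"
    then have d: "depth G u = Suc (depth G w)" using depth_child[OF G, of u] by simp
    obtain k where k: "k \<le> depth G w" "(parent G ^^ k) w = v" using w unfolding is_anc_def by blast
    have "(parent G ^^ Suc k) u = v" using u(2) k by (simp add: funpow_swap1)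
    moreover have "Suc k \<le> depth G u" using d k by simp
    ultimately have "u \<in> ?S" using u(1) unfolding is_anc_def by blast
    then show False using mx[of u] d by simp
  qed
  then show ?thesis using w unfolding leaves_below_def by auto
qed

locale leveled_tree =
  fixes G :: "'v rtree" and L :: nat
  assumes tree: "rooted_tree G" and leaf_depth: "\<forall>a \<in> leaves G. depth G a = L" and L_pos: "1 \<le> L"
begin

lemma leaves_nodes: "a \<in> leaves G \<Longrightarrow> a \<in> nodes G"
  unfolding leaves_def by simp

lemma finite_leaves [simp]: "finite (leaves G)"
  using tree unfolding rooted_tree_def leaves_def by simp

lemma finite_level [simp]: "finite (level G j)"
  using tree unfolding rooted_tree_def level_def by simp

lemma leaves_nonempty: "leaves G \<noteq> {}"
  using leaves_below_nonempty[OF tree, of "root G"] tree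
  unfolding leaves_below_def rooted_tree_def by auto

lemma anc_leaf: "a \<in> leaves G \<Longrightarrow> anc G j a = (parent G ^^ (L - j)) a"
  unfolding anc_def using leaf_depth by simp

lemma anc_in_level: "a \<in> leaves G \<Longrightarrow> j \<le> L \<Longrightarrow> anc G j a \<in> level G j"
  using depth_funpow_parent[OF tree, of a "L - j"] leaf_depth leaves_nodes[of a]
  by (simp add: anc_leaf level_def)

text \<open>For leaves, the ancestor at depth \<open>i\<close> arises from the one at depth
  \<open>j\<close> by the same number \<open>j - i\<close> of parent steps.\<close>

lemma anc_refine:
  assumes "a \<in> leaves G" "b \<in> leaves G" "anc G j a = anc G j b" "i \<le> j" "j \<le> L"
  shows "anc G i a = anc G i b"
proof -
  have "L - i = (j - i) + (L - j)" using assms by simp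
  then show ?thesis using assms(1-3) by (simp add: anc_leaf funpow_add)
qed

lemma anc_L [simp]: "a \<in> leaves G \<Longrightarrow> anc G L a = a"
  by (simp add: anc_leaf)

lemma anc_0:
  assumes "a \<in> leaves G" shows "anc G 0 a = root G"
proof -
  obtain m where "(parent G ^^ m) a = root G"
    using tree leaves_nodes[OF assms] unfolding rooted_tree_def by blast
  then have "(parent G ^^ depth G a) a = root G" unfolding depth_def by (rule LeastI)
  then show ?thesis unfolding anc_def by simp
qed

text \<open>\<open>is_anc\<close> leaves the number of parent steps open; comparing depths forces it
  to be \<open>L - j\<close>. As fibres of \<open>anc G j\<close>, these sets partition the
  leaves.\<close>

lemma leaves_below_level:
  assumes "v \<in> level G j"
  shows "leaves_below G v = {a \<in> leaves G. anc G j a = v}"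
proof (intro set_eqI iffI)
  fix a assume "a \<in> leaves_below G v"
  then obtain k where a: "a \<in> leaves G" and k: "k \<le> L" "(parent G ^^ k) a = v"
    using leaf_depth unfolding leaves_below_def is_anc_def by auto
  have "depth G v = L - k"
    using depth_funpow_parent[OF tree leaves_nodes[OF a], of k] k leaf_depth a by simp
  then have "L - j = k" using assms k(1) unfolding level_def by force
  then show "a \<in> {a \<in> leaves G. anc G j a = v}" using a k by (simp add: anc_leaf)
next
  fix a assume "a \<in> {a \<in> leaves G. anc G j a = v}"
  then have "a \<in> leaves G" "anc G j a = v" by auto
  then have a: "a \<in> leaves G" "(parent G ^^ (L - j)) a = v" using anc_leaf[of a j] by auto
  moreover have "L - j \<le> depth G a" using leaf_depth a(1) by simp
  ultimately show "a \<in> leaves_below G v" unfolding leaves_below_def is_anc_def by blast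
qed

lemma leaves_below_level_nonempty: "v \<in> level G j \<Longrightarrow> leaves_below G v \<noteq> {}"
  using leaves_below_nonempty[OF tree] unfolding level_def by blast

lemma finite_leaves_below [simp]: "finite (leaves_below G v)"
  unfolding leaves_below_def by simp

text \<open>Grouping the leaves by their ancestor at depth \<open>j\<close>. This is the passage
  between sums over nodes and sums over leaves used throughout.\<close>

lemma sum_level_mass:
  assumes "j \<le> L"
  shows "(\<Sum>v\<in>level G j. mass G x v * f v) = (\<Sum>a\<in>leaves G. x a * f (anc G j a))"
proof -
  have "(\<Sum>v\<in>level G j. mass G x v * f v)
      = (\<Sum>v\<in>level G j. \<Sum>a\<in>{a \<in> leaves G. anc G j a = v}. x a * f (anc G j a))"
    by (intro sum.cong refl) (simp add: mass_def leaves_below_level sum_distrib_right)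
  also have "\<dots> = (\<Sum>a\<in>leaves G. x a * f (anc G j a))"
    by (rule sum.group) (use assms anc_in_level in auto)
  finally show ?thesis .
qed

lemma sum_level_mass1:
  assumes "j \<le> L"
  shows "(\<Sum>v\<in>level G j. mass G x v) = (\<Sum>a\<in>leaves G. x a)"
  using sum_level_mass[OF assms, of x "\<lambda>_. 1"] by simp

lemma mass_leaf: "a \<in> leaves G \<Longrightarrow> mass G x a = x a"
proof -
  assume a: "a \<in> leaves G"
  have "a \<in> level G L" using anc_in_level[OF a order_refl] a by simp
  then have "leaves_below G a = {b \<in> leaves G. anc G L b = a}" by (rule leaves_below_level)
  also have "\<dots> = {a}" using a anc_L by fastforce
  finally have "leaves_below G a = {a}" .
  then show ?thesis by (simp add: mass_def)
qed

lemma mass_anc: "a \<in> leaves G \<Longrightarrow> j \<le> L \<Longrightarrow> mass G x (anc G j a) = (\<Sum>b | b \<in> leaves G \<and> anc G j b = anc G j a. x b)"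
  by (simp add: mass_def leaves_below_level[OF anc_in_level])

text \<open>Applied at depth \<open>j - 1\<close>, the lower bound reads
  \<open>j \<le> sep G L a b\<close>. The value \<open>L + 1\<close> is that of equal leaves, where
  the scale is 0.\<close>

lemma sep_bounds:
  assumes "a \<in> leaves G" "b \<in> leaves G" "j \<le> L" "anc G j a = anc G j b"
  shows "j + 1 \<le> sep G L a b" "sep G L a b \<le> L + 1"
proof -
  let ?S = "{j \<in> {0..L}. anc G j a = anc G j b}"
  have S: "finite ?S" "j \<in> ?S" using assms by auto
  then show "j + 1 \<le> sep G L a b" unfolding sep_def by simp
  have "Max ?S \<in> ?S" using Max_in[OF S(1)] S(2) by blast
  then show "sep G L a b \<le> L + 1" unfolding sep_def by simp
qed

section \<open>Follow the regularized leader on the tree\<close>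

lemma simplexD:
  assumes "p \<in> prob_simplex G"
  shows "a \<in> leaves G \<Longrightarrow> 0 \<le> p a" "a \<notin> leaves G \<Longrightarrow> p a = 0" "(\<Sum>a\<in>leaves G. p a) = 1"
  using assms unfolding prob_simplex_def by auto

lemma simplex_nonneg: "p \<in> prob_simplex G \<Longrightarrow> 0 \<le> p a"
  using simplexD by (metis order_refl)

lemma simplex_le_1: "p \<in> prob_simplex G \<Longrightarrow> p a \<le> 1"
  using simplexD(3)[of p] simplexD(2)[of p a] simplex_nonneg[of p] member_le_sum[of a "leaves G" p]
  by (cases "a \<in> leaves G") auto

lemma mass_nonneg: "p \<in> prob_simplex G \<Longrightarrow> 0 \<le> mass G p v"
  unfolding mass_def by (intro sum_nonneg) (simp add: simplex_nonneg)

lemma mass_le_1: "p \<in> prob_simplex G \<Longrightarrow> mass G p v \<le> 1"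
proof -
  assume p: "p \<in> prob_simplex G"
  have "mass G p v \<le> (\<Sum>a\<in>leaves G. p a)" unfolding mass_def
    by (rule sum_mono2) (use p in \<open>auto simp: leaves_below_def simplex_nonneg\<close>)
  then show ?thesis using simplexD(3)[OF p] by simp
qed

lemma sum_level_simplex: "p \<in> prob_simplex G \<Longrightarrow> j \<le> L \<Longrightarrow> (\<Sum>v\<in>level G j. mass G p v) = 1"
  by (simp add: sum_level_mass1 simplexD)

lemma mass_pos:
  assumes "\<And>a. a \<in> leaves G \<Longrightarrow> 0 < p a" "v \<in> level G j"
  shows "0 < mass G p v"
  unfolding mass_def using leaves_below_level_nonempty[OF assms(2)] assms(1)
  by (intro sum_pos) (auto simp: leaves_below_def)

definition point_mass :: "'v \<Rightarrow> 'v \<Rightarrow> real" where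
  "point_mass a = (\<lambda>b. if b = a then 1 else 0)"

lemma point_mass_simplex: "a \<in> leaves G \<Longrightarrow> point_mass a \<in> prob_simplex G"
  unfolding prob_simplex_def point_mass_def by (auto simp: sum.delta)

text \<open>On the simplex the masses of a level add up to 1, so up to a constant this is a weighted
  sum of negative Tsallis entropies of exponent 1/2, one per level. The linear part normalizes it to
  vanish at the vertices.\<close>

definition tsallis :: "(nat \<Rightarrow> real) \<Rightarrow> ('v \<Rightarrow> real) \<Rightarrow> real" where
  "tsallis w x = (\<Sum>j=1..L. w j * (\<Sum>v \<in> level G j. mass G x v - sqrt (mass G x v)))"

definition obj :: "(nat \<Rightarrow> real) \<Rightarrow> ('v \<Rightarrow> real) \<Rightarrow> ('v \<Rightarrow> real) \<Rightarrow> real" where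
  "obj w Z p = (\<Sum>a \<in> leaves G. Z a * p a) + tsallis w p"

definition is_min :: "(nat \<Rightarrow> real) \<Rightarrow> ('v \<Rightarrow> real) \<Rightarrow> ('v \<Rightarrow> real) \<Rightarrow> bool" where
  "is_min w Z p \<longleftrightarrow> p \<in> prob_simplex G \<and> (\<forall>q \<in> prob_simplex G. obj w Z p \<le> obj w Z q)"

text \<open>All masses are 0 or 1, where \<open>x - sqrt x\<close> vanishes. The comparator of the
  regret is a vertex and thus carries no regularization term.\<close>

lemma tsallis_point_mass:
  assumes "a \<in> leaves G" shows "tsallis w (point_mass a) = 0"
proof -
  have "mass G (point_mass a) v = (if v = anc G j a then 1 else 0)" if "v \<in> level G j" for v j
    using that assms by (auto simp: mass_def point_mass_def leaves_below_level)
  then have "mass G (point_mass a) v - sqrt (mass G (point_mass a) v) = 0" if "v \<in> level G j" for v j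
    using that by simp
  then show ?thesis unfolding tsallis_def by simp
qed

lemma tsallis_simplex:
  assumes "p \<in> prob_simplex G"
  shows "tsallis w p = (\<Sum>j=1..L. w j) - (\<Sum>j=1..L. w j * (\<Sum>v \<in> level G j. sqrt (mass G p v)))"
  unfolding tsallis_def using sum_level_simplex[OF assms]
  by (simp add: sum_subtractf right_diff_distrib)

text \<open>Continuity on a compact set. The node type may be infinite, so compactness is taken in
  the product topology of the function space, with the coordinates off the leaves pinned to
  0.\<close>

lemma is_min_exists: "\<exists>p. is_min w Z p"
proof -
  let ?B = "\<lambda>a. if a \<in> leaves G then {0..1} else {0::real}"
  have cont: "continuous_on UNIV (\<lambda>p::'v \<Rightarrow> real. p a)" for a
    by (rule continuous_on_product_coordinates)
  have "compactin (product_topology (\<lambda>_. euclidean) UNIV) (PiE UNIV ?B)"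
    by (subst compactin_PiE) auto
  then have c: "compact (PiE UNIV ?B)" by (simp add: euclidean_product_topology)
  have cl: "closed {p::'v \<Rightarrow> real. (\<Sum>a\<in>leaves G. p a) = 1}"
    by (intro closed_Collect_eq continuous_intros cont)
  have eq: "prob_simplex G = PiE UNIV ?B \<inter> {p. (\<Sum>a\<in>leaves G. p a) = 1}"
    (is "?L = ?R")
  proof
    show "?L \<subseteq> ?R"
    proof
      fix p assume p: "p \<in> ?L"
      then show "p \<in> ?R"
        using simplexD[OF p] simplex_le_1[OF p] by auto
    qed
    show "?R \<subseteq> ?L"
      unfolding prob_simplex_def PiE_UNIV_domain Pi_def by (auto split: if_splits)
  qed
  have "compact (prob_simplex G)" unfolding eq using c cl by (rule compact_Int_closed)
  moreover have "prob_simplex G \<noteq> {}" using point_mass_simplex leaves_nonempty by blast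
  moreover have "continuous_on (prob_simplex G) (obj w Z)"
    unfolding obj_def tsallis_def mass_def
    by (intro continuous_intros continuous_on_subset[OF cont]) auto
  ultimately show ?thesis unfolding is_min_def
    using continuous_attains_inf[of "prob_simplex G" "obj w Z"] by blast
qed

lemma mass_convex:
  "mass G (\<lambda>a. p a + e * (q a - p a)) v = mass G p v + e * (mass G q v - mass G p v)"
  unfolding mass_def by (simp add: sum.distrib sum_distrib_left[symmetric] sum_subtractf)

lemma simplex_convex:
  assumes "p \<in> prob_simplex G" "q \<in> prob_simplex G" "0 \<le> e" "e \<le> 1"
  shows "(\<lambda>a. p a + e * (q a - p a)) \<in> prob_simplex G"
proof -
  have "p a + e * (q a - p a) \<ge> 0" for a
  proof -
    have "p a + e * (q a - p a) = (1 - e) * p a + e * q a" by algebra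
    then show ?thesis using simplex_nonneg[OF assms(1), of a] simplex_nonneg[OF assms(2), of a] assms(3,4)
      by simp
  qed
  moreover have "(\<Sum>a\<in>leaves G. p a + e * (q a - p a)) = 1"
    using simplexD(3)[OF assms(1)] simplexD(3)[OF assms(2)]
    by (simp add: sum.distrib sum_distrib_left[symmetric] sum_subtractf)
  ultimately show ?thesis
    using simplexD(2)[OF assms(1)] simplexD(2)[OF assms(2)] unfolding prob_simplex_def by auto
qed

end

section \<open>Inequalities for real numbers and square roots\<close>

text \<open>First-order optimality without derivatives: if \<open>g\<close> were negative, a step
  \<open>e\<close> with \<open>e * (\<bar>k\<bar> + 1) \<le> - g / 2\<close> would make the
  quadratic negative.\<close>

lemma nonneg_if_quadratic_nonneg:
  fixes g k :: real
  assumes "\<And>e. 0 < e \<Longrightarrow> e \<le> 1 \<Longrightarrow> 0 \<le> e * g + e\<^sup>2 * k"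
  shows "0 \<le> g"
proof (rule ccontr)
  assume "\<not> 0 \<le> g"
  define e where "e = min 1 (- g / (2 * (\<bar>k\<bar> + 1)))"
  have e: "0 < e" "e \<le> 1" using \<open>\<not> 0 \<le> g\<close> unfolding e_def by (auto simp: field_simps)
  have "e * \<bar>k\<bar> \<le> (- g / (2 * (\<bar>k\<bar> + 1))) * (\<bar>k\<bar> + 1)"
    by (intro mult_mono) (use e in \<open>auto simp: e_def\<close>)
  also have "\<dots> = - g / 2" by (simp add: field_simps)
  finally have "g + e * \<bar>k\<bar> < 0" using \<open>\<not> 0 \<le> g\<close> by simp
  moreover have "e * k \<le> e * \<bar>k\<bar>" using e by (intro mult_left_mono) auto
  ultimately have "g + e * k < 0" by simp
  then have "e * (g + e * k) < 0" using e by (simp add: mult_pos_neg)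
  then show False using assms[OF e] by (simp add: algebra_simps power2_eq_square)
qed

text \<open>Only the linear term matters later, so the quadratic coefficient is generous: with r, s
  the two roots, the difference of the sides is (s - r)^2 ((s + r)^2 - r^2) / (2 r^3), which is
  nonnegative over the whole range of \<open>x\<close>.\<close>

lemma sqrt_second_order:
  fixes P x :: real
  assumes "0 < P" "- P \<le> x"
  shows "sqrt P - sqrt (P + x) \<le> - x / (2 * sqrt P) + x\<^sup>2 / (2 * (P * sqrt P))"
proof -
  define r s where "r = sqrt P" and "s = sqrt (P + x)"
  have r: "0 < r" "P = r\<^sup>2" and s: "0 \<le> s" "x = s\<^sup>2 - r\<^sup>2"
    using assms by (auto simp: r_def s_def)
  have "- x / (2 * r) + x\<^sup>2 / (2 * (P * r)) - (r - s) = (s - r)\<^sup>2 * ((s + r)\<^sup>2 - r\<^sup>2) / (2 * (P * r))"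
    unfolding r(2) s(2) using r(1) by (simp add: divide_simps) algebra
  moreover have "0 \<le> (s - r)\<^sup>2 * ((s + r)\<^sup>2 - r\<^sup>2) / (2 * (P * r))"
    using r s by (intro divide_nonneg_nonneg mult_nonneg_nonneg) (auto intro!: power_mono)
  ultimately show ?thesis unfolding r_def s_def by linarith
qed

text \<open>The last term is the exact Bregman divergence of the convex function
  \<open>- sqrt\<close> between \<open>q\<close> and \<open>P\<close>.\<close>

lemma sqrt_bregman:
  fixes P q :: real
  assumes "0 < P" "0 \<le> q"
  shows "sqrt P - sqrt q = - (q - P) / (2 * sqrt P) + (sqrt q - sqrt P)\<^sup>2 / (2 * sqrt P)"
proof -
  define r s where "r = sqrt P" and "s = sqrt q"
  have r: "0 < r" "P = r\<^sup>2" and s: "q = s\<^sup>2"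
    using assms by (auto simp: r_def s_def)
  have "r - s = - (s\<^sup>2 - r\<^sup>2) / (2 * r) + (s - r)\<^sup>2 / (2 * r)"
    using r(1) by (simp add: divide_simps) algebra
  then show ?thesis using r s unfolding r_def s_def by simp
qed

text \<open>In d = \<open>sqrt P - sqrt q\<close> and r = \<open>sqrt P\<close> the left side is the
  quadratic 2 z r d - B d^2 with B = z + \<beta> / (2 r), at most (z r)^2 / B. Since r \<le> 1, the
  lower bound on \<open>z\<close> costs at most the fraction 1/c of \<beta> / (2 r).\<close>

lemma sqrt_stability:
  fixes P q \<beta> c z :: real
  assumes "0 < P" "P \<le> 1" "0 \<le> q" "0 < \<beta>" "2 \<le> c" "- \<beta> / (2 * c) \<le> z"
  shows "z * (P - q) - \<beta> * (sqrt q - sqrt P)\<^sup>2 / (2 * sqrt P) \<le> 2 * c / (c - 1) / \<beta> * z\<^sup>2 * (P * sqrt P)"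
proof -
  define r s d where "r = sqrt P" and "s = sqrt q" and "d = sqrt P - sqrt q"
  have r: "0 < r" "P = r\<^sup>2" "r \<le> 1" and s: "q = s\<^sup>2" and d: "s = r - d"
    using assms by (auto simp: r_def s_def d_def)
  define B where "B = z + \<beta> / (2 * r)"
  have c1: "0 < (c - 1) / c" using assms by simp
  have "\<beta> / (2 * c) \<le> \<beta> / (2 * r) / c"
    using r assms by (simp add: field_simps)
  moreover have "\<beta> / (2 * r) * ((c - 1) / c) = \<beta> / (2 * r) - \<beta> / (2 * r) / c"
    using r assms by (simp add: field_simps)
  ultimately have B: "\<beta> / (2 * r) * ((c - 1) / c) \<le> B"
    unfolding B_def using assms(6) by simp
  have B0: "0 < \<beta> / (2 * r) * ((c - 1) / c)" using assms r c1 by (intro mult_pos_pos) auto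
  have "z * (r\<^sup>2 - (r - d)\<^sup>2) - \<beta> * (r - d - r)\<^sup>2 / (2 * r) = 2 * (z * r) * d - B * d\<^sup>2"
    unfolding B_def using r(1) by (simp add: field_simps power2_eq_square)
  then have "z * (P - q) - \<beta> * (sqrt q - sqrt P)\<^sup>2 / (2 * sqrt P) = 2 * (z * r) * d - B * d\<^sup>2"
    using r(2) s d unfolding r_def[symmetric] s_def[symmetric] by simp
  also have "\<dots> \<le> (z * r)\<^sup>2 / B"
  proof -
    have "0 \<le> (B * d - z * r)\<^sup>2 / B" using B B0 by simp
    also have "\<dots> = (z * r)\<^sup>2 / B - (2 * (z * r) * d - B * d\<^sup>2)"
      using B B0 by (simp add: field_simps power2_eq_square)
    finally show ?thesis by simp
  qed
  also have "\<dots> \<le> (z * r)\<^sup>2 / (\<beta> / (2 * r) * ((c - 1) / c))"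
    using B B0 by (intro divide_left_mono[OF B _ mult_pos_pos]) auto
  also have "\<dots> = 2 * c / (c - 1) / \<beta> * z\<^sup>2 * (P * sqrt P)"
    unfolding r_def[symmetric] r(2) using r assms by (simp add: field_simps power2_eq_square)
  finally show ?thesis .
qed

lemma le_sqrt_self: "0 \<le> x \<Longrightarrow> x \<le> 1 \<Longrightarrow> x \<le> sqrt x" for x :: real
  by (metis abs_of_nonneg mult_left_le real_sqrt_ge_zero real_sqrt_le_1_iff real_sqrt_mult_self)

context leveled_tree
begin

text \<open>If the leaf had probability 0, moving mass e = s^2 onto it would gain
  \<open>w L * s\<close> through the infinite slope of the square root at 0, while all other changes
  cost at most s^2 \<open>C\<close>. For small s this contradicts minimality.\<close>

lemma is_min_positive:
  assumes p: "is_min w Z p" and w: "\<forall>j\<in>{1..L}. 0 < w j" and a: "a \<in> leaves G"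
  shows "0 < p a"
proof (rule ccontr)
  have ps: "p \<in> prob_simplex G" using p unfolding is_min_def by simp
  assume "\<not> 0 < p a"
  then have pa: "p a = 0" using simplex_nonneg[OF ps, of a] by simp
  let ?d = "point_mass a"
  have ds: "?d \<in> prob_simplex G" using a by (rule point_mass_simplex)
  define q where "q e = (\<lambda>b. p b + e * (?d b - p b))" for e
  define C where "C = \<bar>\<Sum>b\<in>leaves G. Z b * (?d b - p b)\<bar> + (\<Sum>j=1..L. w j * real (card (level G j)))"
  have C0: "0 \<le> C" unfolding C_def using w by (intro add_nonneg_nonneg sum_nonneg mult_nonneg_nonneg) (auto intro: less_imp_le)
  have key: "w L \<le> s * C" if s: "0 < s" "s \<le> 1" for s
  proof -
    define e where "e = s\<^sup>2"
    have e: "0 < e" "e \<le> 1" "sqrt e = s" using s by (auto simp: e_def power_le_one)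
    have qs: "q e \<in> prob_simplex G" unfolding q_def using ps ds e by (intro simplex_convex) auto
    have node: "sqrt (mass G p v) - sqrt (mass G (q e) v) \<le> e - (if v = a then s else 0)" if "v \<in> level G j" for v j
    proof (cases "v = a")
      case True
      have "mass G p v = 0" "mass G (q e) v = e"
        using True a pa by (simp_all add: mass_leaf q_def point_mass_def)
      then show ?thesis using e True by simp
    next
      case False
      have "(1 - e)\<^sup>2 \<le> 1 - e" using e by (simp add: power2_eq_square mult_left_le_one_le)
      then have "(1 - e)\<^sup>2 * mass G p v \<le> (1 - e) * mass G p v"
        using mass_nonneg[OF ps] by (rule mult_right_mono)
      also have "\<dots> \<le> mass G (q e) v"
        unfolding q_def mass_convex using mass_nonneg[OF ds, of v] e by (simp add: algebra_simps)
      finally have "sqrt ((1 - e)\<^sup>2 * mass G p v) \<le> sqrt (mass G (q e) v)" by simp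
      then have "(1 - e) * sqrt (mass G p v) \<le> sqrt (mass G (q e) v)" using e by (simp add: real_sqrt_mult)
      moreover have "e * sqrt (mass G p v) \<le> e" using mass_le_1[OF ps, of v] e by (simp add: mult_left_le)
      ultimately show ?thesis using False by (simp add: algebra_simps)
    qed
    have "0 \<le> obj w Z (q e) - obj w Z p" using p qs unfolding is_min_def by simp
    also have "\<dots> = e * (\<Sum>b\<in>leaves G. Z b * (?d b - p b))
        + (\<Sum>j=1..L. w j * (\<Sum>v\<in>level G j. sqrt (mass G p v) - sqrt (mass G (q e) v)))"
      unfolding obj_def tsallis_simplex[OF ps] tsallis_simplex[OF qs]
      by (simp add: q_def sum.distrib sum_distrib_left sum_subtractf algebra_simps)
    also have "\<dots> \<le> e * \<bar>\<Sum>b\<in>leaves G. Z b * (?d b - p b)\<bar>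
        + (\<Sum>j=1..L. w j * (e * real (card (level G j)) - (if j = L then s else 0)))"
    proof (intro add_mono sum_mono mult_left_mono)
      fix j assume j: "j \<in> {1..L}"
      have "(\<Sum>v\<in>level G j. sqrt (mass G p v) - sqrt (mass G (q e) v))
          \<le> (\<Sum>v\<in>level G j. e - (if v = a then s else 0))"
        by (intro sum_mono node)
      also have "\<dots> \<le> e * real (card (level G j)) - (if j = L then s else 0)"
        using anc_in_level[OF a order_refl] a s by (simp add: sum_subtractf sum.delta)
      finally show "(\<Sum>v\<in>level G j. sqrt (mass G p v) - sqrt (mass G (q e) v))
        \<le> e * real (card (level G j)) - (if j = L then s else 0)" .
    qed (use e w in \<open>auto intro: less_imp_le\<close>)
    also have "\<dots> = e * C - (\<Sum>j=1..L. if j = L then w j * s else 0)"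
      unfolding C_def by (simp add: algebra_simps sum.distrib sum_distrib_left sum_subtractf if_distrib[of "\<lambda>x. _ * x"] cong: if_cong)
    also have "\<dots> = s * (s * C) - s * w L" using L_pos by (simp add: e_def power2_eq_square algebra_simps)
    finally have "s * w L \<le> s * (s * C)" by simp
    then show ?thesis using s by simp
  qed
  have wL: "0 < w L" using w L_pos by simp
  define s where "s = min 1 (w L / (2 * (C + 1)))"
  have s: "0 < s" "s \<le> 1" using wL C0 unfolding s_def by auto
  have "s * C \<le> w L / (2 * (C + 1)) * (C + 1)" using C0 s by (intro mult_mono) (auto simp: s_def)
  also have "\<dots> = w L / 2" using C0 by (simp add: field_simps)
  finally show False using key[OF s] wL by simp
qed

text \<open>First-order optimality at the minimizer plus the exact expansion of each square root.
  Positive masses make the derivative at \<open>p\<close> exist, so optimality holds even towards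
  boundary points \<open>q\<close>.\<close>

lemma is_min_bregman:
  assumes p: "is_min w Z p" and w: "\<forall>j\<in>{1..L}. 0 < w j" and q: "q \<in> prob_simplex G"
  shows "obj w Z p + (\<Sum>j=1..L. \<Sum>v\<in>level G j. w j * (sqrt (mass G q v) - sqrt (mass G p v))\<^sup>2 / (2 * sqrt (mass G p v)))
     \<le> obj w Z q"
proof -
  have ps: "p \<in> prob_simplex G" using p unfolding is_min_def by simp
  have pos: "0 < mass G p v" if "v \<in> level G j" for v j
    using mass_pos[OF _ that] is_min_positive[OF p w] by blast
  define d where "d v = mass G q v - mass G p v" for v
  \<comment> \<open>\<open>D\<close> is the derivative of the objective at \<open>p\<close> in the
    direction of \<open>q\<close>, and \<open>K\<close> bounds the remainder along that
    segment.\<close>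
  define D where "D = (\<Sum>b\<in>leaves G. Z b * (q b - p b)) + (\<Sum>j=1..L. \<Sum>v\<in>level G j. w j * (- d v / (2 * sqrt (mass G p v))))"
  define K where "K = (\<Sum>j=1..L. \<Sum>v\<in>level G j. w j * ((d v)\<^sup>2 / (2 * (mass G p v * sqrt (mass G p v)))))"
  have obj_diff: "obj w Z q' - obj w Z p = (\<Sum>b\<in>leaves G. Z b * (q' b - p b))
        + (\<Sum>j=1..L. \<Sum>v\<in>level G j. w j * (sqrt (mass G p v) - sqrt (mass G q' v)))"
    if "q' \<in> prob_simplex G" for q'
    unfolding obj_def tsallis_simplex[OF ps] tsallis_simplex[OF that]
    by (simp add: sum_distrib_left sum_subtractf algebra_simps)
  have "0 \<le> D"
  proof (rule nonneg_if_quadratic_nonneg[where k=K])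
    fix e :: real assume e: "0 < e" "e \<le> 1"
    define q' where "q' = (\<lambda>b. p b + e * (q b - p b))"
    have qs: "q' \<in> prob_simplex G" unfolding q'_def using ps q e by (intro simplex_convex) auto
    have "0 \<le> obj w Z q' - obj w Z p" using p qs unfolding is_min_def by simp
    also have "\<dots> \<le> (\<Sum>b\<in>leaves G. Z b * (q' b - p b)) + (\<Sum>j=1..L. \<Sum>v\<in>level G j.
        w j * (- (e * d v) / (2 * sqrt (mass G p v)) + (e * d v)\<^sup>2 / (2 * (mass G p v * sqrt (mass G p v)))))"
      unfolding obj_diff[OF qs]
    proof (intro add_mono order_refl sum_mono mult_left_mono)
      fix j v assume "j \<in> {1..L}" "v \<in> level G j"
      have "mass G q' v = mass G p v + e * d v" unfolding q'_def mass_convex d_def ..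
      moreover have "- mass G p v \<le> e * d v"
      proof -
        have "0 \<le> mass G q' v" using mass_nonneg[OF qs] .
        then show ?thesis unfolding \<open>mass G q' v = _\<close> by simp
      qed
      ultimately show "sqrt (mass G p v) - sqrt (mass G q' v)
        \<le> - (e * d v) / (2 * sqrt (mass G p v)) + (e * d v)\<^sup>2 / (2 * (mass G p v * sqrt (mass G p v)))"
        using sqrt_second_order[OF pos[OF \<open>v \<in> level G j\<close>], of "e * d v"] by simp
    qed (use w in \<open>auto intro: less_imp_le\<close>)
    also have "\<dots> = e * D + e\<^sup>2 * K"
    proof -
      have 1: "(\<Sum>b\<in>leaves G. Z b * (q' b - p b)) = e * (\<Sum>b\<in>leaves G. Z b * (q b - p b))"
        by (simp add: q'_def sum_distrib_left algebra_simps)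
      have 2: "w j * (- (e * d v) / (2 * sqrt (mass G p v)) + (e * d v)\<^sup>2 / (2 * (mass G p v * sqrt (mass G p v))))
        = e * (w j * (- d v / (2 * sqrt (mass G p v)))) + e\<^sup>2 * (w j * ((d v)\<^sup>2 / (2 * (mass G p v * sqrt (mass G p v)))))" for j v
        by (simp add: algebra_simps power_mult_distrib)
      show ?thesis unfolding 1 2 D_def K_def
        by (simp only: sum.distrib sum_distrib_left distrib_left add.assoc)
    qed
    finally show "0 \<le> e * D + e\<^sup>2 * K" .
  qed
  have "obj w Z q - obj w Z p = (\<Sum>b\<in>leaves G. Z b * (q b - p b)) + (\<Sum>j=1..L. \<Sum>v\<in>level G j.
      w j * (- d v / (2 * sqrt (mass G p v)) + (sqrt (mass G q v) - sqrt (mass G p v))\<^sup>2 / (2 * sqrt (mass G p v))))"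
    unfolding obj_diff[OF q] d_def
    by (intro arg_cong2[of _ _ _ _ "(+)"] refl sum.cong arg_cong2[of _ _ _ _ "(*)"] sqrt_bregman pos mass_nonneg[OF q])
  also have "\<dots> = D + (\<Sum>j=1..L. \<Sum>v\<in>level G j. w j * (sqrt (mass G q v) - sqrt (mass G p v))\<^sup>2 / (2 * sqrt (mass G p v)))"
    unfolding D_def by (simp only: distrib_left sum.distrib add.assoc times_divide_eq_right)
  finally show ?thesis using \<open>0 \<le> D\<close> by simp
qed

text \<open>Strong convexity of the objective in the coordinate \<open>a\<close>
  (\<open>half\<close>, which keeps only the leaf term of level \<open>L\<close>) is applied at both
  minimizers. In the sum the regularizers cancel and only the change of the linear part remains.
  This serves the measurability of the plays.\<close>

lemma is_min_stable:
  assumes p: "is_min w Z p" and p': "is_min w Z' p'" and w: "\<forall>j\<in>{1..L}. 0 < w j" and a: "a \<in> leaves G"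
  shows "w L / 4 * (p a - p' a)\<^sup>2 \<le> (\<Sum>b\<in>leaves G. \<bar>Z b - Z' b\<bar>)"
proof -
  have half: "obj w Z p + w L / 8 * (q a - p a)\<^sup>2 \<le> obj w Z q"
    if p: "is_min w Z p" and q: "q \<in> prob_simplex G" for Z p q
  proof -
    let ?g = "\<lambda>j v. w j * (sqrt (mass G q v) - sqrt (mass G p v))\<^sup>2 / (2 * sqrt (mass G p v))"
    have ps: "p \<in> prob_simplex G" using p unfolding is_min_def by simp
    have g0: "0 \<le> ?g j v" if "j \<in> {1..L}" for j v
      using that w mass_nonneg[OF ps, of v] by (intro divide_nonneg_nonneg mult_nonneg_nonneg) (auto intro: less_imp_le)
    have wL: "0 < w L" using w L_pos by simp
    have pa: "0 < p a" using is_min_positive[OF p w a] .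
    have "(q a - p a)\<^sup>2 = (sqrt (q a) - sqrt (p a))\<^sup>2 * (sqrt (q a) + sqrt (p a))\<^sup>2"
    proof -
      have "q a - p a = (sqrt (q a) - sqrt (p a)) * (sqrt (q a) + sqrt (p a))"
        using simplex_nonneg[OF q, of a] simplex_nonneg[OF ps, of a] by (simp add: algebra_simps)
      then show ?thesis by (metis power_mult_distrib)
    qed
    also have "\<dots> \<le> (sqrt (q a) - sqrt (p a))\<^sup>2 * 2\<^sup>2"
    proof (intro mult_left_mono power_mono)
      have "sqrt (q a) \<le> 1" "sqrt (p a) \<le> 1"
        using simplex_le_1[OF q, of a] simplex_le_1[OF ps, of a] by auto
      then show "sqrt (q a) + sqrt (p a) \<le> 2" by linarith
    qed (use simplex_nonneg[OF q, of a] simplex_nonneg[OF ps, of a] in auto)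
    finally have "w L / 8 * (q a - p a)\<^sup>2 \<le> w L / 8 * ((sqrt (q a) - sqrt (p a))\<^sup>2 * 2\<^sup>2)"
      using wL by (intro mult_left_mono) auto
    also have "\<dots> = w L * (sqrt (q a) - sqrt (p a))\<^sup>2 / 2" by simp
    also have "\<dots> \<le> w L * (sqrt (q a) - sqrt (p a))\<^sup>2 / (2 * sqrt (p a))"
      using wL pa simplex_le_1[OF ps, of a] by (intro divide_left_mono) auto
    also have "\<dots> = ?g L a" using a by (simp add: mass_leaf)
    also have "\<dots> \<le> (\<Sum>v\<in>level G L. ?g L v)"
      using anc_in_level[OF a order_refl] a L_pos g0 by (intro member_le_sum) auto
    also have "\<dots> \<le> (\<Sum>j=1..L. \<Sum>v\<in>level G j. ?g j v)"
      using L_pos by (intro member_le_sum[of L "{1..L}" "\<lambda>j. \<Sum>v\<in>level G j. ?g j v"] sum_nonneg g0) auto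
    finally show ?thesis using is_min_bregman[OF p w q] by simp
  qed
  have ps: "p \<in> prob_simplex G" "p' \<in> prob_simplex G" using p p' unfolding is_min_def by auto
  have "obj w Z p' - obj w Z p + (obj w Z' p - obj w Z' p') = (\<Sum>b\<in>leaves G. (Z b - Z' b) * (p' b - p b))"
    unfolding obj_def by (simp add: algebra_simps sum.distrib sum_subtractf)
  also have "\<dots> \<le> (\<Sum>b\<in>leaves G. \<bar>Z b - Z' b\<bar>)"
  proof (rule sum_mono)
    fix b
    have "\<bar>p' b - p b\<bar> \<le> 1" using simplex_nonneg[OF ps(1), of b] simplex_nonneg[OF ps(2), of b]
        simplex_le_1[OF ps(1), of b] simplex_le_1[OF ps(2), of b] by linarith
    then have "\<bar>Z b - Z' b\<bar> * \<bar>p' b - p b\<bar> \<le> \<bar>Z b - Z' b\<bar>" by (simp add: mult_left_le)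
    then show "(Z b - Z' b) * (p' b - p b) \<le> \<bar>Z b - Z' b\<bar>"
      by (metis abs_le_D1 abs_mult)
  qed
  finally show ?thesis using half[OF p ps(2)] half[OF p' ps(1)] by (simp add: power2_commute)
qed

text \<open>
  The stability bound holds for every shift \<open>\<mu>\<close> of the losses of a level, because the masses of a
  level add up to 1. A good shift makes it of order \<open>p (1 - p)\<close> at nodes of mass \<open>p\<close> close to 1.
\<close>

lemma is_min_step:
  assumes p: "is_min w Z p" and w: "\<forall>j\<in>{1..L}. 0 < w j" and q: "q \<in> prob_simplex G" and c: "2 \<le> c"
    and z: "\<And>a. a \<in> leaves G \<Longrightarrow> z a = (\<Sum>j=1..L. g j (anc G j a))"
    and g: "\<And>j v. j \<in> {1..L} \<Longrightarrow> v \<in> level G j \<Longrightarrow> - w j / (2 * c) \<le> g j v - \<mu> j"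
  shows "obj w Z p + (\<Sum>a\<in>leaves G. z a * p a) - (\<Sum>j=1..L. \<Sum>v\<in>level G j.
            2 * c / (c - 1) / w j * (g j v - \<mu> j)\<^sup>2 * (mass G p v * sqrt (mass G p v)))
        \<le> obj w Z q + (\<Sum>a\<in>leaves G. z a * q a)"
proof -
  have ps: "p \<in> prob_simplex G" using p unfolding is_min_def by simp
  have pos: "0 < mass G p v" if "v \<in> level G j" for v j
    using mass_pos[OF _ that] is_min_positive[OF p w] by blast
  have lin: "(\<Sum>a\<in>leaves G. z a * x a) = (\<Sum>j=1..L. (\<Sum>v\<in>level G j. (g j v - \<mu> j) * mass G x v) + \<mu> j)"
    if x: "x \<in> prob_simplex G" for x
  proof -
    have "(\<Sum>a\<in>leaves G. z a * x a) = (\<Sum>j=1..L. \<Sum>a\<in>leaves G. x a * g j (anc G j a))"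
      by (subst sum.swap) (simp add: z sum_distrib_left mult.commute)
    also have "\<dots> = (\<Sum>j=1..L. \<Sum>v\<in>level G j. mass G x v * g j v)"
      by (intro sum.cong refl sum_level_mass[symmetric]) auto
    also have "\<dots> = (\<Sum>j=1..L. (\<Sum>v\<in>level G j. (g j v - \<mu> j) * mass G x v) + \<mu> j)"
    proof (intro sum.cong refl)
      fix j assume "j \<in> {1..L}"
      then have "(\<Sum>v\<in>level G j. \<mu> j * mass G x v) = \<mu> j"
        using sum_level_simplex[OF x, of j] by (simp add: sum_distrib_left[symmetric])
      then show "(\<Sum>v\<in>level G j. mass G x v * g j v) = (\<Sum>v\<in>level G j. (g j v - \<mu> j) * mass G x v) + \<mu> j"
        by (simp add: left_diff_distrib sum_subtractf mult.commute[of "mass G x _"])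
    qed
    finally show ?thesis .
  qed
  have "(\<Sum>a\<in>leaves G. z a * p a) - (\<Sum>a\<in>leaves G. z a * q a)
      - (\<Sum>j=1..L. \<Sum>v\<in>level G j. w j * (sqrt (mass G q v) - sqrt (mass G p v))\<^sup>2 / (2 * sqrt (mass G p v)))
    = (\<Sum>j=1..L. \<Sum>v\<in>level G j. (g j v - \<mu> j) * (mass G p v - mass G q v)
        - w j * (sqrt (mass G q v) - sqrt (mass G p v))\<^sup>2 / (2 * sqrt (mass G p v)))"
    unfolding lin[OF ps] lin[OF q] by (simp add: sum_subtractf sum.distrib right_diff_distrib)
  also have "\<dots> \<le> (\<Sum>j=1..L. \<Sum>v\<in>level G j.
            2 * c / (c - 1) / w j * (g j v - \<mu> j)\<^sup>2 * (mass G p v * sqrt (mass G p v)))"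
    by (intro sum_mono sqrt_stability) (use pos mass_le_1[OF ps] mass_nonneg[OF q] w c g in auto)
  finally show ?thesis using is_min_bregman[OF p w q] by linarith
qed

section \<open>Telescoping of the objective and the penalty\<close>

definition level_entropy :: "nat \<Rightarrow> ('v \<Rightarrow> real) \<Rightarrow> real" where
  "level_entropy j p = (\<Sum>v\<in>level G j. sqrt (mass G p v) - mass G p v)"

text \<open>This is what remains of the stability of a level once the sampled node is averaged out,
  by \<open>expectation_stab_bound\<close>. The factor \<open>1 - mass G p v\<close> is the gain
  from the shift.\<close>

definition level_variance :: "nat \<Rightarrow> ('v \<Rightarrow> real) \<Rightarrow> real" where
  "level_variance j p = (\<Sum>v\<in>level G j. sqrt (mass G p v) * (1 - mass G p v))"

lemma tsallis_entropy: "tsallis w p = - (\<Sum>j=1..L. w j * level_entropy j p)"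
  unfolding tsallis_def level_entropy_def
  by (simp add: sum_negf[symmetric] sum_subtractf algebra_simps)

lemma level_entropy_nonneg: "p \<in> prob_simplex G \<Longrightarrow> 0 \<le> level_entropy j p"
  unfolding level_entropy_def
  by (intro sum_nonneg) (simp add: le_sqrt_self mass_nonneg mass_le_1)

text \<open>With \<open>q\<close> the next play, the optimal objective value is a telescoping
  potential, and changing the weights costs their increment times the entropy of that play. The last
  step goes directly to the vertex at \<open>a\<close>, where the regularizer vanishes, so no
  weights beyond index \<open>T - 1\<close> occur.\<close>

lemma ftrl_telescope:
  assumes p: "\<And>t. t < T \<Longrightarrow> is_min (w t) (Z t) (p t)"
    and Z: "\<And>a. a \<in> leaves G \<Longrightarrow> Z 0 a = 0"
      "\<And>t a. t < T \<Longrightarrow> a \<in> leaves G \<Longrightarrow> Z (Suc t) a = Z t a + z t a"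
    and step: "\<And>t q. t < T \<Longrightarrow> q \<in> prob_simplex G \<Longrightarrow>
        obj (w t) (Z t) (p t) + (\<Sum>a\<in>leaves G. z t a * p t a) - st t
        \<le> obj (w t) (Z t) q + (\<Sum>a\<in>leaves G. z t a * q a)"
    and T: "1 \<le> T" and a: "a \<in> leaves G"
  shows "(\<Sum>t<T. (\<Sum>b\<in>leaves G. z t b * p t b) - z t a)
    \<le> (\<Sum>t<T. st t) + (\<Sum>j=1..L. w 0 j * level_entropy j (p 0))
      + (\<Sum>t\<in>{1..<T}. \<Sum>j=1..L. (w t j - w (t - 1) j) * level_entropy j (p t))"
proof -
  have main: "(\<Sum>s<t. \<Sum>b\<in>leaves G. z s b * p s b)
    \<le> (\<Sum>s<t. st s) + (\<Sum>j=1..L. w 0 j * level_entropy j (p 0))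
      + (\<Sum>s\<in>{1..<Suc t}. \<Sum>j=1..L. (w s j - w (s - 1) j) * level_entropy j (p s)) + obj (w t) (Z t) (p t)"
    if "t < T" for t
    using that
  proof (induction t)
    case 0
    show ?case using Z(1) by (simp add: obj_def tsallis_entropy)
  next
    case (Suc t)
    have ps: "p (Suc t) \<in> prob_simplex G" using p[OF Suc.prems] unfolding is_min_def by simp
    have "obj (w t) (Z t) (p (Suc t)) + (\<Sum>a\<in>leaves G. z t a * p (Suc t) a)
       = obj (w (Suc t)) (Z (Suc t)) (p (Suc t)) + (\<Sum>j=1..L. (w (Suc t) j - w t j) * level_entropy j (p (Suc t)))"
      using Z(2)[of t] Suc.prems unfolding obj_def tsallis_entropy
      by (simp add: algebra_simps sum.distrib sum_subtractf)
    then show ?case using Suc step[OF _ ps, of t] by simp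
  qed
  obtain t where t: "T = Suc t" using T by (cases T) auto
  have Zsum: "Z s a = (\<Sum>r<s. z r a)" if "s \<le> T" for s
    using that by (induction s) (use Z a in auto)
  have pm: "(\<Sum>b\<in>leaves G. f b * point_mass a b) = f a" for f
    using a by (simp add: point_mass_def if_distrib[of "\<lambda>x. _ * x"] sum.delta cong: if_cong)
  have "obj (w t) (Z t) (point_mass a) = Z t a"
    unfolding obj_def pm tsallis_point_mass[OF a] by simp
  then have "obj (w t) (Z t) (point_mass a) + (\<Sum>b\<in>leaves G. z t b * point_mass a b) = (\<Sum>r<T. z r a)"
    using Zsum[of t] t by (simp add: pm)
  then show ?thesis
    using main[of t] step[OF _ point_mass_simplex[OF a], of t] t by (simp add: sum_subtractf)
qed

text \<open>Taking the maximum with \<open>m j\<close> does not enlarge increments, and consecutive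
  roots x, y satisfy (y - x) y \<le> 1. The initial weight is split as max 1 m \<le> m + 1, whose 1
  becomes the summand of index 0.\<close>

lemma penalty_bound:
  fixes \<gamma> m :: "nat \<Rightarrow> real"
  assumes w: "\<And>t j. j \<in> {1..L} \<Longrightarrow> w t j = \<gamma> j * max (sqrt (real (Suc t))) (m j)"
    and nonneg: "\<And>j. j \<in> {1..L} \<Longrightarrow> 0 \<le> \<gamma> j" "\<And>j. j \<in> {1..L} \<Longrightarrow> 0 \<le> m j"
    and p: "\<And>t. t < T \<Longrightarrow> p t \<in> prob_simplex G" and T: "1 \<le> T"
  shows "(\<Sum>j=1..L. w 0 j * level_entropy j (p 0))
      + (\<Sum>t\<in>{1..<T}. \<Sum>j=1..L. (w t j - w (t - 1) j) * level_entropy j (p t))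
    \<le> (\<Sum>j=1..L. \<gamma> j * m j * level_entropy j (p 0))
      + (\<Sum>t<T. \<Sum>j=1..L. \<gamma> j / sqrt (real (Suc t)) * level_entropy j (p t))"
proof -
  have "(\<Sum>j=1..L. w 0 j * level_entropy j (p 0))
     \<le> (\<Sum>j=1..L. (\<gamma> j * m j + \<gamma> j / sqrt (real (Suc 0))) * level_entropy j (p 0))"
  proof (intro sum_mono mult_right_mono)
    fix j assume j: "j \<in> {1..L}"
    have "\<gamma> j * max 1 (m j) \<le> \<gamma> j * (m j + 1)" using nonneg[OF j] by (intro mult_left_mono) auto
    then show "w 0 j \<le> \<gamma> j * m j + \<gamma> j / sqrt (real (Suc 0))" using w[OF j, of 0] by (simp add: algebra_simps)
  qed (use p T level_entropy_nonneg in auto)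
  moreover have "(\<Sum>t\<in>{1..<T}. \<Sum>j=1..L. (w t j - w (t - 1) j) * level_entropy j (p t))
    \<le> (\<Sum>t\<in>{1..<T}. \<Sum>j=1..L. \<gamma> j / sqrt (real (Suc t)) * level_entropy j (p t))"
  proof (intro sum_mono mult_right_mono)
    fix t j assume t: "t \<in> {1..<T}" and j: "j \<in> {1..L}"
    show "0 \<le> level_entropy j (p t)" using t p level_entropy_nonneg by simp
    define x y where "x = sqrt (real t)" and "y = sqrt (real (Suc t))"
    have xy: "0 \<le> x" "x \<le> y" "0 < y" "y\<^sup>2 = x\<^sup>2 + 1" by (auto simp: x_def y_def)
    have "(y - x) * y \<le> 1"
    proof -
      have "x * x \<le> x * y" using xy by (intro mult_left_mono)
      then show ?thesis using xy(4) by (simp add: power2_eq_square algebra_simps)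
    qed
    then have "y - x \<le> 1 / y" using xy by (simp add: field_simps)
    moreover have "max y (m j) - max x (m j) \<le> y - x" using xy by simp
    ultimately have "\<gamma> j * (max y (m j) - max x (m j)) \<le> \<gamma> j * (1 / y)"
      using nonneg[OF j] by (intro mult_left_mono) auto
    then show "w t j - w (t - 1) j \<le> \<gamma> j / sqrt (real (Suc t))"
      using t w[OF j, of t] w[OF j, of "t - 1"] by (simp add: x_def y_def algebra_simps)
  qed
  moreover have "(\<Sum>t<T. f t) = f 0 + (\<Sum>t\<in>{1..<T}. f t)" for f :: "nat \<Rightarrow> real"
    using T sum.atLeast_Suc_lessThan[of 0 T f] by (simp add: lessThan_atLeast0)
  ultimately show ?thesis by (simp add: sum.distrib distrib_right)
qed

end

declare One_nat_def [simp del]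

section \<open>One round of the algorithm\<close>

locale tree_sampling = leveled_tree G L
  for G :: "'v rtree" and L :: nat +
  fixes n :: nat and D :: "nat set pmf" and ord :: "nat set \<Rightarrow> nat \<Rightarrow> nat"
  assumes D: "set_pmf D \<subseteq> {S. S \<subseteq> {1..L} \<and> card S = n}"
    and xi_pos: "\<And>j. j \<in> {1..L} \<Longrightarrow> 0 < incl_prob D j"
    and order: "order_on_subsets L n ord"
begin

abbreviation \<xi> :: "nat \<Rightarrow> real" where "\<xi> \<equiv> incl_prob D"

lemma finite_set_D [simp]: "finite (set_pmf D)"
  by (rule finite_subset[of _ "Pow {1..L}"]) (use D in auto)

lemma D_subset: "M \<in> set_pmf D \<Longrightarrow> M \<subseteq> {1..L}" and D_finite: "M \<in> set_pmf D \<Longrightarrow> finite M"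
  using D finite_subset[of M "{1..L}"] by auto

lemma ord_bij: "M \<in> set_pmf D \<Longrightarrow> bij_betw (ord M) {2..n+1} M"
  using order D unfolding order_on_subsets_def by blast

lemma sum_D: "(\<Sum>M\<in>set_pmf D. pmf D M) = 1"
  by (rule sum_pmf_eq_1) auto

text \<open>Averaging over the random set turns the indicator of \<open>j\<close> into its inclusion
  probability, which cancels one factor 1 / \<xi> of the estimator.\<close>

lemma sum_D_incl:
  "(\<Sum>M\<in>set_pmf D. pmf D M * (\<Sum>j=1..L. (if j \<in> M then 1 else 0) * f j)) = (\<Sum>j=1..L. \<xi> j * f j)"
proof -
  have xi: "\<xi> j = (\<Sum>M\<in>set_pmf D. pmf D M * (if j \<in> M then 1 else 0))" for j
  proof -
    have "\<xi> j = measure_pmf.expectation D (indicator {S. j \<in> S})"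
      unfolding incl_prob_def by simp
    also have "\<dots> = (\<Sum>M\<in>set_pmf D. pmf D M *\<^sub>R indicator {S. j \<in> S} M)"
      by (rule integral_measure_pmf) auto
    also have "\<dots> = (\<Sum>M\<in>set_pmf D. pmf D M * (if j \<in> M then 1 else 0))"
      by (intro sum.cong refl) (simp add: indicator_def)
    finally show ?thesis .
  qed
  have "(\<Sum>M\<in>set_pmf D. pmf D M * (\<Sum>j=1..L. (if j \<in> M then 1 else 0) * f j))
     = (\<Sum>j=1..L. \<Sum>M\<in>set_pmf D. pmf D M * (if j \<in> M then 1 else 0) * f j)"
    unfolding sum_distrib_left by (subst sum.swap) (simp only: mult.assoc)
  then show ?thesis unfolding xi sum_distrib_right .
qed

text \<open>Positivity gives every conditioning event of a round positive probability and makes all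
  masses on the levels invertible.\<close>

definition pos_dist :: "('v \<Rightarrow> real) \<Rightarrow> bool" where
  "pos_dist p \<longleftrightarrow> p \<in> prob_simplex G \<and> (\<forall>a\<in>leaves G. 0 < p a)"

lemma pmf_embed_simplex:
  assumes "p \<in> prob_simplex G" shows "pmf (embed_pmf p) a = p a"
proof (rule pmf_embed_pmf)
  show "0 \<le> p x" for x using simplex_nonneg[OF assms] .
  have "(\<integral>\<^sup>+ x. ennreal (p x) \<partial>count_space UNIV) = (\<Sum>a\<in>leaves G. ennreal (p a))"
    by (rule nn_integral_count_space') (use simplexD(2)[OF assms] in auto)
  also have "\<dots> = 1"
    using simplexD(3)[OF assms] simplex_nonneg[OF assms] by (subst sum_ennreal) auto
  finally show "(\<integral>\<^sup>+ x. ennreal (p x) \<partial>count_space UNIV) = 1" .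
qed

lemma set_embed_simplex:
  assumes "pos_dist p" shows "set_pmf (embed_pmf p) = leaves G"
proof -
  have p: "p \<in> prob_simplex G" using assms unfolding pos_dist_def by simp
  have "a \<in> leaves G \<longleftrightarrow> p a \<noteq> 0" for a
    using assms simplexD(2)[OF p, of a] unfolding pos_dist_def by force
  then show ?thesis by (auto simp: set_pmf_eq pmf_embed_simplex[OF p])
qed

abbreviation cond_class :: "('v \<Rightarrow> real) \<Rightarrow> nat \<Rightarrow> 'v \<Rightarrow> 'v pmf" where
  "cond_class p k a \<equiv> cond_pmf (embed_pmf p) {b \<in> leaves G. anc G k b = anc G k a}"

text \<open>The conditional expectation of \<open>y\<close> under \<open>p\<close>, given that the
  leaf lies below \<open>v\<close>.\<close>

definition class_mean :: "('v \<Rightarrow> real) \<Rightarrow> ('v \<Rightarrow> real) \<Rightarrow> 'v \<Rightarrow> real" where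
  "class_mean p y v = mass G (\<lambda>b. p b * y b) v / mass G p v"

context
  fixes p :: "'v \<Rightarrow> real"
  assumes p: "pos_dist p"
begin

lemma p_simplex: "p \<in> prob_simplex G" and p_pos: "a \<in> leaves G \<Longrightarrow> 0 < p a"
  using p unfolding pos_dist_def by auto

lemma mass_anc_pos: "a \<in> leaves G \<Longrightarrow> j \<le> L \<Longrightarrow> 0 < mass G p (anc G j a)"
  by (rule mass_pos[OF p_pos anc_in_level])

lemma class_meets:
  "a \<in> leaves G \<Longrightarrow> set_pmf (embed_pmf p) \<inter> {b \<in> leaves G. anc G k b = anc G k a} \<noteq> {}"
  by (auto simp: set_embed_simplex[OF p])

lemma set_cond_class:
  "a \<in> leaves G \<Longrightarrow> set_pmf (cond_class p k a) = {b \<in> leaves G. anc G k b = anc G k a}"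
  by (subst set_cond_pmf[OF class_meets]) (auto simp: set_embed_simplex[OF p])

lemma expectation_cond_class:
  assumes a: "a \<in> leaves G" and k: "k \<le> L"
  shows "measure_pmf.expectation (cond_class p k a) y = class_mean p y (anc G k a)"
proof -
  let ?S = "{b \<in> leaves G. anc G k b = anc G k a}"
  have S: "finite ?S" by simp
  have m: "measure_pmf.prob (embed_pmf p) ?S = mass G p (anc G k a)"
    by (simp add: measure_measure_pmf_finite pmf_embed_simplex[OF p_simplex] mass_anc[OF a k])
  have "measure_pmf.expectation (cond_class p k a) y = (\<Sum>b\<in>?S. pmf (cond_class p k a) b *\<^sub>R y b)"
    by (rule integral_measure_pmf) (use set_cond_class[OF a] in auto)
  also have "\<dots> = (\<Sum>b\<in>?S. p b * y b / mass G p (anc G k a))"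
    by (intro sum.cong refl) (simp add: pmf_cond[OF class_meets[OF a]] m pmf_embed_simplex[OF p_simplex])
  finally show ?thesis
    unfolding class_mean_def mass_anc[OF a k, of "\<lambda>b. p b * y b"] by (simp add: sum_divide_distrib)
qed

text \<open>Tower property. It is the reason why an action resampled within a class of the first
  action still has law \<open>p\<close>.\<close>

lemma sum_class_mean:
  assumes k: "k \<le> L"
  shows "(\<Sum>a\<in>leaves G. p a * class_mean p y (anc G k a)) = (\<Sum>a\<in>leaves G. p a * y a)"
proof -
  have "(\<Sum>a\<in>leaves G. p a * class_mean p y (anc G k a)) = (\<Sum>v\<in>level G k. mass G p v * class_mean p y v)"
    by (rule sum_level_mass[OF k, symmetric])
  also have "\<dots> = (\<Sum>v\<in>level G k. mass G (\<lambda>b. p b * y b) v)"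
    using mass_pos[OF p_pos] unfolding class_mean_def by (intro sum.cong refl) (simp add: less_imp_neq[symmetric])
  also have "\<dots> = (\<Sum>a\<in>leaves G. p a * y a)" by (rule sum_level_mass1[OF k])
  finally show ?thesis .
qed

abbreviation others :: "nat set \<Rightarrow> 'v \<Rightarrow> (nat \<Rightarrow> 'v) pmf" where
  "others M a \<equiv> Pi_pmf {2..n+1} undefined (\<lambda>i. cond_class p (ord M i - 1) a)"

abbreviation round_pmf :: "'v move pmf" where
  "round_pmf \<equiv> ftrl_round G n D ord p"

lemma ftrl_round_alt:
  "round_pmf = embed_pmf p \<bind> (\<lambda>a. D \<bind> (\<lambda>M. map_pmf (\<lambda>A. (M, A(1 := a))) (others M a)))"
  unfolding ftrl_round_def map_pmf_def ..

lemma set_others: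
  assumes "a \<in> leaves G"
  shows "set_pmf (others M a) = PiE_dflt {2..n+1} undefined (\<lambda>i. {b \<in> leaves G. anc G (ord M i - 1) b = anc G (ord M i - 1) a})"
  by (subst set_Pi_pmf) (simp_all add: o_def set_cond_class[OF assms])

lemma finite_set_others: "a \<in> leaves G \<Longrightarrow> finite (set_pmf (others M a))"
  unfolding set_others by (intro finite_PiE_dflt) auto

lemma finite_set_round: "finite (set_pmf round_pmf)"
  unfolding ftrl_round_alt by (auto simp: set_embed_simplex[OF p] finite_set_others)

lemma round_support:
  assumes m: "(M, A) \<in> set_pmf round_pmf"
  shows "M \<in> set_pmf D" "A \<in> {1..n+1} \<rightarrow>\<^sub>E leaves G"
    "\<And>i. i \<in> {2..n+1} \<Longrightarrow> anc G (ord M i - 1) (A i) = anc G (ord M i - 1) (A 1)"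
proof -
  obtain a B where a: "a \<in> leaves G" and M: "M \<in> set_pmf D" and B: "B \<in> set_pmf (others M a)" and A: "A = B(1 := a)"
    using m unfolding ftrl_round_alt by (auto simp: set_embed_simplex[OF p])
  have B': "B i \<in> leaves G \<and> anc G (ord M i - 1) (B i) = anc G (ord M i - 1) a" if "i \<in> {2..n+1}" for i
    using B that unfolding set_others[OF a] PiE_dflt_def by auto
  have Bu: "B i = undefined" if "i \<notin> {2..n+1}" for i
    using B that unfolding set_others[OF a] PiE_dflt_def by auto
  show "M \<in> set_pmf D" by fact
  show "A \<in> {1..n+1} \<rightarrow>\<^sub>E leaves G"
  proof (rule PiE_I)
    fix i assume "i \<in> {1..n+1}"
    then show "A i \<in> leaves G" using B'[of i] a by (cases "i = 1") (auto simp: A)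
  next
    fix i assume "i \<notin> {1..n+1}"
    then show "A i = undefined" using Bu[of i] by (auto simp: A)
  qed
  show "anc G (ord M i - 1) (A i) = anc G (ord M i - 1) (A 1)" if "i \<in> {2..n+1}" for i
    using B'[OF that] that by (auto simp: A)
qed

lemma set_round_moves: "set_pmf round_pmf \<subseteq> moves G n"
proof
  fix m assume m: "m \<in> set_pmf round_pmf"
  obtain M A where "m = (M, A)" by (cases m)
  then show "m \<in> moves G n"
    using round_support(1,2)[of M A] D_finite[of M] m unfolding moves_def by simp
qed

text \<open>The point of index \<open>k\<close> is drawn when \<open>k + 1\<close> is processed,
  hence conditionally on the class at depth \<open>k\<close>. That it is a played action makes its
  masked loss equal to its true loss.\<close>

lemma sample_point_support:
  assumes m: "(M, A) \<in> set_pmf round_pmf"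
  shows "sample_point n ord (M, A) k \<in> leaves G" "sample_point n ord (M, A) k \<in> A ` {1..n+1}"
    "anc G k (sample_point n ord (M, A) k) = anc G k (A 1)"
proof -
  note s = round_support[OF m]
  have A1: "1 \<in> {1..n+1}" by simp
  have "sample_point n ord (M, A) k \<in> leaves G \<and> sample_point n ord (M, A) k \<in> A ` {1..n+1} \<and>
    anc G k (sample_point n ord (M, A) k) = anc G k (A 1)"
  proof (cases "k + 1 \<in> M")
    case False
    then show ?thesis using s(2) A1 by (auto simp: sample_point_def)
  next
    case True
    define i where "i = inv_into {2..n+1} (ord M) (k + 1)"
    have "k + 1 \<in> ord M ` {2..n+1}" using ord_bij[OF s(1)] True unfolding bij_betw_def by simp
    then have i: "i \<in> {2..n+1}" "ord M i = k + 1"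
      unfolding i_def by (rule inv_into_into, rule f_inv_into_f)
    then have "i \<in> {1..n+1}" by simp
    then show ?thesis using s(2) s(3)[OF i(1)] i True by (auto simp: sample_point_def i_def[symmetric])
  qed
  then show "sample_point n ord (M, A) k \<in> leaves G" "sample_point n ord (M, A) k \<in> A ` {1..n+1}"
    "anc G k (sample_point n ord (M, A) k) = anc G k (A 1)" by auto
qed

lemma expectation_round:
  "measure_pmf.expectation round_pmf f =
    (\<Sum>a\<in>leaves G. p a * (\<Sum>M\<in>set_pmf D. pmf D M * measure_pmf.expectation (others M a) (\<lambda>A. f (M, A(1 := a)))))"
proof -
  have fin: "finite (set_pmf (D \<bind> (\<lambda>M. map_pmf (\<lambda>A. (M, A(1 := a))) (others M a))))" if "a \<in> leaves G" for a
    using that finite_set_others by (auto simp: set_map_pmf)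
  have "measure_pmf.expectation round_pmf f =
    (\<Sum>a\<in>leaves G. pmf (embed_pmf p) a *\<^sub>R measure_pmf.expectation (D \<bind> (\<lambda>M. map_pmf (\<lambda>A. (M, A(1 := a))) (others M a))) f)"
    unfolding ftrl_round_alt by (rule pmf_expectation_bind) (use fin set_embed_simplex[OF p] in auto)
  also have "\<dots> = (\<Sum>a\<in>leaves G. p a * (\<Sum>M\<in>set_pmf D. pmf D M * measure_pmf.expectation (others M a) (\<lambda>A. f (M, A(1 := a)))))"
  proof (intro sum.cong refl)
    fix a assume a: "a \<in> leaves G"
    have "measure_pmf.expectation (D \<bind> (\<lambda>M. map_pmf (\<lambda>A. (M, A(1 := a))) (others M a))) f
      = (\<Sum>M\<in>set_pmf D. pmf D M *\<^sub>R measure_pmf.expectation (map_pmf (\<lambda>A. (M, A(1 := a))) (others M a)) f)"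
      by (rule pmf_expectation_bind) (use finite_set_others[OF a] in auto)
    then show "pmf (embed_pmf p) a *\<^sub>R measure_pmf.expectation (D \<bind> (\<lambda>M. map_pmf (\<lambda>A. (M, A(1 := a))) (others M a))) f
      = p a * (\<Sum>M\<in>set_pmf D. pmf D M * measure_pmf.expectation (others M a) (\<lambda>A. f (M, A(1 := a))))"
      by (simp add: pmf_embed_simplex[OF p_simplex])
  qed
  finally show ?thesis .
qed

lemma expectation_other:
  assumes a: "a \<in> leaves G" and M: "M \<in> set_pmf D" and i: "i \<in> {2..n+1}"
  shows "measure_pmf.expectation (others M a) (\<lambda>A. y (A i)) = class_mean p y (anc G (ord M i - 1) a)"
proof -
  have "ord M i \<in> M" using ord_bij[OF M] i unfolding bij_betw_def by auto
  then have le: "ord M i - 1 \<le> L" using D_subset[OF M] by fastforce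
  have "measure_pmf.expectation (others M a) (\<lambda>A. y (A i)) = measure_pmf.expectation (map_pmf (\<lambda>A. A i) (others M a)) y"
    by simp
  also have "map_pmf (\<lambda>A. A i) (others M a) = cond_class p (ord M i - 1) a"
    using i by (subst Pi_pmf_component) auto
  finally show ?thesis using expectation_cond_class[OF a le] by simp
qed

lemma expectation_sample_point:
  assumes a: "a \<in> leaves G" and M: "M \<in> set_pmf D"
  shows "measure_pmf.expectation (others M a) (\<lambda>A. y (sample_point n ord (M, A(1 := a)) k))
    = (if k + 1 \<in> M then class_mean p y (anc G k a) else y a)"
proof (cases "k + 1 \<in> M")
  case False
  then show ?thesis by (simp add: sample_point_def)
next
  case True
  define i where "i = inv_into {2..n+1} (ord M) (k + 1)"
  have "k + 1 \<in> ord M ` {2..n+1}" using ord_bij[OF M] True unfolding bij_betw_def by simp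
  then have i: "i \<in> {2..n+1}" "ord M i = k + 1"
    unfolding i_def by (rule inv_into_into, rule f_inv_into_f)
  then have "sample_point n ord (M, A(1 := a)) k = A i" for A
    using True by (auto simp: sample_point_def i_def[symmetric])
  then show ?thesis using True expectation_other[OF a M i(1), of y] i by simp
qed

lemma expectation_play:
  assumes i: "i \<in> {1..n+1}"
  shows "measure_pmf.expectation round_pmf (\<lambda>m. y (snd m i)) = (\<Sum>a\<in>leaves G. p a * y a)"
proof (cases "i = 1")
  case True
  then show ?thesis unfolding expectation_round by (simp add: sum_distrib_right[symmetric] sum_D)
next
  case False
  then have i2: "i \<in> {2..n+1}" using i by auto
  have "measure_pmf.expectation round_pmf (\<lambda>m. y (snd m i))
    = (\<Sum>a\<in>leaves G. p a * (\<Sum>M\<in>set_pmf D. pmf D M * class_mean p y (anc G (ord M i - 1) a)))"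
    unfolding expectation_round using False expectation_other[OF _ _ i2] by simp
  also have "\<dots> = (\<Sum>M\<in>set_pmf D. pmf D M * (\<Sum>a\<in>leaves G. p a * class_mean p y (anc G (ord M i - 1) a)))"
    unfolding sum_distrib_left by (subst sum.swap) (simp add: mult_ac)
  also have "\<dots> = (\<Sum>M\<in>set_pmf D. pmf D M * (\<Sum>a\<in>leaves G. p a * y a))"
  proof (intro sum.cong refl)
    fix M assume M: "M \<in> set_pmf D"
    have "ord M i \<in> M" using ord_bij[OF M] i2 unfolding bij_betw_def by auto
    then have "ord M i - 1 \<le> L" using D_subset[OF M] by fastforce
    then show "pmf D M * (\<Sum>a\<in>leaves G. p a * class_mean p y (anc G (ord M i - 1) a))
      = pmf D M * (\<Sum>a\<in>leaves G. p a * y a)"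
      by (simp only: sum_class_mean)
  qed
  also have "\<dots> = (\<Sum>a\<in>leaves G. p a * y a)" by (simp add: sum_distrib_right[symmetric] sum_D)
  finally show ?thesis .
qed

lemma round_integrable [simp]: "integrable (measure_pmf round_pmf) (f :: _ \<Rightarrow> real)"
  by (rule integrable_measure_pmf_finite[OF finite_set_round])

lemma others_integrable: "a \<in> leaves G \<Longrightarrow> integrable (measure_pmf (others M a)) (f :: _ \<Rightarrow> real)"
  by (rule integrable_measure_pmf_finite[OF finite_set_others])

lemma loss_estimate_sum:
  assumes "M \<subseteq> {1..L}"
  shows "loss_estimate G n D ord b p y (M, A) a = (\<Sum>j=1..L. (if j \<in> M then 1 else 0) *
    ((if anc G j a = anc G j (A 1) then 1 else 0) *
     ((y (sample_point n ord (M, A) j) - y (sample_point n ord (M, A) (j - 1)) + b j) / (\<xi> j * mass G p (anc G j (A 1))))))"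
proof -
  have restr: "(\<Sum>j\<in>M. h j) = (\<Sum>j=1..L. (if j \<in> M then 1 else 0) * h j)" for h :: "nat \<Rightarrow> real"
  proof -
    have "(\<Sum>j\<in>{1..L} \<inter> M. h j) = (\<Sum>j=1..L. if j \<in> M then h j else 0)"
      by (rule sum.inter_restrict) simp
    also have "\<dots> = (\<Sum>j=1..L. (if j \<in> M then 1 else 0) * h j)"
      by (intro sum.cong refl) simp
    finally show ?thesis using assms by (simp add: Int_absorb1)
  qed
  show ?thesis unfolding loss_estimate_def prod.case by (rule restr)
qed

text \<open>The estimate of level \<open>j\<close> is unbiased for the increment of the class means from depth
  \<open>j - 1\<close> to depth \<open>j\<close>, and these increments telescope.\<close>

lemma expectation_loss_estimate:
  assumes a0: "a0 \<in> leaves G"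
  shows "measure_pmf.expectation round_pmf (\<lambda>m. loss_estimate G n D ord b p y m a0)
    = y a0 - (\<Sum>a\<in>leaves G. p a * y a) + (\<Sum>j=1..L. b j)"
proof -
  let ?cm = "\<lambda>k a. class_mean p y (anc G k a)"
  define same where "same j a = (if anc G j a0 = anc G j a then 1 else 0 :: real)" for j a
  define P where "P j = mass G p (anc G j a0)" for j
  define Y where "Y j M a = (if j + 1 \<in> M then ?cm j a else y a)" for j M a
  have inner: "measure_pmf.expectation (others M a) (\<lambda>A. loss_estimate G n D ord b p y (M, A(1 := a)) a0)
     = (\<Sum>j=1..L. (if j \<in> M then 1 else 0) * (same j a * ((Y j M a - ?cm (j - 1) a0 + b j) / (\<xi> j * P j))))"
    if a: "a \<in> leaves G" and M: "M \<in> set_pmf D" for a M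
  proof -
    have "measure_pmf.expectation (others M a) (\<lambda>A. loss_estimate G n D ord b p y (M, A(1 := a)) a0)
      = (\<Sum>j=1..L. (if j \<in> M then 1 else 0) * (same j a *
     ((measure_pmf.expectation (others M a) (\<lambda>A. y (sample_point n ord (M, A(1 := a)) j))
      - measure_pmf.expectation (others M a) (\<lambda>A. y (sample_point n ord (M, A(1 := a)) (j - 1))) + b j) / (\<xi> j * mass G p (anc G j a)))))"
      unfolding loss_estimate_sum[OF D_subset[OF M]] same_def
      by (simp add: others_integrable[OF a] Bochner_Integration.integral_sum)
    also have "\<dots> = (\<Sum>j=1..L. (if j \<in> M then 1 else 0) * (same j a * ((Y j M a - ?cm (j - 1) a0 + b j) / (\<xi> j * P j))))"
    proof (intro sum.cong refl)
      fix j assume j: "j \<in> {1..L}"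
      show "(if j \<in> M then 1 else 0) * (same j a *
     ((measure_pmf.expectation (others M a) (\<lambda>A. y (sample_point n ord (M, A(1 := a)) j))
      - measure_pmf.expectation (others M a) (\<lambda>A. y (sample_point n ord (M, A(1 := a)) (j - 1))) + b j) / (\<xi> j * mass G p (anc G j a))))
      = (if j \<in> M then 1 else 0) * (same j a * ((Y j M a - ?cm (j - 1) a0 + b j) / (\<xi> j * P j)))"
      proof (cases "j \<in> M \<and> anc G j a0 = anc G j a")
        case True
        \<comment> \<open>The indicator leaves only first actions in the depth-\<open>j\<close>
          class of \<open>a0\<close>. These share the coarser class as well, so the mean at depth
          \<open>j - 1\<close> may be taken at \<open>a0\<close>.\<close>
        then have "anc G (j - 1) a0 = anc G (j - 1) a" using anc_refine[OF a0 a, of j "j - 1"] j by simp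
        then show ?thesis using True j unfolding expectation_sample_point[OF a M]
          by (simp add: Y_def P_def)
      qed (auto simp: same_def)
    qed
    finally show ?thesis .
  qed
  have col: "(\<Sum>a\<in>leaves G. p a * (same j a * ((Y j M a - ?cm (j - 1) a0 + b j) / (\<xi> j * P j))))
     = (?cm j a0 - ?cm (j - 1) a0 + b j) / \<xi> j" if j: "j \<in> {1..L}" for j M
  proof -
    have Pj: "0 < P j" unfolding P_def using mass_anc_pos[OF a0] j by simp
    have same_sum: "(\<Sum>a\<in>leaves G. x a * same j a) = mass G x (anc G j a0)" for x
    proof -
      have "j \<le> L" using j by simp
      then have "mass G x (anc G j a0) = (\<Sum>b\<in>leaves G. if anc G j b = anc G j a0 then x b else 0)"
        by (simp only: mass_anc[OF a0] sum.inter_filter[OF finite_leaves])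
      also have "\<dots> = (\<Sum>a\<in>leaves G. x a * same j a)"
        unfolding same_def by (intro sum.cong refl) auto
      finally show ?thesis ..
    qed
    have P: "(\<Sum>a\<in>leaves G. p a * same j a) = P j"
      unfolding P_def by (rule same_sum)
    have cm: "(\<Sum>a\<in>leaves G. p a * (same j a * y a)) = P j * ?cm j a0"
    proof -
      have "(\<Sum>a\<in>leaves G. p a * (same j a * y a)) = (\<Sum>a\<in>leaves G. p a * y a * same j a)"
        by (intro sum.cong refl) (simp only: mult_ac)
      then show ?thesis using Pj same_sum[of "\<lambda>a. p a * y a"] by (simp add: class_mean_def P_def)
    qed
    \<comment> \<open>Whether the point of index \<open>j\<close> is the first action or a fresh
      sample from its class, its average over the first action in that class is the class mean.
      Hence the set \<open>M\<close> matters only through \<open>j \<in> M\<close>, and no joint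
      inclusion probabilities appear.\<close>
    have Y: "(\<Sum>a\<in>leaves G. p a * (same j a * Y j M a)) = P j * ?cm j a0"
    proof (cases "j + 1 \<in> M")
      case True
      have "(\<Sum>a\<in>leaves G. p a * (same j a * Y j M a)) = (\<Sum>a\<in>leaves G. p a * same j a * ?cm j a0)"
        by (intro sum.cong refl) (auto simp: Y_def True same_def)
      then show ?thesis unfolding sum_distrib_right[symmetric] P .
    qed (use cm in \<open>simp add: Y_def\<close>)
    have "(\<Sum>a\<in>leaves G. p a * (same j a * ((Y j M a - ?cm (j - 1) a0 + b j) / (\<xi> j * P j))))
      = (\<Sum>a\<in>leaves G. (p a * (same j a * Y j M a) - p a * same j a * (?cm (j - 1) a0 - b j)) / (\<xi> j * P j))"
      by (intro sum.cong refl) (simp add: algebra_simps add_divide_distrib diff_divide_distrib)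
    also have "\<dots> = (P j * ?cm j a0 - P j * (?cm (j - 1) a0 - b j)) / (\<xi> j * P j)"
      by (simp only: sum_divide_distrib[symmetric] sum_subtractf Y sum_distrib_right[symmetric] P)
    also have "\<dots> = (?cm j a0 - ?cm (j - 1) a0 + b j) / \<xi> j"
      using Pj xi_pos[OF j] by (simp add: field_simps)
    finally show ?thesis .
  qed
  have "measure_pmf.expectation round_pmf (\<lambda>m. loss_estimate G n D ord b p y m a0)
    = (\<Sum>a\<in>leaves G. p a * (\<Sum>M\<in>set_pmf D. pmf D M * (\<Sum>j=1..L. (if j \<in> M then 1 else 0) *
        (same j a * ((Y j M a - ?cm (j - 1) a0 + b j) / (\<xi> j * P j))))))"
    unfolding expectation_round by (intro sum.cong refl arg_cong2[of _ _ _ _ "(*)"] inner)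
  also have "\<dots> = (\<Sum>M\<in>set_pmf D. pmf D M * (\<Sum>j=1..L. (if j \<in> M then 1 else 0) *
        (\<Sum>a\<in>leaves G. p a * (same j a * ((Y j M a - ?cm (j - 1) a0 + b j) / (\<xi> j * P j))))))"
    unfolding sum_distrib_left
    by (subst sum.swap[where A="leaves G" and B="set_pmf D"], subst sum.swap[where A="leaves G" and B="{1..L}"])
      (intro sum.cong refl, simp only: mult_ac)
  also have "\<dots> = (\<Sum>M\<in>set_pmf D. pmf D M * (\<Sum>j=1..L. (if j \<in> M then 1 else 0) *
        ((?cm j a0 - ?cm (j - 1) a0 + b j) / \<xi> j)))"
    by (intro sum.cong refl arg_cong2[of _ _ _ _ "(*)"] col) auto
  also have "\<dots> = (\<Sum>j=1..L. \<xi> j * ((?cm j a0 - ?cm (j - 1) a0 + b j) / \<xi> j))"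
    by (rule sum_D_incl)
  also have "\<dots> = (\<Sum>j=1..L. (?cm j a0 - ?cm (j - 1) a0) + b j)"
    using xi_pos by (intro sum.cong refl) (simp add: less_imp_neq[symmetric])
  also have "\<dots> = ?cm L a0 - ?cm 0 a0 + (\<Sum>j=1..L. b j)"
    using sum_telescope''[of 0 L "\<lambda>j. ?cm j a0"] by (simp add: sum.distrib One_nat_def)
  also have "?cm L a0 = y a0"
    using p_pos[OF a0] a0 unfolding class_mean_def by (simp add: mass_leaf)
  also have "?cm 0 a0 = (\<Sum>a\<in>leaves G. p a * y a)"
  proof -
    have "{b. b \<in> leaves G \<and> anc G 0 b = anc G 0 a0} = leaves G"
      using a0 by (auto simp: anc_0)
    then have "mass G x (anc G 0 a0) = (\<Sum>a\<in>leaves G. x a)" for x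
      by (simp only: mass_anc[OF a0 le0])
    then show ?thesis unfolding class_mean_def using simplexD(3)[OF p_simplex] by simp
  qed
  finally show ?thesis .
qed

text \<open>The coefficient is \<open>2 * c / (c - 1)\<close> times the square of
  \<open>2 * \<sigma> j / \<xi> j\<close>, the largest possible increment. With the increments
  bounded, only the set and the first action enter, so the mean does not involve the losses.\<close>

definition stab_bound :: "real \<Rightarrow> (nat \<Rightarrow> real) \<Rightarrow> (nat \<Rightarrow> real) \<Rightarrow> 'v move \<Rightarrow> real" where
  "stab_bound c \<sigma> w m = (\<Sum>j=1..L. (if j \<in> fst m then 1 else 0) * (8 * c / (c - 1) / w j * (\<sigma> j / \<xi> j)\<^sup>2 *
     (\<Sum>v\<in>level G j. ((if v = anc G j (snd m 1) then 1 / mass G p v else 0) - 1)\<^sup>2 * (mass G p v * sqrt (mass G p v)))))"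

lemma stab_bound_nonneg:
  assumes "\<And>j. j \<in> {1..L} \<Longrightarrow> 0 < w j" "2 \<le> c"
  shows "0 \<le> stab_bound c \<sigma> w m"
  unfolding stab_bound_def using assms mass_nonneg[OF p_simplex]
  by (intro sum_nonneg mult_nonneg_nonneg divide_nonneg_nonneg) (auto intro: less_imp_le)

text \<open>For a node of mass P the importance-weighted indicator has mean 1 and variance 1/P - 1;
  multiplied by P \<open>sqrt\<close> P this is \<open>sqrt\<close> P (1 - P).\<close>

lemma expectation_stab_bound:
  "measure_pmf.expectation round_pmf (stab_bound c \<sigma> w)
    = (\<Sum>j=1..L. 8 * c / (c - 1) / w j * ((\<sigma> j)\<^sup>2 / \<xi> j) * level_variance j p)"
proof -
  define h where "h j a = (\<Sum>v\<in>level G j. ((if v = anc G j a then 1 / mass G p v else 0) - 1)\<^sup>2 * (mass G p v * sqrt (mass G p v)))" for j a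
  have h: "(\<Sum>a\<in>leaves G. p a * h j a) = level_variance j p" if j: "j \<in> {1..L}" for j
  proof -
    have "(\<Sum>a\<in>leaves G. p a * h j a) = (\<Sum>v\<in>level G j.
        (\<Sum>a\<in>leaves G. p a * ((if v = anc G j a then 1 / mass G p v else 0) - 1)\<^sup>2) * (mass G p v * sqrt (mass G p v)))"
      unfolding h_def sum_distrib_left sum_distrib_right by (subst sum.swap) (simp only: mult.assoc)
    also have "\<dots> = level_variance j p" unfolding level_variance_def
    proof (intro sum.cong refl)
      fix v assume v: "v \<in> level G j"
      define P where "P = mass G p v"
      have P: "0 < P" unfolding P_def using mass_pos[OF p_pos v] .
      have "(\<Sum>a\<in>leaves G. p a * ((if v = anc G j a then 1 / P else 0) - 1)\<^sup>2)
        = (\<Sum>u\<in>level G j. mass G p u * ((if v = u then 1 / P else 0) - 1)\<^sup>2)"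
        using j by (intro sum_level_mass[symmetric]) auto
      also have "\<dots> = (\<Sum>u\<in>level G j. mass G p u + (if v = u then P * ((1 / P - 1)\<^sup>2 - 1) else 0))"
        by (intro sum.cong refl) (auto simp: P_def algebra_simps)
      also have "\<dots> = 1 + P * ((1 / P - 1)\<^sup>2 - 1)"
        using v sum_level_simplex[OF p_simplex, of j] j by (simp add: sum.distrib)
      also have "\<dots> * (P * sqrt P) = sqrt P * (1 - P)"
        using P by (simp add: field_simps power2_eq_square)
      finally show "(\<Sum>a\<in>leaves G. p a * ((if v = anc G j a then 1 / mass G p v else 0) - 1)\<^sup>2) * (mass G p v * sqrt (mass G p v))
        = sqrt (mass G p v) * (1 - mass G p v)" unfolding P_def .
    qed
    finally show ?thesis .
  qed
  let ?k = "\<lambda>j. 8 * c / (c - 1) / w j * (\<sigma> j / \<xi> j)\<^sup>2"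
  have "measure_pmf.expectation round_pmf (stab_bound c \<sigma> w)
    = (\<Sum>a\<in>leaves G. p a * (\<Sum>M\<in>set_pmf D. pmf D M * (\<Sum>j=1..L. (if j \<in> M then 1 else 0) * (?k j * h j a))))"
    unfolding expectation_round stab_bound_def h_def by simp
  also have "\<dots> = (\<Sum>a\<in>leaves G. p a * (\<Sum>j=1..L. \<xi> j * (?k j * h j a)))"
    unfolding sum_D_incl ..
  also have "\<dots> = (\<Sum>j=1..L. \<xi> j * ?k j * (\<Sum>a\<in>leaves G. p a * h j a))"
    unfolding sum_distrib_left by (subst sum.swap) (intro sum.cong refl, simp only: mult_ac)
  also have "\<dots> = (\<Sum>j=1..L. 8 * c / (c - 1) / w j * ((\<sigma> j)\<^sup>2 / \<xi> j) * level_variance j p)"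
  proof (intro sum.cong refl)
    fix j assume j: "j \<in> {1..L}"
    have "\<xi> j * (\<sigma> j / \<xi> j)\<^sup>2 = (\<sigma> j)\<^sup>2 / \<xi> j" using xi_pos[OF j] by (simp add: power2_eq_square)
    then have "\<xi> j * ?k j = 8 * c / (c - 1) / w j * ((\<sigma> j)\<^sup>2 / \<xi> j)"
      by (metis mult.left_commute)
    then show "\<xi> j * ?k j * (\<Sum>a\<in>leaves G. p a * h j a) = 8 * c / (c - 1) / w j * ((\<sigma> j)\<^sup>2 / \<xi> j) * level_variance j p"
      using h[OF j] by simp
  qed
  finally show ?thesis .
qed

end

section \<open>Rounds with tree-compatible losses\<close>

text \<open>The consequence of the bound through \<open>sep\<close> that fits the sampling: it is
  indexed by a shared class at depth \<open>j - 1\<close>, which is what two consecutive sample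
  points have in common.\<close>

definition tree_loss :: "(nat \<Rightarrow> real) \<Rightarrow> ('v \<Rightarrow> real) \<Rightarrow> bool" where
  "tree_loss \<sigma> y \<longleftrightarrow> (\<forall>j\<in>{1..L}. \<forall>a\<in>leaves G. \<forall>b\<in>leaves G. anc G (j - 1) a = anc G (j - 1) b \<longrightarrow> \<bar>y a - y b\<bar> \<le> \<sigma> j)"

text \<open>The case \<open>j = 1\<close>: all leaves share the root.\<close>

lemma tree_loss_diff:
  assumes "tree_loss \<sigma> y" "a \<in> leaves G" "b \<in> leaves G"
  shows "\<bar>y a - y b\<bar> \<le> \<sigma> 1"
  using assms L_pos anc_0 unfolding tree_loss_def by fastforce

text \<open>Both sample points lie in the depth-\<open>(j - 1)\<close> class of the first action, so
  their losses differ by at most \<open>\<sigma> j\<close>. Adding the offset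
  \<open>\<sigma> j\<close> makes the increment nonnegative.\<close>

lemma increment_bounds:
  assumes p: "pos_dist p" and m: "(M, A) \<in> set_pmf (ftrl_round G n D ord p)" and y: "tree_loss \<sigma> y" and j: "j \<in> M"
  shows "0 \<le> y (sample_point n ord (M, A) j) - y (sample_point n ord (M, A) (j - 1)) + \<sigma> j"
    "y (sample_point n ord (M, A) j) - y (sample_point n ord (M, A) (j - 1)) + \<sigma> j \<le> 2 * \<sigma> j"
proof -
  have j': "j \<in> {1..L}" using D_subset[OF round_support(1)[OF p m]] j by auto
  have A1: "A 1 \<in> leaves G" using round_support(2)[OF p m] by auto
  have B: "sample_point n ord (M, A) k \<in> leaves G" "anc G k (sample_point n ord (M, A) k) = anc G k (A 1)" for k
    using sample_point_support[OF p m] by auto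
  have "anc G (j - 1) (sample_point n ord (M, A) j) = anc G (j - 1) (A 1)"
    using j' by (intro anc_refine[OF B(1) A1 B(2)]) auto
  then have "\<bar>y (sample_point n ord (M, A) j) - y (sample_point n ord (M, A) (j - 1))\<bar> \<le> \<sigma> j"
    using y j' B unfolding tree_loss_def by metis
  then show "0 \<le> y (sample_point n ord (M, A) j) - y (sample_point n ord (M, A) (j - 1)) + \<sigma> j"
    "y (sample_point n ord (M, A) j) - y (sample_point n ord (M, A) (j - 1)) + \<sigma> j \<le> 2 * \<sigma> j" by auto
qed

text \<open>This serves integrability: the absolute mean of an estimate is its mean, which is
  known.\<close>

lemma loss_estimate_nonneg:
  assumes p: "pos_dist p" and m: "m \<in> set_pmf (ftrl_round G n D ord p)" and y: "tree_loss \<sigma> y"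
  shows "0 \<le> loss_estimate G n D ord \<sigma> p y m a"
proof -
  obtain M A where mM: "m = (M, A)" by (cases m)
  note m' = m[unfolded mM]
  have MD: "M \<subseteq> {1..L}" using D_subset[OF round_support(1)[OF p m']] .
  show ?thesis unfolding mM loss_estimate_def prod.case
  proof (intro sum_nonneg mult_nonneg_nonneg divide_nonneg_nonneg)
    fix j assume "j \<in> M"
    then show "0 \<le> y (sample_point n ord (M, A) j) - y (sample_point n ord (M, A) (j - 1)) + \<sigma> j"
      by (rule increment_bounds[OF p m' y])
    show "0 \<le> \<xi> j" using xi_pos MD \<open>j \<in> M\<close> less_imp_le by blast
    show "0 \<le> mass G p (anc G j (A 1))" by (rule mass_nonneg[OF p_simplex[OF p]])
  qed auto
qed

text \<open>Before the shift the level losses are nonnegative, so after it they are at least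
  \<open>- \<mu> j\<close>, hence at least \<open>- 2 * \<sigma> j / \<xi> j\<close>. The lower
  bound on the weights makes this at least \<open>- w j / (2 * c)\<close>, the requirement of the
  stability bound.\<close>

lemma ftrl_round_step:
  assumes min: "is_min w Z p" and w: "\<forall>j\<in>{1..L}. 0 < w j" and c: "2 \<le> c" and q: "q \<in> prob_simplex G"
    and m: "m \<in> set_pmf (ftrl_round G n D ord p)" and y: "tree_loss \<sigma> y"
    and w\<sigma>: "\<And>j. j \<in> {1..L} \<Longrightarrow> 4 * c * \<sigma> j / \<xi> j \<le> w j"
  shows "obj w Z p + (\<Sum>a\<in>leaves G. loss_estimate G n D ord \<sigma> p y m a * p a) - stab_bound p c \<sigma> w m
     \<le> obj w Z q + (\<Sum>a\<in>leaves G. loss_estimate G n D ord \<sigma> p y m a * q a)"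
proof -
  have p: "pos_dist p"
    using min is_min_positive[OF min w] unfolding pos_dist_def is_min_def by auto
  obtain M A where mM: "m = (M, A)" by (cases m)
  note m' = m[unfolded mM]
  have MD: "M \<subseteq> {1..L}" using D_subset[OF round_support(1)[OF p m']] .
  define d where "d j = y (sample_point n ord (M, A) j) - y (sample_point n ord (M, A) (j - 1)) + \<sigma> j" for j
  have d: "0 \<le> d j" "d j \<le> 2 * \<sigma> j" if "j \<in> M" for j
    using increment_bounds[OF p m' y that] unfolding d_def by auto
  define r where "r j v = (if v = anc G j (A 1) then 1 / mass G p v else 0)" for j v
  define g where "g j v = (if j \<in> M then d j / \<xi> j * r j v else 0)" for j v
  \<comment> \<open>At the sampled node v this is \<open>mass G p v * g j v\<close>. The mass
    cancels, so the shift stays bounded however small the mass is.\<close>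
  define \<mu> where "\<mu> j = (if j \<in> M then d j / \<xi> j else 0)" for j
  have xi: "0 < \<xi> j" if "j \<in> M" for j using xi_pos MD that by blast
  have d\<xi>: "0 \<le> d j / \<xi> j" "d j / \<xi> j \<le> 2 * \<sigma> j / \<xi> j" if "j \<in> M" for j
    using d[OF that] xi[OF that] by (auto intro!: divide_right_mono)
  have "obj w Z p + (\<Sum>a\<in>leaves G. loss_estimate G n D ord \<sigma> p y m a * p a) - (\<Sum>j=1..L. \<Sum>v\<in>level G j.
            2 * c / (c - 1) / w j * (g j v - \<mu> j)\<^sup>2 * (mass G p v * sqrt (mass G p v)))
     \<le> obj w Z q + (\<Sum>a\<in>leaves G. loss_estimate G n D ord \<sigma> p y m a * q a)"
  proof (rule is_min_step[OF min w q c])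
    fix a assume "a \<in> leaves G"
    show "loss_estimate G n D ord \<sigma> p y m a = (\<Sum>j=1..L. g j (anc G j a))"
      unfolding mM loss_estimate_sum[OF p MD] by (intro sum.cong refl) (auto simp: g_def r_def d_def)
  next
    fix j v assume j: "j \<in> {1..L}"
    have "0 \<le> r j v" unfolding r_def using mass_nonneg[OF p_simplex[OF p], of v] by auto
    then have "0 \<le> g j v" unfolding g_def using d\<xi>(1)[of j] by (cases "j \<in> M") (auto simp del: times_divide_eq_left)
    moreover have "\<mu> j \<le> w j / (2 * c)"
    proof (cases "j \<in> M")
      case True
      have "2 * \<sigma> j / \<xi> j = (4 * c * \<sigma> j / \<xi> j) / (2 * c)" using c by simp
      also have "\<dots> \<le> w j / (2 * c)" using c by (intro divide_right_mono w\<sigma>[OF j]) auto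
      finally show ?thesis using d\<xi>[OF True] True by (simp add: \<mu>_def)
    qed (use w j c in \<open>auto simp: \<mu>_def less_imp_le\<close>)
    ultimately show "- w j / (2 * c) \<le> g j v - \<mu> j" by simp
  qed
  moreover have "(\<Sum>j=1..L. \<Sum>v\<in>level G j. 2 * c / (c - 1) / w j * (g j v - \<mu> j)\<^sup>2 * (mass G p v * sqrt (mass G p v)))
    \<le> stab_bound p c \<sigma> w m"
    unfolding stab_bound_def[OF p]
  proof (intro sum_mono)
    fix j assume j: "j \<in> {1..L}"
    show "(\<Sum>v\<in>level G j. 2 * c / (c - 1) / w j * (g j v - \<mu> j)\<^sup>2 * (mass G p v * sqrt (mass G p v)))
      \<le> (if j \<in> fst m then 1 else 0) * (8 * c / (c - 1) / w j * (\<sigma> j / \<xi> j)\<^sup>2 *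
     (\<Sum>v\<in>level G j. ((if v = anc G j (snd m 1) then 1 / mass G p v else 0) - 1)\<^sup>2 * (mass G p v * sqrt (mass G p v))))"
    proof (cases "j \<in> M")
      case True
      have k: "0 \<le> 2 * c / (c - 1) / w j" using c w j by (auto intro!: divide_nonneg_nonneg less_imp_le)
      have "(\<Sum>v\<in>level G j. 2 * c / (c - 1) / w j * (g j v - \<mu> j)\<^sup>2 * (mass G p v * sqrt (mass G p v)))
        \<le> (\<Sum>v\<in>level G j. 2 * c / (c - 1) / w j * ((2 * \<sigma> j / \<xi> j)\<^sup>2 * (r j v - 1)\<^sup>2) * (mass G p v * sqrt (mass G p v)))"
      proof (intro sum_mono mult_right_mono mult_left_mono k)
        fix v
        have "(d j / \<xi> j)\<^sup>2 \<le> (2 * \<sigma> j / \<xi> j)\<^sup>2" using d\<xi>[OF True] by (intro power_mono)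
        then have "(d j / \<xi> j)\<^sup>2 * (r j v - 1)\<^sup>2 \<le> (2 * \<sigma> j / \<xi> j)\<^sup>2 * (r j v - 1)\<^sup>2" by (intro mult_right_mono) auto
        moreover have "g j v - \<mu> j = d j / \<xi> j * (r j v - 1)" using True by (simp add: g_def \<mu>_def right_diff_distrib)
        ultimately show "(g j v - \<mu> j)\<^sup>2 \<le> (2 * \<sigma> j / \<xi> j)\<^sup>2 * (r j v - 1)\<^sup>2"
          by (simp only: power_mult_distrib)
      qed (use mass_nonneg[OF p_simplex[OF p]] in auto)
      also have "\<dots> = 8 * c / (c - 1) / w j * (\<sigma> j / \<xi> j)\<^sup>2 * (\<Sum>v\<in>level G j. (r j v - 1)\<^sup>2 * (mass G p v * sqrt (mass G p v)))"
      proof -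
        have "2 * c / (c - 1) / w j * ((2 * \<sigma> j / \<xi> j)\<^sup>2 * x) * u = 8 * c / (c - 1) / w j * (\<sigma> j / \<xi> j)\<^sup>2 * (x * u)" for x u
          by (simp add: power_divide)
        then show ?thesis by (simp only: sum_distrib_left)
      qed
      finally show ?thesis using True by (simp add: mM r_def)
    qed (simp add: mM g_def \<mu>_def)
  qed
  ultimately show ?thesis by linarith
qed

end

section \<open>The algorithm is a learner\<close>

locale tree_ftrl = tree_sampling G L n D ord
  for G :: "'v rtree" and L n :: nat and D :: "nat set pmf" and ord :: "nat set \<Rightarrow> nat \<Rightarrow> nat" +
  fixes \<sigma> :: "nat \<Rightarrow> real" and c :: real
  assumes scale_mono: "\<forall>i j. 1 \<le> i \<and> i \<le> j \<and> j \<le> L \<longrightarrow> \<sigma> j \<le> \<sigma> i"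
    and scale_pos: "0 < \<sigma> L" and scale_top: "\<sigma> (L + 1) = 0" and c: "2 \<le> c"
begin

lemma \<sigma>_pos: "j \<in> {1..L} \<Longrightarrow> 0 < \<sigma> j"
  using scale_mono scale_pos by (meson atLeastAtMost_iff less_le_trans order_refl)

definition gam :: "nat \<Rightarrow> real" where
  "gam j = 4 * sqrt c / sqrt (c - 1) * (\<sigma> j / sqrt (\<xi> j))"

definition thr :: "nat \<Rightarrow> real" where
  "thr j = sqrt (c * (c - 1) / \<xi> j)"

definition wt :: "nat \<Rightarrow> nat \<Rightarrow> real" where
  "wt t j = gam j * max (sqrt (real (Suc t))) (thr j)"

abbreviation psi :: "nat \<Rightarrow> ('v \<Rightarrow> real) \<Rightarrow> real" where
  "psi \<equiv> regularizer G L \<sigma> D c"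

definition dist :: "nat \<Rightarrow> ('v \<Rightarrow> real) \<Rightarrow> 'v \<Rightarrow> real" where
  "dist t Z = ftrl_dist G psi (t + 1) Z"

lemma regularizer_tsallis: "psi (t + 1) = tsallis (wt t)"
proof
  fix x
  have "max (sqrt (real (t + 1))) (sqrt (c * (c - 1) / \<xi> j)) = max (sqrt (real (Suc t))) (thr j)" for j
    unfolding thr_def by (simp add: add.commute)
  then show "psi (t + 1) x = tsallis (wt t) x"
    unfolding regularizer_def tsallis_def wt_def gam_def sum_distrib_left by (simp only: mult.assoc)
qed

lemma gam_pos: "j \<in> {1..L} \<Longrightarrow> 0 < gam j"
  unfolding gam_def using \<sigma>_pos[of j] xi_pos[of j] c by simp

lemma wt_pos: "j \<in> {1..L} \<Longrightarrow> 0 < wt t j"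
  unfolding wt_def using gam_pos[of j] by (intro mult_pos_pos) (auto simp: less_max_iff_disj)

text \<open>The origin of prefactor and threshold in the regularizer: the roots of
  \<open>c - 1\<close> cancel, and the product is exactly the weight that
  \<open>ftrl_round_step\<close> demands.\<close>

lemma gam_thr: "j \<in> {1..L} \<Longrightarrow> gam j * thr j = 4 * c * \<sigma> j / \<xi> j"
proof -
  assume "j \<in> {1..L}"
  then have xi: "0 < \<xi> j" by (rule xi_pos)
  define s u x where "s = sqrt c" and "u = sqrt (c - 1)" and "x = sqrt (\<xi> j)"
  have s: "0 < s" "c = s * s" and u: "0 < u" and x: "0 < x" "\<xi> j = x * x"
    using c xi by (auto simp: s_def u_def x_def)
  have "gam j * thr j = 4 * s / u * (\<sigma> j / x) * (s * u / x)"
    unfolding gam_def thr_def s_def u_def x_def by (simp add: real_sqrt_divide real_sqrt_mult)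
  also have "\<dots> = 4 * c * \<sigma> j / \<xi> j" unfolding s(2) x(2) using s u x by simp
  finally show ?thesis .
qed

lemma thr_nonneg: "j \<in> {1..L} \<Longrightarrow> 0 \<le> thr j"
  unfolding thr_def using xi_pos[of j] c by simp

lemma wt_lower: "j \<in> {1..L} \<Longrightarrow> 4 * c * \<sigma> j / \<xi> j \<le> wt t j"
  unfolding gam_thr[symmetric] wt_def using gam_pos[of j] by (intro mult_left_mono) auto

text \<open>The play is defined by a choice operator; existence of a minimizer ensures that the
  chosen point is one.\<close>

lemma dist_min: "is_min (wt t) Z (dist t Z)"
proof -
  have obj: "(\<lambda>p. (\<Sum>a \<in> leaves G. Z a * p a) + psi (t + 1) p) = obj (wt t) Z"
    unfolding regularizer_tsallis obj_def ..
  have "is_min (wt t) Z x \<longleftrightarrow> is_arg_min (obj (wt t) Z) (\<lambda>x. x \<in> prob_simplex G) x" for x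
    unfolding is_min_def is_arg_min_linorder by blast
  then show ?thesis
    unfolding dist_def ftrl_dist_def obj arg_min_on_def arg_min_def
    using someI_ex[OF is_min_exists[of "wt t" Z]] by simp
qed

lemma dist_simplex: "dist t Z \<in> prob_simplex G"
  using dist_min[of t Z] unfolding is_min_def by simp

lemma dist_pos: "pos_dist (dist t Z)"
  unfolding pos_dist_def using dist_simplex is_min_positive[OF dist_min] wt_pos by blast

text \<open>The minimizer is continuous in \<open>Z\<close>; approximating \<open>Z\<close> by functions with countably many
  values therefore gives measurability.\<close>

lemma dist_measurable:
  assumes f: "\<And>a. a \<in> leaves G \<Longrightarrow> (\<lambda>x. f x a) \<in> borel_measurable M"
  shows "(\<lambda>x. dist t (f x) b) \<in> borel_measurable M"
proof (cases "b \<in> leaves G")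
  case False
  then have "dist t (f x) b = 0" for x using simplexD(2)[OF dist_simplex] by blast
  then show ?thesis by simp
next
  case b: True
  \<comment> \<open>The losses are rounded down to a grid of mesh 1 / (k + 1) and recorded as
    integer vectors. These form a countable discrete space, on which the map to the minimizer is
    trivially measurable; \<open>is_min_stable\<close> controls the rounding error.\<close>
  define F where "F k x = (\<lambda>a\<in>leaves G. \<lfloor>real (Suc k) * f x a\<rfloor>)" for k x
  define A where "A k g = (\<lambda>a. real_of_int (g a) / real (Suc k))" for k and g :: "'v \<Rightarrow> int"
  have "F k \<in> M \<rightarrow>\<^sub>M PiM (leaves G) (\<lambda>_. count_space UNIV)" for k
    unfolding F_def
    by (intro measurable_restrict measurable_compose[OF _ measurable_real_floor] borel_measurable_times borel_measurable_const f)
  then have F: "F k \<in> M \<rightarrow>\<^sub>M count_space (leaves G \<rightarrow>\<^sub>E UNIV)" for k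
    by (subst (asm) count_space_PiM_finite) auto
  show ?thesis
  proof (rule borel_measurable_LIMSEQ_real)
    show "(\<lambda>x. dist t (A k (F k x)) b) \<in> borel_measurable M" for k
      by (rule measurable_compose[OF F, of "\<lambda>g. dist t (A k g) b"]) simp
    fix x assume "x \<in> space M"
    have wL: "0 < wt t L" using wt_pos L_pos by simp
    have bound: "(dist t (A k (F k x)) b - dist t (f x) b)\<^sup>2 \<le> 4 * real (card (leaves G)) / wt t L * inverse (real (Suc k))" for k
    proof -
      have "wt t L / 4 * (dist t (A k (F k x)) b - dist t (f x) b)\<^sup>2 \<le> (\<Sum>a\<in>leaves G. \<bar>A k (F k x) a - f x a\<bar>)"
        using is_min_stable[OF dist_min dist_min _ b] wt_pos by blast
      also have "\<dots> \<le> (\<Sum>a\<in>leaves G. inverse (real (Suc k)))"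
      proof (rule sum_mono)
        fix a assume a: "a \<in> leaves G"
        let ?K = "real (Suc k)"
        have "\<bar>?K * f x a - real_of_int \<lfloor>?K * f x a\<rfloor>\<bar> \<le> 1" by linarith
        then have "\<bar>real_of_int \<lfloor>?K * f x a\<rfloor> - ?K * f x a\<bar> / ?K \<le> 1 / ?K"
          by (intro divide_right_mono) auto
        moreover have "A k (F k x) a - f x a = (real_of_int \<lfloor>?K * f x a\<rfloor> - ?K * f x a) / ?K"
          using a unfolding A_def F_def by (simp add: diff_divide_distrib)
        ultimately show "\<bar>A k (F k x) a - f x a\<bar> \<le> inverse ?K"
          by (simp add: abs_divide inverse_eq_divide)
      qed
      also have "\<dots> = real (card (leaves G)) * inverse (real (Suc k))" by simp
      finally have "wt t L / 4 * (dist t (A k (F k x)) b - dist t (f x) b)\<^sup>2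
        \<le> real (card (leaves G)) * inverse (real (Suc k))" .
      moreover have "X \<le> 4 * K / wt t L * I" if "wt t L / 4 * X \<le> K * I" for X K I
        using that wL by (simp add: field_simps)
      ultimately show ?thesis by blast
    qed
    have "(\<lambda>k. (dist t (A k (F k x)) b - dist t (f x) b)\<^sup>2) \<longlonglongrightarrow> 0"
    proof (rule tendsto_sandwich[where f="\<lambda>_. 0"])
      show "(\<lambda>k. 4 * real (card (leaves G)) / wt t L * inverse (real (Suc k))) \<longlonglongrightarrow> 0"
        by (rule tendsto_mult_right_zero[OF LIMSEQ_inverse_real_of_nat])
      show "(\<lambda>k. 0) \<longlonglongrightarrow> (0::real)" by simp
    qed (use bound in auto)
    then have "(\<lambda>k. dist t (A k (F k x)) b - dist t (f x) b) \<longlonglongrightarrow> 0"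
      using tendsto_real_sqrt[of "\<lambda>k. (dist t (A k (F k x)) b - dist t (f x) b)\<^sup>2" 0 sequentially]
      by (simp add: tendsto_rabs_zero_iff)
    then show "(\<lambda>k. dist t (A k (F k x)) b) \<longlonglongrightarrow> dist t (f x) b" by (rule LIM_zero_cancel)
  qed
qed

abbreviation cum :: "'v view \<Rightarrow> nat \<Rightarrow> 'v \<Rightarrow> real" where
  "cum \<equiv> cum_estimate G n psi \<sigma> D ord"

abbreviation alg :: "'v learner" where
  "alg \<equiv> ftrl G n psi \<sigma> D ord"

lemma alg_round: "alg t v = ftrl_round G n D ord (dist t (cum v t))"
  unfolding ftrl_def dist_def ..

lemma cum_Suc: "cum v (Suc t) = (\<lambda>a. cum v t a
    + loss_estimate G n D ord \<sigma> (dist t (cum v t)) (fst (v t)) (snd (v t)) a)"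
  by (simp add: Let_def dist_def)

lemma cum_cong:
  assumes "\<And>s. s < t \<Longrightarrow> v s = v' s" shows "cum v t = cum v' t"
  using assms by (induction t) (simp_all add: Let_def)

lemma countable_moves: "countable (moves G n)"
  unfolding moves_def by (intro countable_SIGMA countable_Collect_finite countable_finite finite_PiE) auto

text \<open>The index sets on the right do not depend on \<open>p\<close>: tuples outside the
  conditioning classes stay in the sum with factor 0. Measurability in \<open>p\<close> can then be
  read off.\<close>

lemma pmf_round_formula:
  assumes p: "pos_dist p"
  shows "pmf (ftrl_round G n D ord p) m = (\<Sum>a\<in>leaves G. p a * (\<Sum>M\<in>set_pmf D. pmf D M *
    (\<Sum>B\<in>PiE_dflt {2..n+1} undefined (\<lambda>_. leaves G). (\<Prod>i\<in>{2..n+1}.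
       if anc G (ord M i - 1) (B i) = anc G (ord M i - 1) a then p (B i) / mass G p (anc G (ord M i - 1) a) else 0)
       * indicator {m} (M, B(1 := a)))))"
proof -
  have "pmf (ftrl_round G n D ord p) m = measure_pmf.expectation (ftrl_round G n D ord p) (indicator {m})"
    by (simp add: measure_pmf_single)
  also have "\<dots> = (\<Sum>a\<in>leaves G. p a * (\<Sum>M\<in>set_pmf D. pmf D M *
    (\<Sum>B\<in>PiE_dflt {2..n+1} undefined (\<lambda>_. leaves G). (\<Prod>i\<in>{2..n+1}.
       if anc G (ord M i - 1) (B i) = anc G (ord M i - 1) a then p (B i) / mass G p (anc G (ord M i - 1) a) else 0)
       * indicator {m} (M, B(1 := a)))))"
    unfolding expectation_round[OF p]
  proof (intro sum.cong refl arg_cong2[of _ _ _ _ "(*)"])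
    fix a M assume a: "a \<in> leaves G" and M: "M \<in> set_pmf D"
    let ?R = "PiE_dflt {2..n+1} undefined (\<lambda>_. leaves G)"
    let ?q = "Pi_pmf {2..n+1} undefined (\<lambda>i. cond_class p (ord M i - 1) a)"
    have fin: "finite ?R" by (intro finite_PiE_dflt) auto
    have cc: "pmf (cond_class p k a) b = (if anc G k b = anc G k a then p b / mass G p (anc G k a) else 0)"
      if "b \<in> leaves G" "k \<le> L" for b k
    proof -
      have "measure_pmf.prob (embed_pmf p) {b \<in> leaves G. anc G k b = anc G k a} = mass G p (anc G k a)"
        by (simp add: measure_measure_pmf_finite pmf_embed_simplex[OF p_simplex[OF p]] mass_anc[OF a that(2)])
      then show ?thesis
        using that by (simp add: pmf_cond[OF class_meets[OF p a]] pmf_embed_simplex[OF p_simplex[OF p]])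
    qed
    have "measure_pmf.expectation ?q (\<lambda>A. indicator {m} (M, A(1 := a)) :: real)
      = (\<Sum>B\<in>?R. pmf ?q B *\<^sub>R indicator {m} (M, B(1 := a)))"
      by (rule integral_measure_pmf[OF fin]) (auto simp: set_others[OF p a] PiE_dflt_def)
    also have "\<dots> = (\<Sum>B\<in>?R. (\<Prod>i\<in>{2..n+1}.
       if anc G (ord M i - 1) (B i) = anc G (ord M i - 1) a then p (B i) / mass G p (anc G (ord M i - 1) a) else 0)
       * indicator {m} (M, B(1 := a)))"
    proof (intro sum.cong refl)
      fix B assume B: "B \<in> ?R"
      have "pmf ?q B = (\<Prod>i\<in>{2..n+1}. pmf (cond_class p (ord M i - 1) a) (B i))"
        using B by (intro pmf_Pi') (auto simp: PiE_dflt_def)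
      also have "\<dots> = (\<Prod>i\<in>{2..n+1}. if anc G (ord M i - 1) (B i) = anc G (ord M i - 1) a
          then p (B i) / mass G p (anc G (ord M i - 1) a) else 0)"
      proof (intro prod.cong refl cc)
        fix i assume i: "i \<in> {2..n+1}"
        then show "B i \<in> leaves G" using B unfolding PiE_dflt_def by blast
        have "ord M i \<in> M" using ord_bij[OF M] i unfolding bij_betw_def by auto
        then show "ord M i - 1 \<le> L" using D_subset[OF M] by fastforce
      qed
      finally show "pmf ?q B *\<^sub>R indicator {m} (M, B(1 := a)) = (\<Prod>i\<in>{2..n+1}.
         if anc G (ord M i - 1) (B i) = anc G (ord M i - 1) a then p (B i) / mass G p (anc G (ord M i - 1) a) else 0)
         * indicator {m} (M, B(1 := a))" by simp
    qed
    finally show "measure_pmf.expectation ?q (\<lambda>A. indicator {m} (M, A(1 := a))) = (\<Sum>B\<in>?R. (\<Prod>i\<in>{2..n+1}.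
       if anc G (ord M i - 1) (B i) = anc G (ord M i - 1) a then p (B i) / mass G p (anc G (ord M i - 1) a) else 0)
       * indicator {m} (M, B(1 := a)))" .
  qed
  finally show ?thesis .
qed

lemma mass_measurable:
  "(\<And>a. a \<in> leaves G \<Longrightarrow> (\<lambda>x. f x a) \<in> borel_measurable M) \<Longrightarrow> (\<lambda>x. mass G (f x) v) \<in> borel_measurable M"
  unfolding mass_def by (intro borel_measurable_sum) (auto simp: leaves_below_def)

text \<open>There are countably many moves, so the move can be fixed. For a move outside the support
  a sample point need not be a leaf, which is why coordinates off the leaves must be controlled
  too.\<close>

lemma loss_estimate_measurable:
  assumes p: "\<And>a. (\<lambda>x. p x a) \<in> borel_measurable M"
    and y: "\<And>a. a \<in> leaves G \<Longrightarrow> (\<lambda>x. y x a) \<in> borel_measurable M"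
    and y_off: "\<And>a x. a \<notin> leaves G \<Longrightarrow> x \<in> space M \<Longrightarrow> y x a = undefined"
    and m: "m \<in> M \<rightarrow>\<^sub>M count_space (moves G n)"
  shows "(\<lambda>x. loss_estimate G n D ord \<sigma> (p x) (y x) (m x) a) \<in> borel_measurable M"
proof (rule measurable_compose_countable'[OF _ m countable_moves])
  fix k assume "k \<in> moves G n"
  have y': "(\<lambda>x. y x b) \<in> borel_measurable M" for b
  proof (cases "b \<in> leaves G")
    case False
    then show ?thesis using y_off by (subst measurable_cong[where g="\<lambda>_. undefined"]) auto
  qed (rule y)
  show "(\<lambda>x. loss_estimate G n D ord \<sigma> (p x) (y x) k a) \<in> borel_measurable M"
    unfolding loss_estimate_def case_prod_beta
    by (intro borel_measurable_sum borel_measurable_times borel_measurable_const borel_measurable_divide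
        borel_measurable_add borel_measurable_diff y' mass_measurable p)
qed

lemma cum_measurable:
  assumes "s \<le> t" shows "(\<lambda>v. cum v s a) \<in> borel_measurable (view_space G n t)"
  using assms
proof (induction s arbitrary: a)
  case 0
  then show ?case by simp
next
  case (Suc s)
  have vs: "(\<lambda>v. v s) \<in> view_space G n t \<rightarrow>\<^sub>M (PiM (leaves G) (\<lambda>_. borel) \<Otimes>\<^sub>M count_space (moves G n))"
    unfolding view_space_def using Suc.prems by (intro measurable_component_singleton) auto
  have y: "(\<lambda>v. fst (v s)) \<in> view_space G n t \<rightarrow>\<^sub>M PiM (leaves G) (\<lambda>_. borel)"
    and m: "(\<lambda>v. snd (v s)) \<in> view_space G n t \<rightarrow>\<^sub>M count_space (moves G n)"
    using measurable_compose[OF vs measurable_fst] measurable_compose[OF vs measurable_snd] .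
  show ?case unfolding cum_Suc
  proof (intro borel_measurable_add loss_estimate_measurable dist_measurable m)
    show "(\<lambda>v. cum v s b) \<in> borel_measurable (view_space G n t)" for b using Suc by simp
    then show "(\<lambda>v. cum v s b) \<in> borel_measurable (view_space G n t)" for b .
    show "(\<lambda>v. fst (v s) b) \<in> borel_measurable (view_space G n t)" if "b \<in> leaves G" for b
      by (rule measurable_compose[OF y measurable_component_singleton[OF that]])
    show "fst (v s) b = undefined" if "b \<notin> leaves G" "v \<in> space (view_space G n t)" for b v
      using measurable_space[OF y that(2)] that(1) by (auto simp: space_PiM PiE_def extensional_def)
  qed
qed

lemma alg_learner: "is_learner G n alg"
  unfolding is_learner_def
proof (intro allI conjI ballI)
  show "set_pmf (alg t v) \<subseteq> moves G n" for t v
    unfolding alg_round using set_round_moves[OF dist_pos] .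
  have dm: "(\<lambda>v. dist t (cum v t) b) \<in> borel_measurable (view_space G n t)" for t b
    by (intro dist_measurable cum_measurable) auto
  show "(\<lambda>v. pmf (alg t v) m) \<in> borel_measurable (view_space G n t)" for t m
    unfolding alg_round pmf_round_formula[OF dist_pos]
    by (intro borel_measurable_sum borel_measurable_times borel_measurable_const borel_measurable_prod
        measurable_If borel_measurable_divide mass_measurable dm) simp_all
qed

end

section \<open>The law of the game\<close>

locale tree_game = tree_ftrl G L n D ord \<sigma> c
  for G :: "'v rtree" and L n :: nat and D :: "nat set pmf" and ord :: "nat set \<Rightarrow> nat \<Rightarrow> nat"
    and \<sigma> :: "nat \<Rightarrow> real" and c :: real +
  fixes N :: "('e, 'v) environment"
  assumes env: "tree_environment G L \<sigma> n N"
begin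

abbreviation H :: "nat \<Rightarrow> (nat \<Rightarrow> 'e \<times> 'v move) measure" where "H \<equiv> hist_space G n N"
abbreviation S :: "'e measure" where "S \<equiv> signals N"
abbreviation law :: "nat \<Rightarrow> (nat \<Rightarrow> 'e \<times> 'v move) measure" where "law \<equiv> game_law G n N alg"

lemma loss_measurable: "a \<in> leaves G \<Longrightarrow> (\<lambda>e. loss N e a) \<in> borel_measurable S"
  using env unfolding tree_environment_def by blast

lemma draw_measurable: "draw N t \<in> H t \<rightarrow>\<^sub>M prob_algebra S"
  using env unfolding tree_environment_def by blast

text \<open>A common ancestor at depth \<open>j - 1\<close> gives
  \<open>j \<le> sep G L a b\<close>, and the scales decrease. The index \<open>L + 1\<close> is
  outside the range of monotonicity and is settled by its scale 0.\<close>

lemma loss_tree: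
  assumes e: "e \<in> space S" shows "tree_loss \<sigma> (loss N e)"
  unfolding tree_loss_def
proof (intro ballI impI)
  fix j a b assume j: "j \<in> {1..L}" and ab: "a \<in> leaves G" "b \<in> leaves G" and anc: "anc G (j - 1) a = anc G (j - 1) b"
  have "j - 1 \<le> L" using j by auto
  note sb = sep_bounds[OF ab this anc]
  have "\<bar>loss N e a - loss N e b\<bar> \<le> \<sigma> (sep G L a b)"
    using env e ab unfolding tree_environment_def by blast
  also have "\<dots> \<le> \<sigma> j"
  proof (cases "sep G L a b = L + 1")
    case True
    then show ?thesis using scale_top \<sigma>_pos[OF j] by simp
  next
    case False
    then have "1 \<le> j \<and> j \<le> sep G L a b \<and> sep G L a b \<le> L" using sb j by auto
    then show ?thesis using scale_mono by blast
  qed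
  finally show "\<bar>loss N e a - loss N e b\<bar> \<le> \<sigma> j" .
qed

lemma hist_component: "s < t \<Longrightarrow> (\<lambda>h. h s) \<in> H t \<rightarrow>\<^sub>M round_space G n N"
  unfolding hist_space_def by (intro measurable_component_singleton) auto

lemma hist_signal: "s < t \<Longrightarrow> (\<lambda>h. fst (h s)) \<in> H t \<rightarrow>\<^sub>M S"
  by (rule measurable_compose[OF hist_component]) (auto simp: round_space_def)

lemma hist_move: "s < t \<Longrightarrow> (\<lambda>h. snd (h s)) \<in> H t \<rightarrow>\<^sub>M count_space (moves G n)"
  by (rule measurable_compose[OF hist_component]) (auto simp: round_space_def)

lemma observe_measurable: "observe G n N t \<in> H t \<rightarrow>\<^sub>M view_space G n t"
  unfolding view_space_def observe_def[abs_def] case_prod_beta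
proof (intro measurable_restrict measurable_Pair)
  fix s assume s: "s \<in> {0..<t}"
  then have s': "s < t" by simp
  note m = hist_move[OF s']
  show "(\<lambda>h. if a \<in> snd (snd (h s)) ` {1..n+1} then loss N (fst (h s)) a else 0) \<in> borel_measurable (H t)"
    if a: "a \<in> leaves G" for a
    by (rule measurable_compose_countable'[where f="\<lambda>m h. if a \<in> snd m ` {1..n+1} then loss N (fst (h s)) a else 0", OF _ m countable_moves])
      (use measurable_compose[OF hist_signal[OF s'] loss_measurable[OF a]] in simp)
  show "(\<lambda>h. (fst (snd (h s)), snd (snd (h s)))) \<in> H t \<rightarrow>\<^sub>M count_space (moves G n)"
    using m by simp
qed

text \<open>The support lies in the countable set of moves, so the restriction is a probability
  measure, and the measure of a set of moves is an integral of point probabilities, each measurable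
  in the history.\<close>

lemma restricted_pmf_measurable:
  "(\<lambda>h. restrict_space (measure_pmf (alg t (observe G n N t h))) (moves G n)) \<in> H t \<rightarrow>\<^sub>M prob_algebra (count_space (moves G n))"
proof (intro measurable_prob_algebraI measurable_subprob_algebra)
  fix h assume "h \<in> space (H t)"
  then have v: "observe G n N t h \<in> space (view_space G n t)" by (rule measurable_space[OF observe_measurable])
  let ?p = "alg t (observe G n N t h)"
  have sub: "set_pmf ?p \<subseteq> moves G n" using alg_learner v unfolding is_learner_def by blast
  have "emeasure (measure_pmf ?p) (moves G n) = 1"
    using measure_pmf.emeasure_eq_1_AE[of "moves G n" ?p] sub by (auto simp: AE_measure_pmf_iff)
  then show ps: "prob_space (restrict_space (measure_pmf ?p) (moves G n))"
    by (intro prob_space_restrict_space) auto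
  show "subprob_space (restrict_space (measure_pmf ?p) (moves G n))"
    by (rule prob_space_imp_subprob_space[OF ps])
  show "sets (restrict_space (measure_pmf ?p) (moves G n)) = sets (count_space (moves G n))"
    by (auto simp: sets_restrict_space)
next
  fix X assume X: "X \<in> sets (count_space (moves G n))"
  then have X': "X \<subseteq> moves G n" by simp
  then have cX: "countable X" using countable_moves countable_subset by blast
  interpret sigma_finite_measure "count_space X" using cX by (rule sigma_finite_measure_count_space_countable)
  have pm: "(\<lambda>h. pmf (alg t (observe G n N t h)) m) \<in> borel_measurable (H t)" if "m \<in> moves G n" for m
    using measurable_compose[OF observe_measurable] alg_learner that unfolding is_learner_def by blast
  have "(\<lambda>h. \<integral>\<^sup>+ m. ennreal (pmf (alg t (observe G n N t h)) m) \<partial>count_space X) \<in> borel_measurable (H t)"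
  proof (rule borel_measurable_nn_integral)
    show "(\<lambda>(h, m). ennreal (pmf (alg t (observe G n N t h)) m)) \<in> borel_measurable (H t \<Otimes>\<^sub>M count_space X)"
      unfolding case_prod_beta
    proof (rule measurable_compose_countable'[where g=snd and f="\<lambda>m x. ennreal (pmf (alg t (observe G n N t (fst x))) m)", OF _ _ cX])
      show "(\<lambda>x. ennreal (pmf (alg t (observe G n N t (fst x))) m)) \<in> borel_measurable (H t \<Otimes>\<^sub>M count_space X)"
        if "m \<in> X" for m
        using measurable_compose[OF measurable_fst pm] that X' by (intro measurable_compose[OF _ measurable_ennreal]) blast
    qed simp
  qed
  then show "(\<lambda>h. emeasure (restrict_space (measure_pmf (alg t (observe G n N t h))) (moves G n)) X) \<in> borel_measurable (H t)"
    by (subst emeasure_restrict_space) (use X' in \<open>auto simp: nn_integral_pmf\<close>)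
qed

lemma round_law_measurable: "round_law G n N alg t \<in> H t \<rightarrow>\<^sub>M prob_algebra (round_space G n N)"
  unfolding round_law_def[abs_def] round_space_def
  by (intro measurable_pair_prob draw_measurable restricted_pmf_measurable)

sublocale IT: Ionescu_Tulcea "round_law G n N alg" "\<lambda>_. round_space G n N"
proof (rule Ionescu_Tulcea.intro, goal_cases)
  case (1 i)
  show ?case using measurable_prob_algebraD[OF round_law_measurable] unfolding hist_space_def .
next
  case (2 i x)
  then show ?case using measurable_space[OF round_law_measurable, of x i] unfolding hist_space_def
    by (simp add: space_prob_algebra)
qed

lemma start_space: "(\<lambda>_. undefined) \<in> space (PiM {0..<(0::nat)} (\<lambda>_. round_space G n N))"
  by (auto simp: space_PiM)

lemma prob_space_law: "prob_space (law T)"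
  unfolding game_law_def using IT.prob_space_C[OF start_space] .

lemma sets_law [measurable_cong]: "sets (law T) = sets (H T)"
  unfolding game_law_def hist_space_def using IT.sets_C[OF start_space, of T] by simp

lemma space_law: "space (law T) = space (H T)"
  using sets_law by (rule sets_eq_imp_space_eq)

lemma fun_upd_measurable:
  assumes h: "h \<in> space (H t)"
  shows "(\<lambda>x. h(t := x)) \<in> round_space G n N \<rightarrow>\<^sub>M H (Suc t)"
  unfolding hist_space_def
  by (intro measurable_fun_upd[where J="{0..<t}"]) (use h in \<open>auto simp: hist_space_def\<close>)

lemma space_draw: "h \<in> space (H t) \<Longrightarrow> space (draw N t h) = space S"
  and sets_draw: "h \<in> space (H t) \<Longrightarrow> sets (draw N t h) = sets S"
  and prob_space_draw: "h \<in> space (H t) \<Longrightarrow> prob_space (draw N t h)"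
  using measurable_space[OF draw_measurable, of h t] by (auto simp: space_prob_algebra dest: sets_eq_imp_space_eq)

text \<open>Disintegration along the last round: the kernel, then Fubini for its product measure.
  The law of the move in the inner integral does not depend on the signal \<open>e\<close>; this is
  the conditional independence of losses and actions.\<close>

lemma nn_integral_law_Suc:
  fixes f :: "_ \<Rightarrow> ennreal"
  assumes f: "f \<in> borel_measurable (H (Suc t))"
  shows "(\<integral>\<^sup>+h. f h \<partial>law (Suc t)) = (\<integral>\<^sup>+h. (\<integral>\<^sup>+e. (\<integral>\<^sup>+m. f (h(t := (e, m))) \<partial>measure_pmf (alg t (observe G n N t h))) \<partial>draw N t h) \<partial>law t)"
proof -
  let ?C = "\<lambda>T. Ionescu_Tulcea.C (round_law G n N alg) (\<lambda>_. round_space G n N) 0 T (\<lambda>_. undefined)"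
  have f': "f \<in> borel_measurable (PiM {0..<Suc t} (\<lambda>_. round_space G n N))" using f unfolding hist_space_def .
  have "(\<integral>\<^sup>+h. f h \<partial>law (Suc t)) = (\<integral>\<^sup>+h. (\<integral>\<^sup>+x. f x \<partial>IT.eP t h) \<partial>law t)"
    unfolding game_law_def IT.C.simps add_0
    by (rule nn_integral_bind[OF f']) (simp add: IT.sets_C[OF start_space] cong: measurable_cong_sets)
  also have "\<dots> = (\<integral>\<^sup>+h. (\<integral>\<^sup>+e. (\<integral>\<^sup>+m. f (h(t := (e, m))) \<partial>measure_pmf (alg t (observe G n N t h))) \<partial>draw N t h) \<partial>law t)"
  proof (rule nn_integral_cong)
    fix h assume "h \<in> space (law t)"
    then have h: "h \<in> space (H t)" by (simp add: space_law)
    let ?p = "measure_pmf (alg t (observe G n N t h))"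
    let ?R = "restrict_space ?p (moves G n)"
    have R: "prob_space ?R" "sets ?R = sets (count_space (moves G n))"
      using measurable_space[OF restricted_pmf_measurable h] by (auto simp: space_prob_algebra)
    interpret R: prob_space ?R by fact
    have "sets (draw N t h \<Otimes>\<^sub>M ?R) = sets (round_space G n N)"
      unfolding round_space_def using sets_draw[OF h] R(2) by (rule sets_pair_measure_cong)
    then have fm: "(\<lambda>x. f (h(t := x))) \<in> borel_measurable (draw N t h \<Otimes>\<^sub>M ?R)"
      using measurable_compose[OF fun_upd_measurable[OF h] f] by (simp cong: measurable_cong_sets)
    have sup: "set_pmf (alg t (observe G n N t h)) \<subseteq> moves G n"
      using alg_learner measurable_space[OF observe_measurable h] unfolding is_learner_def by blast
    have "(\<integral>\<^sup>+x. f x \<partial>IT.eP t h) = (\<integral>\<^sup>+x. f (h(t := x)) \<partial>round_law G n N alg t h)"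
      using h f' by (intro IT.nn_integral_eP) (auto simp: hist_space_def)
    also have "\<dots> = (\<integral>\<^sup>+e. (\<integral>\<^sup>+m. f (h(t := (e, m))) \<partial>?R) \<partial>draw N t h)"
      unfolding round_law_def by (rule R.nn_integral_fst[symmetric, OF fm])
    also have "\<dots> = (\<integral>\<^sup>+e. (\<integral>\<^sup>+m. f (h(t := (e, m))) \<partial>?p) \<partial>draw N t h)"
    proof (intro nn_integral_cong)
      fix e
      have "(\<integral>\<^sup>+m. f (h(t := (e, m))) \<partial>?R) = (\<integral>\<^sup>+m. f (h(t := (e, m))) * indicator (moves G n) m \<partial>?p)"
        by (rule nn_integral_restrict_space) simp
      also have "\<dots> = (\<integral>\<^sup>+m. f (h(t := (e, m))) \<partial>?p)"
        using sup by (intro nn_integral_cong_AE) (auto simp: AE_measure_pmf_iff indicator_def)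
      finally show "(\<integral>\<^sup>+m. f (h(t := (e, m))) \<partial>?R) = (\<integral>\<^sup>+m. f (h(t := (e, m))) \<partial>?p)" .
    qed
    finally show "(\<integral>\<^sup>+x. f x \<partial>IT.eP t h) = (\<integral>\<^sup>+e. (\<integral>\<^sup>+m. f (h(t := (e, m))) \<partial>?p) \<partial>draw N t h)" .
  qed
  finally show ?thesis .
qed

text \<open>The conditional expectation given the past \<open>h\<close> and the signal
  \<open>e\<close> of round \<open>t\<close>: the loss vector is frozen and only the learner's move
  is averaged.\<close>

abbreviation cexp :: "nat \<Rightarrow> (nat \<Rightarrow> 'e \<times> 'v move) \<Rightarrow> 'e \<Rightarrow> ((nat \<Rightarrow> 'e \<times> 'v move) \<Rightarrow> real) \<Rightarrow> real" where
  "cexp t h e f \<equiv> measure_pmf.expectation (alg t (observe G n N t h)) (\<lambda>m. f (h(t := (e, m))))"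

lemma alg_integrable: "integrable (measure_pmf (alg t v)) (f :: _ \<Rightarrow> real)"
  unfolding alg_round by (rule round_integrable[OF dist_pos])

text \<open>The bound on the conditional absolute mean gives integrability without a bound on
  \<open>f\<close>. For the sign, the conditional means of negative and positive part are compared
  and integrated, so only nonnegative integrals are disintegrated.\<close>

lemma cond_nonneg_Suc:
  fixes f :: "_ \<Rightarrow> real"
  assumes f: "f \<in> borel_measurable (H (Suc t))"
    and bound: "\<And>h e. h \<in> space (H t) \<Longrightarrow> e \<in> space S \<Longrightarrow> cexp t h e (\<lambda>h. \<bar>f h\<bar>) \<le> B"
    and nonneg: "\<And>h e. h \<in> space (H t) \<Longrightarrow> e \<in> space S \<Longrightarrow> 0 \<le> cexp t h e f"
  shows "integrable (law (Suc t)) f" "0 \<le> (\<integral>h. f h \<partial>law (Suc t))"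
proof -
  have fm: "f \<in> borel_measurable (law (Suc t))" using f by (simp cong: measurable_cong_sets)
  interpret lt: prob_space "law t" by (rule prob_space_law)
  have eq: "(\<integral>\<^sup>+h. ennreal (g h) \<partial>law (Suc t)) = (\<integral>\<^sup>+h. (\<integral>\<^sup>+e. ennreal (cexp t h e g) \<partial>draw N t h) \<partial>law t)"
    if g: "g \<in> borel_measurable (H (Suc t))" "\<And>h. 0 \<le> g h" for g
    by (subst nn_integral_law_Suc)
      (use g alg_integrable in \<open>auto intro!: nn_integral_cong nn_integral_eq_integral\<close>)
  have "(\<integral>\<^sup>+h. ennreal \<bar>f h\<bar> \<partial>law (Suc t)) = (\<integral>\<^sup>+h. (\<integral>\<^sup>+e. ennreal (cexp t h e (\<lambda>h. \<bar>f h\<bar>)) \<partial>draw N t h) \<partial>law t)"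
    using f by (intro eq) auto
  also have "\<dots> \<le> (\<integral>\<^sup>+h. (\<integral>\<^sup>+e. ennreal B \<partial>draw N t h) \<partial>law t)"
    by (intro nn_integral_mono ennreal_leI bound) (auto simp: space_law space_draw)
  also have "\<dots> = (\<integral>\<^sup>+h. ennreal B \<partial>law t)"
    by (intro nn_integral_cong) (simp add: space_law prob_space.emeasure_space_1[OF prob_space_draw])
  also have "\<dots> < \<infinity>" by (simp add: lt.emeasure_space_1)
  finally have abs: "(\<integral>\<^sup>+h. ennreal \<bar>f h\<bar> \<partial>law (Suc t)) < \<infinity>" .
  then show int: "integrable (law (Suc t)) f"
    by (intro integrableI_bounded fm) simp
  have "(\<integral>\<^sup>+h. ennreal (- f h) \<partial>law (Suc t)) = (\<integral>\<^sup>+h. ennreal (max 0 (- f h)) \<partial>law (Suc t))"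
    by (intro nn_integral_cong) (simp add: max_def ennreal_neg)
  also have "\<dots> = (\<integral>\<^sup>+h. (\<integral>\<^sup>+e. ennreal (cexp t h e (\<lambda>h. max 0 (- f h))) \<partial>draw N t h) \<partial>law t)"
    using f by (intro eq) auto
  also have "\<dots> \<le> (\<integral>\<^sup>+h. (\<integral>\<^sup>+e. ennreal (cexp t h e (\<lambda>h. max 0 (f h))) \<partial>draw N t h) \<partial>law t)"
  proof (intro nn_integral_mono ennreal_leI)
    fix h e assume "h \<in> space (law t)" "e \<in> space (draw N t h)"
    then have he: "h \<in> space (H t)" "e \<in> space S" by (auto simp: space_law space_draw)
    have "cexp t h e f = cexp t h e (\<lambda>h. max 0 (f h) - max 0 (- f h))"
      by (intro Bochner_Integration.integral_cong) auto
    also have "\<dots> = cexp t h e (\<lambda>h. max 0 (f h)) - cexp t h e (\<lambda>h. max 0 (- f h))"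
      by (intro Bochner_Integration.integral_diff alg_integrable)
    finally show "cexp t h e (\<lambda>h. max 0 (- f h)) \<le> cexp t h e (\<lambda>h. max 0 (f h))"
      using nonneg[OF he] by simp
  qed
  also have "\<dots> = (\<integral>\<^sup>+h. ennreal (max 0 (f h)) \<partial>law (Suc t))"
    using f by (intro eq[symmetric]) auto
  also have "\<dots> = (\<integral>\<^sup>+h. ennreal (f h) \<partial>law (Suc t))"
    by (intro nn_integral_cong) (simp add: max_def ennreal_neg)
  finally have le: "(\<integral>\<^sup>+h. ennreal (- f h) \<partial>law (Suc t)) \<le> (\<integral>\<^sup>+h. ennreal (f h) \<partial>law (Suc t))" .
  have "(\<integral>\<^sup>+h. ennreal (f h) \<partial>law (Suc t)) \<le> (\<integral>\<^sup>+h. ennreal \<bar>f h\<bar> \<partial>law (Suc t))"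
    by (intro nn_integral_mono ennreal_leI) auto
  then have "(\<integral>\<^sup>+h. ennreal (f h) \<partial>law (Suc t)) < top" using abs by (simp add: less_top le_less_trans)
  then show "0 \<le> (\<integral>h. f h \<partial>law (Suc t))"
    unfolding real_lebesgue_integral_def[OF int] using enn2real_mono[OF le] by simp
qed

lemma law_restrict:
  assumes "t < T"
  shows "law (Suc t) = distr (law T) (H (Suc t)) (\<lambda>h. restrict h {0..<Suc t})"
  using IT.distr_C[OF _ start_space, of "Suc t" T] assms unfolding game_law_def hist_space_def by simp

lemma restrict_measurable: "t < T \<Longrightarrow> (\<lambda>h. restrict h {0..<Suc t}) \<in> law T \<rightarrow>\<^sub>M H (Suc t)"
  unfolding hist_space_def
  by (simp add: sets_law hist_space_def cong: measurable_cong_sets)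

text \<open>Since \<open>f\<close> depends only on the first \<open>t + 1\<close> rounds, it has the
  same law under every horizon beyond \<open>t\<close>, so the one-round result transfers.\<close>

lemma cond_nonneg:
  fixes f :: "_ \<Rightarrow> real"
  assumes t: "t < T" and f: "f \<in> borel_measurable (H (Suc t))"
    and dep: "\<And>h. f (restrict h {0..<Suc t}) = f h"
    and bound: "\<And>h e. h \<in> space (H t) \<Longrightarrow> e \<in> space S \<Longrightarrow> cexp t h e (\<lambda>h. \<bar>f h\<bar>) \<le> B"
    and nonneg: "\<And>h e. h \<in> space (H t) \<Longrightarrow> e \<in> space S \<Longrightarrow> 0 \<le> cexp t h e f"
  shows "integrable (law T) f" "0 \<le> (\<integral>h. f h \<partial>law T)"
proof -
  note r = restrict_measurable[OF t]
  have "integrable (law (Suc t)) f \<longleftrightarrow> integrable (law T) (\<lambda>h. f (restrict h {0..<Suc t}))"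
    unfolding law_restrict[OF t] by (rule integrable_distr_eq[OF r f])
  then show "integrable (law T) f" using cond_nonneg_Suc(1)[OF f bound nonneg] unfolding dep by blast
  have "(\<integral>h. f h \<partial>law (Suc t)) = (\<integral>h. f (restrict h {0..<Suc t}) \<partial>law T)"
    unfolding law_restrict[OF t] by (rule integral_distr[OF r f])
  then show "0 \<le> (\<integral>h. f h \<partial>law T)" using cond_nonneg_Suc(2)[OF f bound nonneg] unfolding dep by simp
qed

text \<open>The negated indicator of an impossible move has conditional mean 0, so
  \<open>cond_nonneg\<close> makes the integral of a nonpositive function nonnegative, and the
  function vanishes almost everywhere.\<close>

lemma AE_support:
  assumes t: "t < T"
  shows "AE h in law T. snd (h t) \<in> set_pmf (alg t (observe G n N t h))"
proof -
  define f where "f h = (if pmf (alg t (observe G n N t h)) (snd (h t)) = 0 then - 1 else 0 :: real)" for h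
  have obs: "observe G n N t (restrict h {0..<Suc t}) = observe G n N t h" "observe G n N t (h(t := x)) = observe G n N t h" for h x
    unfolding observe_def by (auto intro!: restrict_ext)
  have r: "(\<lambda>h. restrict h {0..<t}) \<in> H (Suc t) \<rightarrow>\<^sub>M H t"
    unfolding hist_space_def by (rule measurable_restrict_subset) auto
  have obs_r: "observe G n N t (restrict h {0..<t}) = observe G n N t h" for h
    unfolding observe_def by (auto intro!: restrict_ext)
  have pm: "(\<lambda>h. pmf (alg t (observe G n N t h)) m) \<in> borel_measurable (H (Suc t))" if "m \<in> moves G n" for m
  proof -
    have "(\<lambda>v. pmf (alg t v) m) \<in> borel_measurable (view_space G n t)"
      using alg_learner that unfolding is_learner_def by blast
    from measurable_compose[OF measurable_compose[OF r observe_measurable] this]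
    show ?thesis unfolding obs_r .
  qed
  have fm: "f \<in> borel_measurable (H (Suc t))"
    unfolding f_def
    by (rule measurable_compose_countable'[where f="\<lambda>m h. if pmf (alg t (observe G n N t h)) m = 0 then - 1 else 0 :: real",
          OF _ hist_move countable_moves]) (use pm in \<open>auto intro!: measurable_If\<close>)
  have zero: "measure_pmf.expectation (alg t (observe G n N t h)) (\<lambda>m. g (f (h(t := (e, m))))) = 0"
    if "g 0 = 0" for g :: "real \<Rightarrow> real" and h e
  proof -
    have "measure_pmf.expectation (alg t (observe G n N t h)) (\<lambda>m. g (f (h(t := (e, m)))))
      = measure_pmf.expectation (alg t (observe G n N t h)) (\<lambda>m. 0)"
      by (intro integral_cong_AE) (auto simp: AE_measure_pmf_iff f_def obs set_pmf_iff that)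
    then show ?thesis by simp
  qed
  have int: "integrable (law T) f" "0 \<le> (\<integral>h. f h \<partial>law T)"
    by (rule cond_nonneg[OF t fm, where B=0]; use zero[of abs] zero[of "\<lambda>x. x"] obs in \<open>simp add: f_def\<close>)+
  have "(\<integral>h. - f h \<partial>law T) \<le> 0" using int by simp
  moreover have "0 \<le> (\<integral>h. - f h \<partial>law T)" by (intro integral_nonneg_AE) (auto simp: f_def)
  ultimately have "(\<integral>h. - f h \<partial>law T) = 0" by simp
  moreover have "integrable (law T) (\<lambda>h. - f h)" "AE h in law T. 0 \<le> - f h"
    using int(1) by simp_all (simp add: f_def)
  ultimately have "AE h in law T. - f h = 0"
    using integral_nonneg_eq_0_iff_AE[of "law T" "\<lambda>h. - f h"] by blast
  then show ?thesis by eventually_elim (auto simp: f_def set_pmf_iff split: if_splits)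
qed

end

section \<open>Bounds on the level sums\<close>

lemma sum_sqrt_mult_le:
  fixes f g :: "'a \<Rightarrow> real"
  assumes "\<And>x. x \<in> A \<Longrightarrow> 0 \<le> f x" "\<And>x. x \<in> A \<Longrightarrow> 0 \<le> g x"
  shows "(\<Sum>x\<in>A. sqrt (f x) * sqrt (g x)) \<le> sqrt ((\<Sum>x\<in>A. f x) * (\<Sum>x\<in>A. g x))"
proof -
  have "(\<Sum>x\<in>A. sqrt (f x) * sqrt (g x)) = (\<Sum>x\<in>A. \<bar>sqrt (f x)\<bar> * \<bar>sqrt (g x)\<bar>)"
    using assms by (intro sum.cong refl) simp
  also have "\<dots> \<le> L2_set (\<lambda>x. sqrt (f x)) A * L2_set (\<lambda>x. sqrt (g x)) A"
    by (rule L2_set_mult_ineq)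
  also have "\<dots> = sqrt ((\<Sum>x\<in>A. f x) * (\<Sum>x\<in>A. g x))"
    using assms unfolding L2_set_def by (simp add: real_sqrt_mult)
  finally show ?thesis .
qed

text \<open>Consecutive roots x, y satisfy 1 / y \<le> 2 (y - x), as (y - x)^2 is
  nonnegative.\<close>

lemma sum_inverse_sqrt_le: "(\<Sum>t<T. 1 / sqrt (real (Suc t))) \<le> 2 * sqrt (real T)"
proof (induction T)
  case (Suc t)
  define x y where "x = sqrt (real t)" and "y = sqrt (real (Suc t))"
  have xy: "0 \<le> x" "x \<le> y" "0 < y" "y * y = x * x + 1" by (auto simp: x_def y_def)
  have "1 \<le> 2 * (y - x) * y"
  proof -
    have "0 \<le> (y - x) * (y - x)" by simp
    then show ?thesis using xy(4) by (simp add: algebra_simps)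
  qed
  then have "1 / y \<le> 2 * (y - x)" using xy(3) by (simp add: divide_le_eq)
  then show ?case using Suc by (simp add: x_def y_def)
qed simp

text \<open>From \<open>ln x \<le> x - 1\<close> at t / (t + 1), each later term is at most an
  increment of the logarithm; the first term 1 is the logarithm of e.\<close>

lemma sum_inverse_le_ln:
  assumes "1 \<le> T" shows "(\<Sum>t<T. 1 / real (Suc t)) \<le> ln (exp 1 * real T)"
proof -
  have "(\<Sum>t<T. 1 / real (Suc t)) \<le> 1 + ln (real T)"
    using assms
  proof (induction T rule: dec_induct)
    case (step t)
    have "1 / real (Suc t) \<le> ln (real (Suc t)) - ln (real t)"
    proof -
      have "ln (real t / real (Suc t)) \<le> real t / real (Suc t) - 1"
        using step(1) by (intro ln_le_minus_one) auto
      also have "\<dots> = - 1 / real (Suc t)" by (simp add: field_simps)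
      finally show ?thesis using step(1) by (simp add: ln_div)
    qed
    then show ?case using step by simp
  qed (simp add: One_nat_def)
  then show ?thesis using assms by (simp add: ln_mult)
qed

context leveled_tree
begin

lemma sqrt_variance_le:
  "p \<in> prob_simplex G \<Longrightarrow> sqrt (mass G p v) * (1 - mass G p v) \<le> sqrt (mass G p v)"
  using mass_nonneg[of p v] mass_le_1[of p v] by (intro mult_left_le) auto

context
  fixes p :: "'v \<Rightarrow> real" and j :: nat
  assumes p: "p \<in> prob_simplex G" and j: "j \<le> L"
begin

lemma sum_sqrt_mass_le: "(\<Sum>v\<in>level G j. sqrt (mass G p v)) \<le> sqrt (real (card (level G j)))"
  using sum_sqrt_mult_le[of "level G j" "mass G p" "\<lambda>_. 1"] mass_nonneg[OF p] sum_level_simplex[OF p j]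
  by simp

lemma level_entropy_le: "level_entropy j p \<le> sqrt (real (card (level G j)))"
proof -
  have "level_entropy j p \<le> (\<Sum>v\<in>level G j. sqrt (mass G p v))"
    unfolding level_entropy_def by (intro sum_mono) (simp add: mass_nonneg[OF p])
  then show ?thesis using sum_sqrt_mass_le by linarith
qed

lemma level_variance_nonneg: "0 \<le> level_variance j p"
  unfolding level_variance_def using mass_nonneg[OF p] mass_le_1[OF p] by (intro sum_nonneg mult_nonneg_nonneg) auto

lemma level_variance_le: "level_variance j p \<le> sqrt (real (card (level G j)))"
proof -
  have "level_variance j p \<le> (\<Sum>v\<in>level G j. sqrt (mass G p v))"
    unfolding level_variance_def by (intro sum_mono sqrt_variance_le[OF p])
  then show ?thesis using sum_sqrt_mass_le by linarith
qed

end

section \<open>Level sums in terms of the gaps\<close>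

definition min_gap :: "('v \<Rightarrow> real) \<Rightarrow> 'v \<Rightarrow> real" where
  "min_gap \<Delta> v = Min (\<Delta> ` leaves_below G v)"

definition gap_nodes :: "nat \<Rightarrow> ('v \<Rightarrow> real) \<Rightarrow> 'v set" where
  "gap_nodes j \<Delta> = {v \<in> level G j. min_gap \<Delta> v \<noteq> 0}"

context
  fixes \<Delta> :: "'v \<Rightarrow> real"
  assumes \<Delta>_nonneg: "\<forall>a\<in>leaves G. 0 \<le> \<Delta> a"
begin

lemma min_gap_attained: "v \<in> level G j \<Longrightarrow> \<exists>a\<in>leaves G. anc G j a = v \<and> min_gap \<Delta> v = \<Delta> a"
proof -
  assume v: "v \<in> level G j"
  have "min_gap \<Delta> v \<in> \<Delta> ` leaves_below G v"
    unfolding min_gap_def using leaves_below_level_nonempty[OF v] by (intro Min_in) auto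
  then show ?thesis using leaves_below_level[OF v] by auto
qed

lemma min_gap_nonneg: "v \<in> level G j \<Longrightarrow> 0 \<le> min_gap \<Delta> v"
  using min_gap_attained \<Delta>_nonneg by metis

lemma min_gap_le: "a \<in> leaves G \<Longrightarrow> j \<le> L \<Longrightarrow> min_gap \<Delta> (anc G j a) \<le> \<Delta> a"
  unfolding min_gap_def using leaves_below_level[OF anc_in_level] by (intro Min_le) auto

lemma gap_complexity_nonneg: "0 \<le> gap_complexity G j \<Delta>"
  unfolding gap_complexity_def using min_gap_nonneg[unfolded min_gap_def] by (intro sum_nonneg) auto

text \<open>Cauchy-Schwarz after inserting the smallest gap below each node and its inverse. The
  inverses sum to the gap complexity, and the weighted masses are at most the expected gap.\<close>

lemma sum_sqrt_gap_nodes: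
  assumes p: "p \<in> prob_simplex G" and j: "j \<le> L"
  shows "(\<Sum>v\<in>gap_nodes j \<Delta>. sqrt (mass G p v)) \<le> sqrt ((\<Sum>a\<in>leaves G. p a * \<Delta> a) * gap_complexity G j \<Delta>)"
proof -
  have pos: "0 < min_gap \<Delta> v" if "v \<in> gap_nodes j \<Delta>" for v
    using that min_gap_nonneg[of v j] unfolding gap_nodes_def by simp
  have "(\<Sum>v\<in>gap_nodes j \<Delta>. sqrt (mass G p v)) = (\<Sum>v\<in>gap_nodes j \<Delta>. sqrt (mass G p v * min_gap \<Delta> v) * sqrt (1 / min_gap \<Delta> v))"
    using pos by (intro sum.cong refl) (auto simp: real_sqrt_mult[symmetric] less_imp_neq[symmetric])
  also have "\<dots> \<le> sqrt ((\<Sum>v\<in>gap_nodes j \<Delta>. mass G p v * min_gap \<Delta> v) * (\<Sum>v\<in>gap_nodes j \<Delta>. 1 / min_gap \<Delta> v))"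
    using pos mass_nonneg[OF p] by (intro sum_sqrt_mult_le) (auto simp: less_imp_le)
  also have "(\<Sum>v\<in>gap_nodes j \<Delta>. 1 / min_gap \<Delta> v) = gap_complexity G j \<Delta>"
    unfolding gap_complexity_def gap_nodes_def min_gap_def ..
  also have "sqrt ((\<Sum>v\<in>gap_nodes j \<Delta>. mass G p v * min_gap \<Delta> v) * gap_complexity G j \<Delta>)
    \<le> sqrt ((\<Sum>a\<in>leaves G. p a * \<Delta> a) * gap_complexity G j \<Delta>)"
  proof (intro real_sqrt_le_mono mult_right_mono gap_complexity_nonneg)
    have "(\<Sum>v\<in>gap_nodes j \<Delta>. mass G p v * min_gap \<Delta> v) \<le> (\<Sum>v\<in>level G j. mass G p v * min_gap \<Delta> v)"
      by (intro sum_mono2) (use mass_nonneg[OF p] min_gap_nonneg in \<open>auto simp: gap_nodes_def\<close>)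
    also have "\<dots> = (\<Sum>a\<in>leaves G. p a * min_gap \<Delta> (anc G j a))" by (rule sum_level_mass[OF j])
    also have "\<dots> \<le> (\<Sum>a\<in>leaves G. p a * \<Delta> a)"
      using min_gap_le[OF _ j] simplex_nonneg[OF p] by (intro sum_mono mult_left_mono) auto
    finally show "(\<Sum>v\<in>gap_nodes j \<Delta>. mass G p v * min_gap \<Delta> v) \<le> (\<Sum>a\<in>leaves G. p a * \<Delta> a)" .
  qed
  finally show ?thesis .
qed

text \<open>By uniqueness at most one node of the level has gap 0; let P be its mass and X the sum
  over the others. Their masses sum to 1 - P, so the entropy is X - (1 - \<open>sqrt\<close> P). In
  the variance that node adds at most 1 - P, again at most X, whence the factor 2.\<close>

lemma level_gap_bounds:
  assumes unique: "card {a \<in> leaves G. \<Delta> a = 0} \<le> 1" and p: "p \<in> prob_simplex G" and j: "j \<le> L"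
  shows "level_entropy j p \<le> (\<Sum>v\<in>gap_nodes j \<Delta>. sqrt (mass G p v))"
    "level_variance j p \<le> 2 * (\<Sum>v\<in>gap_nodes j \<Delta>. sqrt (mass G p v))"
proof -
  let ?X = "\<Sum>v\<in>gap_nodes j \<Delta>. sqrt (mass G p v)"
  have fin: "finite (gap_nodes j \<Delta>)" unfolding gap_nodes_def by simp
  have X0: "0 \<le> ?X" using mass_nonneg[OF p] by (intro sum_nonneg) simp
  have "level_entropy j p \<le> ?X \<and> level_variance j p \<le> 2 * ?X"
  proof (cases "level G j = gap_nodes j \<Delta>")
    case True
    have "level_entropy j p \<le> ?X" unfolding level_entropy_def True by (intro sum_mono) (simp add: mass_nonneg[OF p])
    moreover have "level_variance j p \<le> ?X" unfolding level_variance_def True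
      by (intro sum_mono sqrt_variance_le[OF p])
    ultimately show ?thesis using X0 by simp
  next
    case False
    then obtain v0 where v0: "v0 \<in> level G j" "min_gap \<Delta> v0 = 0" unfolding gap_nodes_def by blast
    have uniq: "v = v0" if v: "v \<in> level G j" "min_gap \<Delta> v = 0" for v
    proof -
      obtain a b where ab: "a \<in> leaves G" "anc G j a = v" "\<Delta> a = 0" "b \<in> leaves G" "anc G j b = v0" "\<Delta> b = 0"
        using min_gap_attained[OF v(1)] min_gap_attained[OF v0(1)] v(2) v0(2) by metis
      have "a = b" using unique ab card_le_Suc0_iff_eq[of "{a \<in> leaves G. \<Delta> a = 0}"] by (auto simp: One_nat_def)
      then show ?thesis using ab by simp
    qed
    have v0n: "v0 \<notin> gap_nodes j \<Delta>" using v0 unfolding gap_nodes_def by simp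
    have lev: "level G j = insert v0 (gap_nodes j \<Delta>)"
    proof (intro subset_antisym subsetI)
      show "v \<in> insert v0 (gap_nodes j \<Delta>)" if "v \<in> level G j" for v
        using uniq[OF that] that unfolding gap_nodes_def by blast
      show "v \<in> level G j" if "v \<in> insert v0 (gap_nodes j \<Delta>)" for v
        using that v0(1) unfolding gap_nodes_def by blast
    qed
    define P where "P = mass G p v0"
    have P: "0 \<le> P" "P \<le> 1" unfolding P_def using mass_nonneg[OF p] mass_le_1[OF p] by auto
    then have sP: "sqrt P \<le> 1" by simp
    have one: "(\<Sum>v\<in>gap_nodes j \<Delta>. mass G p v) = 1 - P"
      using sum_level_simplex[OF p j] unfolding lev P_def using fin v0n by simp
    have "(\<Sum>v\<in>gap_nodes j \<Delta>. mass G p v) \<le> ?X"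
      using mass_nonneg[OF p] mass_le_1[OF p] by (intro sum_mono le_sqrt_self) auto
    then have PX: "1 - P \<le> ?X" unfolding one .
    have "level_entropy j p = (sqrt P - P) + (?X - (1 - P))"
      unfolding level_entropy_def lev P_def[symmetric] using fin v0n one by (simp add: sum_subtractf P_def)
    then have 1: "level_entropy j p \<le> ?X" using sP by simp
    have "level_variance j p = sqrt P * (1 - P) + (\<Sum>v\<in>gap_nodes j \<Delta>. sqrt (mass G p v) * (1 - mass G p v))"
      unfolding level_variance_def lev using fin v0n by (simp add: P_def)
    moreover have "sqrt P * (1 - P) \<le> 1 - P" using P sP by (intro mult_left_le_one_le) auto
    moreover have "(\<Sum>v\<in>gap_nodes j \<Delta>. sqrt (mass G p v) * (1 - mass G p v)) \<le> ?X"
      by (intro sum_mono sqrt_variance_le[OF p])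
    ultimately show ?thesis using 1 PX by simp
  qed
  then show "level_entropy j p \<le> ?X" "level_variance j p \<le> 2 * ?X" by auto
qed

end

end

section \<open>The regret bounds\<close>

context tree_game
begin

section \<open>Quantities of the algorithm as functions of the history\<close>

definition estim :: "nat \<Rightarrow> (nat \<Rightarrow> 'e \<times> 'v move) \<Rightarrow> 'v \<Rightarrow> real" where
  "estim t h = cum (observe G n N t h) t"

definition play :: "nat \<Rightarrow> (nat \<Rightarrow> 'e \<times> 'v move) \<Rightarrow> 'v \<Rightarrow> real" where
  "play t h = dist t (estim t h)"

text \<open>It is formed from the masked losses, as the algorithm sees them, for every history. The
  true losses may be substituted on the support of the sampling law, by
  \<open>incr_support\<close>.\<close>

definition incr :: "nat \<Rightarrow> (nat \<Rightarrow> 'e \<times> 'v move) \<Rightarrow> 'v \<Rightarrow> real" where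
  "incr t h = loss_estimate G n D ord \<sigma> (play t h) (fst (observe G n N (Suc t) h t)) (snd (h t))"

lemma alg_play: "alg t (observe G n N t h) = ftrl_round G n D ord (play t h)"
  unfolding play_def estim_def alg_round ..

lemma play_pos: "pos_dist (play t h)" and play_simplex: "play t h \<in> prob_simplex G"
  and play_min: "is_min (wt t) (estim t h) (play t h)"
  unfolding play_def by (rule dist_pos dist_simplex dist_min)+

lemma estim_later: "t \<le> u \<Longrightarrow> estim t h = cum (observe G n N u h) t"
  unfolding estim_def by (rule cum_cong) (simp add: observe_def)

lemma estim_0: "estim 0 h = (\<lambda>_. 0)"
  unfolding estim_def by simp

lemma estim_Suc: "estim (Suc t) h a = estim t h a + incr t h a"
proof -
  have "snd (observe G n N (Suc t) h t) = snd (h t)" by (simp add: observe_def case_prod_beta)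
  then show ?thesis
    unfolding incr_def play_def estim_later[of t "Suc t", OF le_SucI[OF order_refl]]
    by (subst estim_def) (simp add: cum_Suc del: cum_estimate.simps)
qed

lemma observe_upd: "observe G n N t (h(t := x)) = observe G n N t h"
  and observe_restrict: "observe G n N t (restrict h {0..<t}) = observe G n N t h"
    "observe G n N t (restrict h {0..<Suc t}) = observe G n N t h"
  unfolding observe_def by (auto intro!: restrict_ext)

lemma play_upd: "play t (h(t := x)) = play t h"
  unfolding play_def estim_def observe_upd ..

lemma play_restrict: "play t (restrict h {0..<Suc t}) = play t h"
  unfolding play_def estim_def observe_restrict ..

lemma incr_restrict: "incr t (restrict h {0..<Suc t}) = incr t h"
  unfolding incr_def play_restrict observe_restrict by simp

lemma estim_measurable: "t \<le> u \<Longrightarrow> (\<lambda>h. estim t h a) \<in> borel_measurable (H u)"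
  unfolding estim_later by (rule measurable_compose[OF observe_measurable cum_measurable])

lemma play_measurable: "t \<le> u \<Longrightarrow> (\<lambda>h. play t h a) \<in> borel_measurable (H u)"
  unfolding play_def by (intro dist_measurable estim_measurable)

lemma incr_measurable: "t < u \<Longrightarrow> (\<lambda>h. incr t h a) \<in> borel_measurable (H u)"
proof -
  assume "t < u"
  then have "(\<lambda>h. estim (Suc t) h a - estim t h a) \<in> borel_measurable (H u)"
    by (intro borel_measurable_diff estim_measurable) auto
  then show ?thesis by (simp add: estim_Suc)
qed

lemma incr_support:
  assumes "snd (h t) \<in> set_pmf (ftrl_round G n D ord (play t h))"
  shows "incr t h a = loss_estimate G n D ord \<sigma> (play t h) (loss N (fst (h t))) (snd (h t)) a"
proof -
  obtain e M A where ht: "h t = (e, M, A)" by (cases "h t") auto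
  have m: "(M, A) \<in> set_pmf (ftrl_round G n D ord (play t h))" using assms ht by simp
  have "fst (observe G n N (Suc t) h t) (sample_point n ord (M, A) k) = loss N e (sample_point n ord (M, A) k)" for k
    using sample_point_support(1,2)[OF play_pos m, of k] by (simp add: observe_def ht)
  then show ?thesis unfolding incr_def loss_estimate_def ht by simp
qed

text \<open>The regret of a single round against \<open>a\<close>. Only differences of losses enter,
  so it is bounded although the losses need not be.\<close>

definition excess :: "nat \<Rightarrow> 'v \<Rightarrow> (nat \<Rightarrow> 'e \<times> 'v move) \<Rightarrow> real" where
  "excess t a h = 1 / real (n + 1) * (\<Sum>i=1..n+1. env_loss N h t (action h t i)) - env_loss N h t a"

definition stab_mean :: "nat \<Rightarrow> ('v \<Rightarrow> real) \<Rightarrow> real" where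
  "stab_mean t p = (\<Sum>j=1..L. 8 * c / (c - 1) / wt t j * ((\<sigma> j)\<^sup>2 / \<xi> j) * level_variance j p)"

definition stab :: "nat \<Rightarrow> (nat \<Rightarrow> 'e \<times> 'v move) \<Rightarrow> real" where
  "stab t h = stab_bound (play t h) c \<sigma> (wt t) (snd (h t))"

lemma average_le:
  fixes f :: "nat \<Rightarrow> real"
  assumes "\<And>i. i \<in> {1..n+1} \<Longrightarrow> \<bar>f i\<bar> \<le> B"
  shows "\<bar>1 / real (n + 1) * (\<Sum>i=1..n+1. f i)\<bar> \<le> B"
proof -
  have "\<bar>\<Sum>i=1..n+1. f i\<bar> \<le> (\<Sum>i=1..n+1. B)"
    by (rule order_trans[OF sum_abs]) (intro sum_mono assms)
  then show ?thesis by (simp add: abs_mult field_simps)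
qed

lemma average_diff:
  fixes f :: "nat \<Rightarrow> real"
  shows "1 / real (n + 1) * (\<Sum>i=1..n+1. f i) - x = 1 / real (n + 1) * (\<Sum>i=1..n+1. f i - x)"
  by (simp add: sum_subtractf right_diff_distrib)

lemma hist_space_move:
  assumes "h \<in> space (H T)" "t < T"
  shows "fst (h t) \<in> space S" "i \<in> {1..n+1} \<Longrightarrow> action h t i \<in> leaves G"
  using measurable_space[OF hist_signal[OF assms(2)] assms(1)] measurable_space[OF hist_move[OF assms(2)] assms(1)]
  by (auto simp: moves_def action_def mem_Times_iff)

lemma action_measurable:
  assumes t: "t < u" and f: "\<And>a. a \<in> leaves G \<Longrightarrow> (\<lambda>h. f h a) \<in> borel_measurable (H u)" and i: "i \<in> {1..n+1}"
  shows "(\<lambda>h. f h (action h t i)) \<in> borel_measurable (H u)"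
  unfolding action_def
proof (rule measurable_compose_countable'[where f="\<lambda>m h. f h (snd m i)", OF _ hist_move[OF t] countable_moves])
  fix m :: "'v move" assume "m \<in> moves G n"
  then have "snd m i \<in> leaves G" using i by (auto simp: moves_def)
  then show "(\<lambda>h. f h (snd m i)) \<in> borel_measurable (H u)" by (rule f)
qed

lemma env_loss_measurable: "t < u \<Longrightarrow> a \<in> leaves G \<Longrightarrow> (\<lambda>h. env_loss N h t a) \<in> borel_measurable (H u)"
  unfolding env_loss_def by (rule measurable_compose[OF hist_signal loss_measurable])

lemma excess_measurable:
  assumes t: "t < u" and a: "a \<in> leaves G"
  shows "excess t a \<in> borel_measurable (H u)"
proof -
  have "(\<lambda>h. env_loss N h t (action h t i)) \<in> borel_measurable (H u)" if "i \<in> {1..n+1}" for i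
    by (rule action_measurable[where f="\<lambda>h. env_loss N h t", OF t env_loss_measurable[OF t] that])
  then show ?thesis unfolding excess_def[abs_def] using env_loss_measurable[OF t a]
    by (intro borel_measurable_diff borel_measurable_times borel_measurable_const borel_measurable_sum) auto
qed

lemma excess_bounded:
  assumes "h \<in> space (H T)" "t < T" "a \<in> leaves G"
  shows "\<bar>excess t a h\<bar> \<le> \<sigma> 1"
  unfolding excess_def average_diff
  by (intro average_le) (use hist_space_move[OF assms(1,2)] tree_loss_diff[OF loss_tree] assms in \<open>auto simp: env_loss_def\<close>)

lemma level_sums_measurable:
  assumes "t \<le> u"
  shows "(\<lambda>h. level_entropy j (play t h)) \<in> borel_measurable (H u)" "(\<lambda>h. level_variance j (play t h)) \<in> borel_measurable (H u)"
  unfolding level_entropy_def level_variance_def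
  by (intro borel_measurable_sum borel_measurable_diff borel_measurable_times borel_measurable_const
      measurable_compose[OF _ borel_measurable_sqrt] mass_measurable play_measurable assms)+

lemma stab_mean_measurable: "t \<le> u \<Longrightarrow> (\<lambda>h. stab_mean t (play t h)) \<in> borel_measurable (H u)"
  unfolding stab_mean_def
  by (intro borel_measurable_sum borel_measurable_times borel_measurable_const level_sums_measurable)

lemma stab_measurable: "t < u \<Longrightarrow> stab t \<in> borel_measurable (H u)"
proof -
  assume t: "t < u"
  define F where "F m h = (\<Sum>j=1..L. (if j \<in> fst m then 1 else 0) * (8 * c / (c - 1) / wt t j * (\<sigma> j / \<xi> j)\<^sup>2 *
       (\<Sum>v\<in>level G j. ((if v = anc G j (snd m 1) then 1 / mass G (play t h) v else 0) - 1)\<^sup>2 * (mass G (play t h) v * sqrt (mass G (play t h) v)))))"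
    for m :: "'v move" and h
  have mass [measurable]: "(\<lambda>h. mass G (play t h) v) \<in> borel_measurable (H u)" for v
    using t by (intro mass_measurable play_measurable) simp
  have "(\<lambda>h. F (snd (h t)) h) \<in> borel_measurable (H u)"
    by (rule measurable_compose_countable'[OF _ hist_move[OF t] countable_moves]) (unfold F_def, measurable)
  then show ?thesis unfolding stab_def[abs_def] stab_bound_def[OF play_pos] F_def .
qed

lemma stab_mean_bounds:
  assumes p: "p \<in> prob_simplex G"
  shows "0 \<le> stab_mean t p" "stab_mean t p \<le> (\<Sum>j=1..L. 8 * c / (c - 1) / wt t j * ((\<sigma> j)\<^sup>2 / \<xi> j) * sqrt (real (card (level G j))))"
proof -
  have k: "0 \<le> 8 * c / (c - 1) / wt t j * ((\<sigma> j)\<^sup>2 / \<xi> j)" if "j \<in> {1..L}" for j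
  proof -
    have "0 < wt t j" "0 < \<xi> j" using that by (rule wt_pos, rule xi_pos)
    then show ?thesis using c by simp
  qed
  show "0 \<le> stab_mean t p" unfolding stab_mean_def
    using level_variance_nonneg[OF p] by (intro sum_nonneg mult_nonneg_nonneg[OF k]) auto
  show "stab_mean t p \<le> (\<Sum>j=1..L. 8 * c / (c - 1) / wt t j * ((\<sigma> j)\<^sup>2 / \<xi> j) * sqrt (real (card (level G j))))"
    unfolding stab_mean_def using k level_variance_le[OF p] by (intro sum_mono mult_left_mono) auto
qed

text \<open>The conditional mean of this quantity given the past is 0: the loss estimates are unbiased
  up to a constant, and \<open>stab_mean\<close> is the conditional mean of \<open>stab\<close>.\<close>

definition slack :: "nat \<Rightarrow> 'v \<Rightarrow> (nat \<Rightarrow> 'e \<times> 'v move) \<Rightarrow> real" where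
  "slack t a h = ((\<Sum>b\<in>leaves G. incr t h b * play t h b) - incr t h a) - excess t a h
     + (stab_mean t (play t h) - stab t h)"

text \<open>Integrability rests on a bound, uniform in past and signal, for the conditional absolute
  mean: estimates and \<open>stab\<close> are nonnegative, so their absolute means are the means
  already computed.\<close>

lemma slack_nonneg:
  assumes t: "t < T" and a: "a \<in> leaves G"
  shows "integrable (law T) (slack t a)" "0 \<le> (\<integral>h. slack t a h \<partial>law T)"
proof -
  define s where "s = (\<Sum>j=1..L. \<sigma> j)"
  define K where "K = (\<Sum>j=1..L. 8 * c / (c - 1) / wt t j * ((\<sigma> j)\<^sup>2 / \<xi> j) * sqrt (real (card (level G j))))"
  have cond: "cexp t h e (slack t a) = 0 \<and> cexp t h e (\<lambda>h. \<bar>slack t a h\<bar>) \<le> 2 * s + 2 * \<sigma> 1 + 2 * K"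
    if h: "h \<in> space (H t)" and e: "e \<in> space S" for h e
  proof -
    define q where "q = play t h"
    have q: "pos_dist q" and qs: "q \<in> prob_simplex G" unfolding q_def by (rule play_pos play_simplex)+
    let ?R = "ftrl_round G n D ord q"
    note int = round_integrable[OF q]
    define y where "y = loss N e"
    have y: "tree_loss \<sigma> y" unfolding y_def by (rule loss_tree[OF e])
    define le where "le m b = loss_estimate G n D ord \<sigma> q y m b" for m b
    define sb where "sb = stab_bound q c \<sigma> (wt t)"
    define av where "av m = 1 / real (n + 1) * (\<Sum>i=1..n+1. y (snd m i))" for m :: "'v move"
    define mean where "mean = (\<Sum>b\<in>leaves G. q b * y b)"
    have Ele: "measure_pmf.expectation ?R (\<lambda>m. le m b) = y b - mean + s" if "b \<in> leaves G" for b
      unfolding le_def mean_def s_def by (rule expectation_loss_estimate[OF q that])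
    have Esum: "measure_pmf.expectation ?R (\<lambda>m. \<Sum>b\<in>leaves G. le m b * q b) = s"
    proof -
      have "measure_pmf.expectation ?R (\<lambda>m. \<Sum>b\<in>leaves G. le m b * q b) = (\<Sum>b\<in>leaves G. (y b - mean + s) * q b)"
        using Ele by (simp add: int Bochner_Integration.integral_sum)
      also have "\<dots> = mean + (s - mean) * (\<Sum>b\<in>leaves G. q b)"
      proof -
        have "(y b - mean + s) * q b = q b * y b + (s - mean) * q b" for b by algebra
        then show ?thesis unfolding mean_def by (simp only: sum.distrib sum_distrib_left[symmetric])
      qed
      finally show ?thesis using simplexD(3)[OF qs] by simp
    qed
    have Eav: "measure_pmf.expectation ?R av = mean"
      unfolding av_def mean_def using expectation_play[OF q, of _ y]
      by (simp add: int Bochner_Integration.integral_sum del: of_nat_add of_nat_Suc)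
    have Esb: "measure_pmf.expectation ?R sb = stab_mean t q"
      unfolding sb_def stab_mean_def by (rule expectation_stab_bound[OF q])
    define F where "F m = ((\<Sum>b\<in>leaves G. le m b * q b) - le m a) - (av m - y a) + (stab_mean t q - sb m)" for m
    \<comment> \<open>A dominating function with explicit mean: nonnegative parts enter with plus
      signs, the excess through \<open>\<sigma> 1\<close>.\<close>
    define F' where "F' m = (\<Sum>b\<in>leaves G. le m b * q b) + le m a + \<sigma> 1 + (stab_mean t q + sb m)" for m
    have eq: "slack t a (h(t := (e, m))) = F m" if m: "m \<in> set_pmf ?R" for m
    proof -
      let ?h = "h(t := (e, m))"
      have p: "play t ?h = q" unfolding q_def by (rule play_upd)
      have inc: "incr t ?h b = le m b" for b
        using incr_support[of ?h t b] m unfolding p le_def y_def by simp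
      have "excess t a ?h = av m - y a"
        unfolding excess_def env_loss_def action_def av_def y_def by simp
      then show ?thesis unfolding slack_def F_def inc p stab_def sb_def by simp
    qed
    have bnd: "\<bar>F m\<bar> \<le> F' m" if m: "m \<in> set_pmf ?R" for m
    proof -
      have le0: "0 \<le> le m b" for b unfolding le_def by (rule loss_estimate_nonneg[OF q m y])
      then have "0 \<le> (\<Sum>b\<in>leaves G. le m b * q b)" using simplex_nonneg[OF qs] by (intro sum_nonneg mult_nonneg_nonneg) auto
      moreover have "m \<in> moves G n" using set_round_moves[OF q] m by blast
      then have "\<bar>av m - y a\<bar> \<le> \<sigma> 1" unfolding av_def average_diff
        by (intro average_le tree_loss_diff[OF y]) (use a in \<open>auto simp: moves_def\<close>)
      moreover have "0 \<le> sb m" unfolding sb_def by (rule stab_bound_nonneg[OF q wt_pos c])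
      moreover have "0 \<le> stab_mean t q" by (rule stab_mean_bounds[OF qs])
      ultimately show ?thesis unfolding F_def F'_def using le0[of a] by linarith
    qed
    have "cexp t h e (slack t a) = measure_pmf.expectation ?R F"
      unfolding alg_play q_def[symmetric] by (intro integral_cong_AE) (auto simp: AE_measure_pmf_iff eq)
    \<comment> \<open>The means are s - (y a - mean + s) for the estimates and mean - y a for the
      excess; the two stability terms cancel.\<close>
    also have "\<dots> = 0"
      unfolding F_def using Ele[OF a] by (simp add: int Esum Eav Esb)
    finally have 1: "cexp t h e (slack t a) = 0" .
    have "cexp t h e (\<lambda>h. \<bar>slack t a h\<bar>) \<le> measure_pmf.expectation ?R F'"
      unfolding alg_play q_def[symmetric] by (intro integral_mono_AE int) (auto simp: AE_measure_pmf_iff eq bnd)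
    also have "\<dots> = s + (y a - mean + s) + \<sigma> 1 + 2 * stab_mean t q"
      unfolding F'_def using Ele[OF a] by (simp add: int Esum Esb)
    also have "y a - mean \<le> \<sigma> 1"
    proof -
      have "y a - mean = (\<Sum>b\<in>leaves G. q b * (y a - y b))"
        unfolding mean_def using simplexD(3)[OF qs] by (simp add: right_diff_distrib sum_subtractf sum_distrib_right[symmetric])
      also have "\<dots> \<le> (\<Sum>b\<in>leaves G. q b * \<sigma> 1)"
        using tree_loss_diff[OF y a] simplex_nonneg[OF qs] by (intro sum_mono mult_left_mono) (auto simp: abs_le_iff)
      finally show ?thesis using simplexD(3)[OF qs] by (simp add: sum_distrib_right[symmetric])
    qed
    also have "stab_mean t q \<le> K" unfolding K_def by (rule stab_mean_bounds[OF qs])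
    finally have 2: "cexp t h e (\<lambda>h. \<bar>slack t a h\<bar>) \<le> 2 * s + 2 * \<sigma> 1 + 2 * K" by simp
    show ?thesis using 1 2 by simp
  qed
  have meas: "slack t a \<in> borel_measurable (H (Suc t))"
    unfolding slack_def[abs_def]
    by (intro borel_measurable_add borel_measurable_diff borel_measurable_sum borel_measurable_times
        incr_measurable play_measurable excess_measurable stab_mean_measurable stab_measurable a) auto
  have dep: "slack t a (restrict h {0..<Suc t}) = slack t a h" for h
    unfolding slack_def incr_restrict play_restrict stab_def excess_def env_loss_def action_def by simp
  have bound: "cexp t h e (\<lambda>h. \<bar>slack t a h\<bar>) \<le> 2 * s + 2 * \<sigma> 1 + 2 * K"
    and nonneg: "0 \<le> cexp t h e (slack t a)" if "h \<in> space (H t)" "e \<in> space S" for h e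
    using cond[OF that] by (blast, metis order_refl)
  show "integrable (law T) (slack t a)" by (rule cond_nonneg(1)[OF t meas dep bound nonneg])
  show "0 \<le> (\<integral>h. slack t a h \<partial>law T)" by (rule cond_nonneg(2)[OF t meas dep bound nonneg])
qed

section \<open>From the pathwise inequality to the regret\<close>

text \<open>With \<open>stab\<close> exchanged for its conditional mean, the bound depends on the
  history only through the plays and can be estimated pointwise.\<close>

definition total :: "nat \<Rightarrow> (nat \<Rightarrow> 'e \<times> 'v move) \<Rightarrow> real" where
  "total T h = (\<Sum>j=1..L. gam j * thr j * level_entropy j (play 0 h))
     + (\<Sum>t<T. \<Sum>j=1..L. gam j / sqrt (real (Suc t)) * level_entropy j (play t h))
     + (\<Sum>t<T. stab_mean t (play t h))"

text \<open>The FTRL inequality is deterministic as soon as every move lies in the support of its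
  sampling law, which holds almost surely. The differences between actual and mean quantities are
  what \<open>slack\<close> absorbs.\<close>

lemma excess_pathwise:
  assumes T: "1 \<le> T" and a: "a \<in> leaves G"
  shows "AE h in law T. (\<Sum>t<T. excess t a h) \<le> total T h - (\<Sum>t<T. slack t a h)"
proof -
  have "AE h in law T. \<forall>t\<in>{..<T}. snd (h t) \<in> set_pmf (alg t (observe G n N t h))"
    by (intro AE_finite_allI AE_support) auto
  then show ?thesis using AE_space
  proof eventually_elim
    fix h assume sup: "\<forall>t\<in>{..<T}. snd (h t) \<in> set_pmf (alg t (observe G n N t h))" and "h \<in> space (law T)"
    then have h: "h \<in> space (H T)" by (simp add: space_law)
    have "(\<Sum>t<T. (\<Sum>b\<in>leaves G. incr t h b * play t h b) - incr t h a)
      \<le> (\<Sum>t<T. stab t h) + (\<Sum>j=1..L. wt 0 j * level_entropy j (play 0 h))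
        + (\<Sum>t\<in>{1..<T}. \<Sum>j=1..L. (wt t j - wt (t - 1) j) * level_entropy j (play t h))"
    proof (rule ftrl_telescope[where Z="\<lambda>t. estim t h", OF play_min _ _ _ T a])
      fix t q assume t: "t < T" and q: "q \<in> prob_simplex G"
      have m: "snd (h t) \<in> set_pmf (ftrl_round G n D ord (play t h))" using sup t alg_play by auto
      show "obj (wt t) (estim t h) (play t h) + (\<Sum>a\<in>leaves G. incr t h a * play t h a) - stab t h
        \<le> obj (wt t) (estim t h) q + (\<Sum>a\<in>leaves G. incr t h a * q a)"
        unfolding incr_support[of h t, OF m] stab_def
        using ftrl_round_step[OF play_min _ c q m loss_tree[OF hist_space_move(1)[OF h t]] wt_lower] wt_pos by blast
    qed (simp_all add: estim_0 estim_Suc)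
    moreover have "(\<Sum>j=1..L. wt 0 j * level_entropy j (play 0 h))
        + (\<Sum>t\<in>{1..<T}. \<Sum>j=1..L. (wt t j - wt (t - 1) j) * level_entropy j (play t h))
      \<le> (\<Sum>j=1..L. gam j * thr j * level_entropy j (play 0 h))
        + (\<Sum>t<T. \<Sum>j=1..L. gam j / sqrt (real (Suc t)) * level_entropy j (play t h))"
      by (rule penalty_bound[where p="\<lambda>t. play t h"])
        (use wt_def gam_pos less_imp_le thr_nonneg play_simplex T in blast)+
    ultimately show "(\<Sum>t<T. excess t a h) \<le> total T h - (\<Sum>t<T. slack t a h)"
      unfolding total_def slack_def by (simp add: sum.distrib sum_subtractf)
  qed
qed

lemma law_measurable: "f \<in> borel_measurable (H T) \<Longrightarrow> f \<in> borel_measurable (law T)"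
  by (simp cong: measurable_cong_sets)

lemma law_integrable_bounded:
  fixes f :: "_ \<Rightarrow> real"
  assumes "f \<in> borel_measurable (H T)" "\<And>h. h \<in> space (H T) \<Longrightarrow> \<bar>f h\<bar> \<le> B"
  shows "integrable (law T) f"
proof -
  interpret prob_space "law T" by (rule prob_space_law)
  show ?thesis by (rule integrable_const_bound[where B=B]) (use assms in \<open>auto simp: space_law intro!: law_measurable\<close>)
qed

lemma total_integrable: "integrable (law T) (total T)"
proof -
  have e: "integrable (law T) (\<lambda>h. level_entropy j (play t h))" if "t \<le> T" "j \<in> {1..L}" for t j
  proof (rule law_integrable_bounded[OF level_sums_measurable(1)[OF that(1)]])
    fix h
    show "\<bar>level_entropy j (play t h)\<bar> \<le> sqrt (real (card (level G j)))"
      using level_entropy_le[OF play_simplex[of t h], of j] level_entropy_nonneg[OF play_simplex[of t h], of j] that by simp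
  qed
  have s: "integrable (law T) (\<lambda>h. stab_mean t (play t h))" if "t \<le> T" for t
  proof (rule law_integrable_bounded[OF stab_mean_measurable[OF that]])
    fix h
    show "\<bar>stab_mean t (play t h)\<bar> \<le> (\<Sum>j=1..L. 8 * c / (c - 1) / wt t j * ((\<sigma> j)\<^sup>2 / \<xi> j) * sqrt (real (card (level G j))))"
      using stab_mean_bounds[OF play_simplex[of t h], of t] by simp
  qed
  show ?thesis unfolding total_def[abs_def]
    by (intro Bochner_Integration.integrable_add Bochner_Integration.integrable_sum integrable_mult_right e s) auto
qed

lemma excess_integrable: "t < T \<Longrightarrow> a \<in> leaves G \<Longrightarrow> integrable (law T) (excess t a)"
  by (rule law_integrable_bounded[OF excess_measurable excess_bounded])

lemma excess_integral_le:
  assumes T: "1 \<le> T" and a: "a \<in> leaves G"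
  shows "(\<integral>h. (\<Sum>t<T. excess t a h) \<partial>law T) \<le> (\<integral>h. total T h \<partial>law T)"
proof -
  have s: "integrable (law T) (\<lambda>h. \<Sum>t<T. slack t a h)" "0 \<le> (\<integral>h. (\<Sum>t<T. slack t a h) \<partial>law T)"
    using slack_nonneg[OF _ a] by (auto simp: Bochner_Integration.integral_sum intro!: sum_nonneg)
  have "(\<integral>h. (\<Sum>t<T. excess t a h) \<partial>law T) \<le> (\<integral>h. total T h - (\<Sum>t<T. slack t a h) \<partial>law T)"
    by (intro integral_mono_AE excess_pathwise T a Bochner_Integration.integrable_diff total_integrable s(1)
        Bochner_Integration.integrable_sum excess_integrable) auto
  also have "\<dots> \<le> (\<integral>h. total T h \<partial>law T)"
    using s total_integrable by (subst Bochner_Integration.integral_diff) auto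
  finally show ?thesis .
qed

text \<open>Integrability of the losses enters here, where the comparator's expected loss is
  separated from the bounded excess.\<close>

lemma regret_le_total:
  assumes T: "1 \<le> T" and int: "integrable_losses G n N alg T"
  shows "regret G n N alg T \<le> (\<integral>h. total T h \<partial>law T)"
proof -
  let ?best = "\<lambda>a. \<integral>h. (\<Sum>t<T. env_loss N h t a) \<partial>law T"
  have "Min (?best ` leaves G) \<in> ?best ` leaves G" using leaves_nonempty by (intro Min_in) auto
  then obtain a where a: "a \<in> leaves G" and best: "Min (?best ` leaves G) = ?best a" by blast
  have ia: "integrable (law T) (\<lambda>h. \<Sum>t<T. env_loss N h t a)"
    using int a unfolding integrable_losses_def by (intro Bochner_Integration.integrable_sum) auto
  have ie: "integrable (law T) (\<lambda>h. \<Sum>t<T. excess t a h)"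
    using a by (intro Bochner_Integration.integrable_sum excess_integrable) auto
  have "(\<Sum>t<T. 1 / real (n+1) * (\<Sum>i=1..n+1. env_loss N h t (action h t i)))
      = (\<Sum>t<T. excess t a h) + (\<Sum>t<T. env_loss N h t a)" for h
    unfolding excess_def by (simp add: sum_subtractf)
  then have "regret G n N alg T = (\<integral>h. (\<Sum>t<T. excess t a h) \<partial>law T)"
    unfolding regret_def best using ia ie by simp
  then show ?thesis using excess_integral_le[OF T a] by simp
qed

text \<open>Every action of a round has conditional law \<open>play t h\<close>, so both sides have
  equal conditional means; \<open>cond_nonneg\<close> yields the direction that self-bounding
  needs.\<close>

lemma expected_gap_ge:
  "(\<integral>h. (\<Sum>t<T. \<Sum>a\<in>leaves G. play t h a * \<Delta> a) \<partial>law T) \<le> expected_gap G n N alg T \<Delta>"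
    "integrable (law T) (\<lambda>h. \<Sum>t<T. \<Sum>a\<in>leaves G. play t h a * \<Delta> a)"
proof -
  define av where "av t h = 1 / real (n + 1) * (\<Sum>i=1..n+1. \<Delta> (action h t i))" for t and h :: "nat \<Rightarrow> 'e \<times> 'v move"
  define mn where "mn t h = (\<Sum>a\<in>leaves G. play t h a * \<Delta> a)" for t h
  define B where "B = (\<Sum>a\<in>leaves G. \<bar>\<Delta> a\<bar>)"
  have B: "\<bar>\<Delta> a\<bar> \<le> B" if "a \<in> leaves G" for a
    unfolding B_def using that by (intro member_le_sum) auto
  have avB: "\<bar>av t h\<bar> \<le> B" if "h \<in> space (H T)" "t < T" for t T h
    unfolding av_def by (intro average_le B hist_space_move[OF that])
  have mnB: "\<bar>mn t h\<bar> \<le> B" for t h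
  proof -
    have "\<bar>mn t h\<bar> \<le> (\<Sum>a\<in>leaves G. \<bar>play t h a * \<Delta> a\<bar>)" unfolding mn_def by (rule sum_abs)
    also have "\<dots> \<le> B" unfolding B_def
      using simplex_nonneg[OF play_simplex] simplex_le_1[OF play_simplex]
      by (intro sum_mono) (simp add: abs_mult mult_left_le_one_le)
    finally show ?thesis .
  qed
  have avm: "av t \<in> borel_measurable (H u)" if "t < u" for t u
    unfolding av_def[abs_def] using that
    by (intro borel_measurable_times borel_measurable_const borel_measurable_sum action_measurable[where f="\<lambda>h. \<Delta>"]) auto
  have mnm: "mn t \<in> borel_measurable (H u)" if "t < u" for t u
    unfolding mn_def[abs_def] using that
    by (intro borel_measurable_times borel_measurable_const borel_measurable_sum play_measurable) auto
  have ai: "integrable (law T) (av t)" and mi: "integrable (law T) (mn t)" if "t < T" for t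
    by (rule law_integrable_bounded[OF avm avB] law_integrable_bounded[OF mnm mnB]; use that in simp)+
  have le: "(\<integral>h. mn t h \<partial>law T) \<le> (\<integral>h. av t h \<partial>law T)" if t: "t < T" for t
  proof -
    have cond: "cexp t h e (\<lambda>h. av t h - mn t h) = 0 \<and> cexp t h e (\<lambda>h. \<bar>av t h - mn t h\<bar>) \<le> 2 * B"
      if h: "h \<in> space (H t)" and e: "e \<in> space S" for h e
    proof -
      define q where "q = play t h"
      have q: "pos_dist q" unfolding q_def by (rule play_pos)
      let ?R = "ftrl_round G n D ord q"
      note int = round_integrable[OF q]
      have a: "av t (h(t := (e, m))) = 1 / real (n + 1) * (\<Sum>i=1..n+1. \<Delta> (snd m i))" for m
        unfolding av_def action_def by simp
      have m: "mn t (h(t := (e, m))) = (\<Sum>a\<in>leaves G. q a * \<Delta> a)" for m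
        unfolding mn_def play_upd q_def ..
      have "cexp t h e (\<lambda>h. av t h - mn t h) = 0"
        unfolding alg_play q_def[symmetric] a m using expectation_play[OF q, of _ \<Delta>]
        by (simp add: int Bochner_Integration.integral_sum del: of_nat_add of_nat_Suc)
      moreover have "cexp t h e (\<lambda>h. \<bar>av t h - mn t h\<bar>) \<le> measure_pmf.expectation ?R (\<lambda>m. 2 * B)"
        unfolding alg_play q_def[symmetric]
      proof (intro integral_mono_AE int AE_pmfI)
        fix m' assume "m' \<in> set_pmf ?R"
        then have "m' \<in> moves G n" using set_round_moves[OF q] by blast
        then have "\<bar>av t (h(t := (e, m')))\<bar> \<le> B"
          unfolding a by (intro average_le B) (auto simp: moves_def)
        then show "\<bar>av t (h(t := (e, m'))) - mn t (h(t := (e, m')))\<bar> \<le> 2 * B"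
          using mnB[of t "h(t := (e, m'))"] by linarith
      qed
      ultimately show ?thesis by simp
    qed
    have bound: "cexp t h e (\<lambda>h. \<bar>av t h - mn t h\<bar>) \<le> 2 * B"
      and nonneg: "0 \<le> cexp t h e (\<lambda>h. av t h - mn t h)" if "h \<in> space (H t)" "e \<in> space S" for h e
      using cond[OF that] by (blast, metis order_refl)
    have "0 \<le> (\<integral>h. av t h - mn t h \<partial>law T)"
    proof (rule cond_nonneg(2)[OF t _ _ bound nonneg])
      show "(\<lambda>h. av t h - mn t h) \<in> borel_measurable (H (Suc t))"
        by (intro borel_measurable_diff avm mnm) auto
      show "av t (restrict h {0..<Suc t}) - mn t (restrict h {0..<Suc t}) = av t h - mn t h" for h
        unfolding av_def mn_def play_restrict action_def by simp
    qed
    then show ?thesis using ai[OF t] mi[OF t] by simp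
  qed
  have "(\<Sum>t<T. \<integral>h. mn t h \<partial>law T) \<le> (\<Sum>t<T. \<integral>h. av t h \<partial>law T)" by (intro sum_mono le) auto
  then show "(\<integral>h. (\<Sum>t<T. \<Sum>a\<in>leaves G. play t h a * \<Delta> a) \<partial>law T) \<le> expected_gap G n N alg T \<Delta>"
    unfolding expected_gap_def av_def[symmetric] mn_def[symmetric] using ai mi by (simp add: Bochner_Integration.integral_sum)
  show "integrable (law T) (\<lambda>h. \<Sum>t<T. \<Sum>a\<in>leaves G. play t h a * \<Delta> a)"
    unfolding mn_def[symmetric] using mi by (intro Bochner_Integration.integrable_sum) auto
qed

text \<open>The square of \<open>gam j\<close> is \<open>16 * c / (c - 1)\<close> times \<sigma>^2 /
  \<xi>, so the stability coefficient is half that square divided by the weight. As the weight is at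
  least \<open>gam j\<close> times the root of the round number, this is half the penalty
  coefficient.\<close>

lemma total_le:
  "total T h \<le> (\<Sum>j=1..L. 4 * c * \<sigma> j / \<xi> j * level_entropy j (play 0 h))
    + (\<Sum>t<T. \<Sum>j=1..L. gam j / sqrt (real (Suc t)) * (level_entropy j (play t h) + level_variance j (play t h) / 2))"
proof -
  have "stab_mean t p \<le> (\<Sum>j=1..L. gam j / sqrt (real (Suc t)) * (level_variance j p / 2))"
    if p: "p \<in> prob_simplex G" for t p
    unfolding stab_mean_def
  proof (rule sum_mono)
    fix j assume j: "j \<in> {1..L}"
    define g r where "g = gam j" and "r = sqrt (real (Suc t))"
    have g: "0 < g" and r: "0 < r" using gam_pos[OF j] by (auto simp: g_def r_def)
    have sq: "8 * c / (c - 1) * ((\<sigma> j)\<^sup>2 / \<xi> j) = g\<^sup>2 / 2"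
      using xi_pos[OF j] c unfolding g_def gam_def by (simp add: power_mult_distrib power_divide field_simps)
    have "8 * c / (c - 1) / wt t j * ((\<sigma> j)\<^sup>2 / \<xi> j) = g\<^sup>2 / 2 / wt t j"
      unfolding sq[symmetric] by simp
    also have "\<dots> \<le> g\<^sup>2 / 2 / (g * r)"
    proof (rule divide_left_mono)
      show "g * r \<le> wt t j" unfolding wt_def g_def r_def using g by (intro mult_left_mono) (auto simp: g_def)
    qed (use g r wt_pos[OF j] in auto)
    also have "\<dots> = g / r / 2" using g by (simp add: power2_eq_square)
    finally have "8 * c / (c - 1) / wt t j * ((\<sigma> j)\<^sup>2 / \<xi> j) * level_variance j p \<le> g / r / 2 * level_variance j p"
      using level_variance_nonneg[OF p] j by (intro mult_right_mono) auto
    then show "8 * c / (c - 1) / wt t j * ((\<sigma> j)\<^sup>2 / \<xi> j) * level_variance j p \<le> gam j / sqrt (real (Suc t)) * (level_variance j p / 2)"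
      unfolding g_def r_def by simp
  qed
  then have "(\<Sum>t<T. stab_mean t (play t h)) \<le> (\<Sum>t<T. \<Sum>j=1..L. gam j / sqrt (real (Suc t)) * (level_variance j (play t h) / 2))"
    using play_simplex by (intro sum_mono) blast
  moreover have "(\<Sum>j=1..L. gam j * thr j * level_entropy j (play 0 h)) = (\<Sum>j=1..L. 4 * c * \<sigma> j / \<xi> j * level_entropy j (play 0 h))"
    by (intro sum.cong refl) (simp only: gam_thr)
  ultimately show ?thesis unfolding total_def by (simp only: distrib_left sum.distrib)
qed

lemma offset_le:
  "(\<Sum>j=1..L. 4 * c * \<sigma> j / \<xi> j * level_entropy j (play 0 h)) \<le> 4 * c * (\<Sum>j=1..L. \<sigma> j / \<xi> j * sqrt (real (card (level G j))))"
proof -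
  have "(\<Sum>j=1..L. 4 * c * \<sigma> j / \<xi> j * level_entropy j (play 0 h)) \<le> (\<Sum>j=1..L. 4 * c * \<sigma> j / \<xi> j * sqrt (real (card (level G j))))"
    using level_entropy_le[OF play_simplex] \<sigma>_pos xi_pos c
    by (intro sum_mono mult_left_mono divide_nonneg_nonneg mult_nonneg_nonneg) (auto simp: less_imp_le)
  then show ?thesis by (simp add: sum_distrib_left mult.assoc)
qed

lemma offset_nonneg: "0 \<le> (\<Sum>j=1..L. \<sigma> j / \<xi> j * sqrt (real (card (level G j))))"
  using \<sigma>_pos xi_pos by (intro sum_nonneg mult_nonneg_nonneg divide_nonneg_nonneg) (auto simp: less_imp_le)

text \<open>The constant 16 is 4 from \<open>gam\<close>, 2 for entropy plus half the variance, and
  2 from the sum of inverse roots.\<close>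

theorem worst_case_bound:
  assumes T: "1 \<le> T" and int: "integrable_losses G n N alg T"
  shows "regret G n N alg T
    \<le> 6 * c * (\<Sum>j=1..L. \<sigma> j / \<xi> j * sqrt (real (card (level G j))))
       + 16 * sqrt c / sqrt (c - 1) * (\<Sum>j=1..L. \<sigma> j / sqrt (\<xi> j) * sqrt (real (card (level G j)) * real T))"
proof -
  interpret prob_space "law T" by (rule prob_space_law)
  let ?A = "\<Sum>j=1..L. \<sigma> j / \<xi> j * sqrt (real (card (level G j)))"
  let ?V = "\<lambda>j. sqrt (real (card (level G j)))"
  have gam0: "0 \<le> gam j" if "j \<in> {1..L}" for j using gam_pos[OF that] by simp
  have "total T h \<le> 6 * c * ?A + 16 * sqrt c / sqrt (c - 1) * (\<Sum>j=1..L. \<sigma> j / sqrt (\<xi> j) * sqrt (real (card (level G j)) * real T))" for h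
  proof -
    have "(\<Sum>t<T. \<Sum>j=1..L. gam j / sqrt (real (Suc t)) * (level_entropy j (play t h) + level_variance j (play t h) / 2))
      \<le> (\<Sum>t<T. \<Sum>j=1..L. gam j / sqrt (real (Suc t)) * (2 * ?V j))"
    proof (intro sum_mono mult_left_mono)
      fix t j assume "j \<in> {1..L}"
      then have "level_entropy j (play t h) \<le> ?V j" "level_variance j (play t h) \<le> ?V j"
        using level_entropy_le[OF play_simplex] level_variance_le[OF play_simplex] by auto
      then show "level_entropy j (play t h) + level_variance j (play t h) / 2 \<le> 2 * ?V j"
        using real_sqrt_ge_zero[of "real (card (level G j))"] by linarith
    qed (use gam0 in auto)
    also have "\<dots> = (\<Sum>j=1..L. 2 * gam j * ?V j * (\<Sum>t<T. 1 / sqrt (real (Suc t))))"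
      by (subst sum.swap) (simp add: sum_distrib_left mult_ac)
    also have "\<dots> \<le> (\<Sum>j=1..L. 2 * gam j * ?V j * (2 * sqrt (real T)))"
      using gam0 by (intro sum_mono mult_left_mono sum_inverse_sqrt_le) auto
    also have "\<dots> = 16 * sqrt c / sqrt (c - 1) * (\<Sum>j=1..L. \<sigma> j / sqrt (\<xi> j) * sqrt (real (card (level G j)) * real T))"
      unfolding gam_def by (simp add: sum_distrib_left real_sqrt_mult mult_ac)
    finally have "(\<Sum>t<T. \<Sum>j=1..L. gam j / sqrt (real (Suc t)) * (level_entropy j (play t h) + level_variance j (play t h) / 2))
      \<le> 16 * sqrt c / sqrt (c - 1) * (\<Sum>j=1..L. \<sigma> j / sqrt (\<xi> j) * sqrt (real (card (level G j)) * real T))" .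
    \<comment> \<open>The threshold part of the initial weight contributes the factor
      \<open>4 * c\<close>, relaxed here to the stated one.\<close>
    moreover have "4 * c * ?A \<le> 6 * c * ?A" using offset_nonneg c by (intro mult_right_mono) auto
    ultimately show ?thesis using total_le[of T h] offset_le[of h] by linarith
  qed
  then have "(\<integral>h. total T h \<partial>law T) \<le> 6 * c * ?A + 16 * sqrt c / sqrt (c - 1) * (\<Sum>j=1..L. \<sigma> j / sqrt (\<xi> j) * sqrt (real (card (level G j)) * real T))"
    by (intro integral_le_const total_integrable AE_I2)
  then show ?thesis using regret_le_total[OF T int] by linarith
qed

text \<open>Self-bounding: twice the upper bound for the regret minus the lower bound for it is an upper
  bound in which each round contributes at most \<open>max\<^sub>x (u * sqrt x - x) = u\<^sup>2 / 4\<close>.\<close>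

theorem gap_bound:
  assumes T: "1 \<le> T" and int: "integrable_losses G n N alg T"
    and \<Delta>: "\<forall>a\<in>leaves G. 0 \<le> \<Delta> a" and unique: "card {a \<in> leaves G. \<Delta> a = 0} \<le> 1"
    and gap: "expected_gap G n N alg T \<Delta> \<le> regret G n N alg T"
  shows "regret G n N alg T
    \<le> 12 * c * (\<Sum>j=1..L. \<sigma> j / \<xi> j * sqrt (real (card (level G j))))
      + 64 * c / (c - 1) * (\<Sum>j=1..L. \<sigma> j / sqrt (\<xi> j) * sqrt (gap_complexity G j \<Delta>))\<^sup>2 * ln (exp 1 * real T)"
proof -
  interpret prob_space "law T" by (rule prob_space_law)
  let ?A = "\<Sum>j=1..L. \<sigma> j / \<xi> j * sqrt (real (card (level G j)))"
  define W where "W = (\<Sum>j=1..L. \<sigma> j / sqrt (\<xi> j) * sqrt (gap_complexity G j \<Delta>))"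
  define d where "d t h = (\<Sum>a\<in>leaves G. play t h a * \<Delta> a)" for t h
  have gam0: "0 \<le> gam j" if "j \<in> {1..L}" for j using gam_pos[OF that] by simp
  have d0: "0 \<le> d t h" for t h unfolding d_def using simplex_nonneg[OF play_simplex] \<Delta> by (intro sum_nonneg) auto
  have gamW: "(\<Sum>j=1..L. gam j * sqrt (gap_complexity G j \<Delta>)) = 4 * sqrt c / sqrt (c - 1) * W"
    unfolding W_def gam_def sum_distrib_left by (simp only: mult.assoc)
  have round: "2 * (\<Sum>j=1..L. gam j / sqrt (real (Suc t)) * (level_entropy j (play t h) + level_variance j (play t h) / 2)) - d t h
    \<le> 64 * c / (c - 1) * W\<^sup>2 * (1 / real (Suc t))" for t h
  proof -
    define r where "r = sqrt (real (Suc t))"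
    have r: "0 < r" "r\<^sup>2 = real (Suc t)" by (auto simp: r_def)
    have "(\<Sum>j=1..L. gam j / r * (level_entropy j (play t h) + level_variance j (play t h) / 2))
      \<le> (\<Sum>j=1..L. gam j / r * (2 * sqrt (d t h * gap_complexity G j \<Delta>)))"
    proof (intro sum_mono mult_left_mono)
      fix j assume "j \<in> {1..L}"
      then have j: "j \<le> L" by simp
      show "level_entropy j (play t h) + level_variance j (play t h) / 2 \<le> 2 * sqrt (d t h * gap_complexity G j \<Delta>)"
        using level_gap_bounds[OF \<Delta> unique play_simplex[of t h] j] sum_sqrt_gap_nodes[OF \<Delta> play_simplex[of t h] j]
        unfolding d_def by linarith
    qed (use gam0 r in auto)
    also have "\<dots> = 2 / r * sqrt (d t h) * (\<Sum>j=1..L. gam j * sqrt (gap_complexity G j \<Delta>))"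
      by (simp add: sum_distrib_left real_sqrt_mult mult_ac)
    also have "\<dots> = 8 * sqrt c / sqrt (c - 1) * W / r * sqrt (d t h)"
      unfolding gamW by (simp add: mult_ac)
    finally have "(\<Sum>j=1..L. gam j / r * (level_entropy j (play t h) + level_variance j (play t h) / 2))
      \<le> 8 * sqrt c / sqrt (c - 1) * W / r * sqrt (d t h)" .
    moreover have "16 * sqrt c / sqrt (c - 1) * W / r * sqrt (d t h) = 2 * (8 * sqrt c / sqrt (c - 1) * W / r * sqrt (d t h))"
      by simp
    ultimately have le: "2 * (\<Sum>j=1..L. gam j / r * (level_entropy j (play t h) + level_variance j (play t h) / 2))
      \<le> 16 * sqrt c / sqrt (c - 1) * W / r * sqrt (d t h)"
      by linarith
    \<comment> \<open>The 16 is 4 from \<open>gam\<close>, 2 from the bound by the gap nodes and 2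
      from doubling the regret; squared and divided by 4 it gives the constant 64.\<close>
    define u x where "u = 16 * sqrt c / sqrt (c - 1) * W / r" and "x = sqrt (d t h)"
    have "u * x - x\<^sup>2 \<le> u\<^sup>2 / 4"
    proof -
      have "0 \<le> (u / 2 - x)\<^sup>2" by simp
      then show ?thesis by (simp add: power2_eq_square algebra_simps)
    qed
    moreover have "x\<^sup>2 = d t h" unfolding x_def using d0 by simp
    moreover have "u\<^sup>2 / 4 = 64 * c / (c - 1) * W\<^sup>2 * (1 / real (Suc t))"
      unfolding u_def using c by (simp add: power_mult_distrib power_divide r(2) del: of_nat_Suc)
    ultimately show ?thesis using le unfolding u_def x_def r_def by linarith
  qed
  have pointwise: "2 * total T h - (\<Sum>t<T. d t h) \<le> 12 * c * ?A + 64 * c / (c - 1) * W\<^sup>2 * ln (exp 1 * real T)" for h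
  proof -
    have "2 * (\<Sum>t<T. \<Sum>j=1..L. gam j / sqrt (real (Suc t)) * (level_entropy j (play t h) + level_variance j (play t h) / 2)) - (\<Sum>t<T. d t h)
      = (\<Sum>t<T. 2 * (\<Sum>j=1..L. gam j / sqrt (real (Suc t)) * (level_entropy j (play t h) + level_variance j (play t h) / 2)) - d t h)"
      by (simp only: sum_subtractf sum_distrib_left)
    also have "\<dots> \<le> (\<Sum>t<T. 64 * c / (c - 1) * W\<^sup>2 * (1 / real (Suc t)))"
      by (intro sum_mono round)
    also have "\<dots> = 64 * c / (c - 1) * W\<^sup>2 * (\<Sum>t<T. 1 / real (Suc t))" by (simp only: sum_distrib_left)
    also have "\<dots> \<le> 64 * c / (c - 1) * W\<^sup>2 * ln (exp 1 * real T)"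
      using c by (intro mult_left_mono sum_inverse_le_ln T) auto
    finally have "2 * (\<Sum>t<T. \<Sum>j=1..L. gam j / sqrt (real (Suc t)) * (level_entropy j (play t h) + level_variance j (play t h) / 2)) - (\<Sum>t<T. d t h)
      \<le> 64 * c / (c - 1) * W\<^sup>2 * ln (exp 1 * real T)" .
    moreover have "2 * (4 * c * ?A) \<le> 12 * c * ?A"
    proof -
      have "8 * c * ?A \<le> 12 * c * ?A" using offset_nonneg c by (intro mult_right_mono) auto
      then show ?thesis by simp
    qed
    ultimately show ?thesis using total_le[of T h] offset_le[of h] by linarith
  qed
  have di: "integrable (law T) (\<lambda>h. \<Sum>t<T. d t h)" unfolding d_def by (rule expected_gap_ge(2))
  have "regret G n N alg T \<le> 2 * regret G n N alg T - expected_gap G n N alg T \<Delta>" using gap by simp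
  also have "\<dots> \<le> 2 * (\<integral>h. total T h \<partial>law T) - (\<integral>h. (\<Sum>t<T. d t h) \<partial>law T)"
    using regret_le_total[OF T int] expected_gap_ge(1)[of T \<Delta>] unfolding d_def by linarith
  also have "\<dots> = (\<integral>h. 2 * total T h - (\<Sum>t<T. d t h) \<partial>law T)"
    using total_integrable di by simp
  also have "\<dots> \<le> 12 * c * ?A + 64 * c / (c - 1) * W\<^sup>2 * ln (exp 1 * real T)"
    using total_integrable di by (intro integral_le_const AE_I2 pointwise) auto
  finally show ?thesis unfolding W_def .
qed

end

theorem theorem8:
  fixes G :: "'v rtree" and L n T :: nat and \<sigma> :: "nat \<Rightarrow> real" and c :: real
    and D :: "nat set pmf" and ord :: "nat set \<Rightarrow> nat \<Rightarrow> nat"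
    and N :: "('e, 'v) environment"
  defines "\<xi> \<equiv> incl_prob D"
    and "alg \<equiv> ftrl G n (regularizer G L \<sigma> D c) \<sigma> D ord"
  assumes tree: "rooted_tree G" "\<forall>a \<in> leaves G. depth G a = L" "1 \<le> L"
    and n: "1 \<le> n" "n \<le> L"
    and scales: "\<forall>i j. 1 \<le> i \<and> i \<le> j \<and> j \<le> L \<longrightarrow> \<sigma> j \<le> \<sigma> i" "0 < \<sigma> L" "\<sigma> (L + 1) = 0"
    and D: "set_pmf D \<subseteq> {S. S \<subseteq> {1..L} \<and> card S = n}"
    and xi_pos: "\<forall>j \<in> {1..L}. 0 < \<xi> j"
    and order: "order_on_subsets L n ord"
    and c: "2 \<le> c"
    and env: "tree_environment G L \<sigma> n N"
    and T: "1 \<le> T"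
    and integrable: "integrable_losses G n N alg T"
  shows "regret G n N alg T
           \<le> 6 * c * (\<Sum>j=1..L. \<sigma> j / \<xi> j * sqrt (real (card (level G j))))
             + 16 * sqrt c / sqrt (c - 1) *
               (\<Sum>j=1..L. \<sigma> j / sqrt (\<xi> j) * sqrt (real (card (level G j)) * real T))
       \<and> (\<forall>\<Delta> :: 'v \<Rightarrow> real.
            (\<forall>a \<in> leaves G. 0 \<le> \<Delta> a) \<and> card {a \<in> leaves G. \<Delta> a = 0} \<le> 1 \<and>
            (\<forall>\<pi>. is_learner G n \<pi> \<and> integrable_losses G n N \<pi> T \<longrightarrow>
                 expected_gap G n N \<pi> T \<Delta> \<le> regret G n N \<pi> T)
            \<longrightarrow> regret G n N alg T
                  \<le> 12 * c * (\<Sum>j=1..L. \<sigma> j / \<xi> j * sqrt (real (card (level G j))))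
                    + 64 * c / (c - 1) *
                      (\<Sum>j=1..L. \<sigma> j / sqrt (\<xi> j) * sqrt (gap_complexity G j \<Delta>))\<^sup>2 *
                      ln (exp 1 * real T))"
proof -
  interpret game: tree_game G L n D ord \<sigma> c N
    by unfold_locales (fact tree D order scales c env | use xi_pos[unfolded \<xi>_def] in blast)+
  note int = integrable[unfolded alg_def]
  \<comment> \<open>The gap hypothesis is instantiated at the algorithm itself, hence the need for
    \<open>alg_learner\<close>.\<close>
  show ?thesis unfolding \<xi>_def alg_def
    using game.worst_case_bound[OF T int] game.gap_bound[OF T int] game.alg_learner int by blast
qed

end
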